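(* Let $p$ be an odd prime and let $G$ be a finite $p$-group of nilpotency class $c\ge p$. Then $\exp(G\wedge G)\mid (\exp(G))^n$, where $n=1+\left\lceil \log_{p-1}\left(\frac{c+1}{p+1}\right)\right\rceil$. In particular, $\exp(M(G))\mid (\exp(G))^n$.
   Context: $\exp(X)$ denotes the exponent of a group $X$. Write ${}^g h=ghg^{-1}$. The nonabelian tensor square $G\otimes G$ is the group generated by symbols $g\otimes h$ ($g,h\in G$) subject to the relations $gg'\otimes h=({}^g g'\otimes {}^g h)(g\otimes h)$ and $g\otimes hh'=(g\otimes h)({}^h g\otimes {}^h h')$ for all $g,g',h,h'\in G$. The (nonabelian) exterior square is $G\wedge G=(G\otimes G)/\nabla(G)$, where $\nabla(G)$ is the subgroup generated by all $x\otimes x$, $x\in G$. The Schur multiplier is $M(G)=H_2(G,\mathbb{Z})$; it is isomorphic to the kernel of the homomorphism $G\wedge G\to [G,G]$, $g\wedge h\mapsto [g,h]=ghg^{-1}h^{-1}$. *)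

theory Defs
  imports "HOL-Algebra.Generated_Groups" "HOL-Algebra.Elementary_Groups"
    "HOL-Algebra.Free_Abelian_Groups" "HOL-Computational_Algebra.Primes" Complex_Main
begin

section \<open>Exponent and nilpotency class\<close>

text \<open>The exponent is \<open>0\<close> if the group has no finite exponent. In particular, a statement
  \<open>group_exponent H dvd m\<close> with \<open>m > 0\<close> asserts that \<open>H\<close> has finite exponent.\<close>

definition group_exponent :: "('a, 'm) monoid_scheme \<Rightarrow> nat" where
  "group_exponent G =
     (if \<exists>n>0. \<forall>x\<in>carrier G. x [^]\<^bsub>G\<^esub> (n::nat) = \<one>\<^bsub>G\<^esub>
      then LEAST n. n > 0 \<and> (\<forall>x\<in>carrier G. x [^]\<^bsub>G\<^esub> (n::nat) = \<one>\<^bsub>G\<^esub>)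
      else 0)"

definition conjugate :: "('a, 'm) monoid_scheme \<Rightarrow> 'a \<Rightarrow> 'a \<Rightarrow> 'a" where
  "conjugate G g h = g \<otimes>\<^bsub>G\<^esub> h \<otimes>\<^bsub>G\<^esub> inv\<^bsub>G\<^esub> g"

definition commutator :: "('a, 'm) monoid_scheme \<Rightarrow> 'a \<Rightarrow> 'a \<Rightarrow> 'a" where
  "commutator G g h = g \<otimes>\<^bsub>G\<^esub> h \<otimes>\<^bsub>G\<^esub> inv\<^bsub>G\<^esub> g \<otimes>\<^bsub>G\<^esub> inv\<^bsub>G\<^esub> h"

text \<open>The index is shifted: \<open>lower_central G i\<close> is the term usually written
  \<open>\<gamma>\<^sub>i\<^sub>+\<^sub>1(G)\<close>, so a group of class \<open>c\<close> is one whose series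
  reaches the trivial subgroup at index \<open>c\<close> and not before.\<close>

primrec lower_central :: "('a, 'm) monoid_scheme \<Rightarrow> nat \<Rightarrow> 'a set" where
  "lower_central G 0 = carrier G"
| "lower_central G (Suc i) =
     generate G {commutator G x g | x g. x \<in> lower_central G i \<and> g \<in> carrier G}"

definition nilpotent_of_class :: "('a, 'm) monoid_scheme \<Rightarrow> nat \<Rightarrow> bool" where
  "nilpotent_of_class G c \<longleftrightarrow>
     lower_central G c = {\<one>\<^bsub>G\<^esub>} \<and> (\<forall>i<c. lower_central G i \<noteq> {\<one>\<^bsub>G\<^esub>})"


section \<open>Groups given by generators and relations\<close>

text \<open>A word over \<open>X\<close> is a list of letters \<open>(b, x)\<close> with \<open>x \<in> X\<close>, where
  \<open>(True, x)\<close> stands for the generator \<open>x\<close> and \<open>(False, x)\<close> for its formal inverse.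
  A relation is a pair \<open>(u, v)\<close> of words, read as \<open>u = v\<close>. The presented group consists of
  the words modulo the least congruence that contains the relations and free cancellation.\<close>

type_synonym 'x word = "(bool \<times> 'x) list"

abbreviation words :: "'x set \<Rightarrow> 'x word set" where
  "words X \<equiv> lists (UNIV \<times> X)"

inductive_set word_rel :: "'x set \<Rightarrow> ('x word \<times> 'x word) set \<Rightarrow> ('x word \<times> 'x word) set"
  for X :: "'x set" and R :: "('x word \<times> 'x word) set" where
  refl: "w \<in> words X \<Longrightarrow> (w, w) \<in> word_rel X R"
| sym: "(u, v) \<in> word_rel X R \<Longrightarrow> (v, u) \<in> word_rel X R"
| trans: "(u, v) \<in> word_rel X R \<Longrightarrow> (v, w) \<in> word_rel X R \<Longrightarrow> (u, w) \<in> word_rel X R"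
| cong: "(u, v) \<in> word_rel X R \<Longrightarrow> a \<in> words X \<Longrightarrow> b \<in> words X \<Longrightarrow>
    (a @ u @ b, a @ v @ b) \<in> word_rel X R"
| cancel: "x \<in> X \<Longrightarrow> ([(b, x), (\<not> b, x)], []) \<in> word_rel X R"
| relation: "(u, v) \<in> R \<Longrightarrow> u \<in> words X \<Longrightarrow> v \<in> words X \<Longrightarrow> (u, v) \<in> word_rel X R"

definition presented_group :: "'x set \<Rightarrow> ('x word \<times> 'x word) set \<Rightarrow> 'x word set monoid" where
  "presented_group X R =
     \<lparr>carrier = words X // word_rel X R,
      monoid.mult = (\<lambda>A B. \<Union>u\<in>A. \<Union>v\<in>B. word_rel X R `` {u @ v}),
      one = word_rel X R `` {[]}\<rparr>"

definition presented_gen :: "'x set \<Rightarrow> ('x word \<times> 'x word) set \<Rightarrow> 'x \<Rightarrow> 'x word set" where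
  "presented_gen X R x = word_rel X R `` {[(True, x)]}"

lemma word_rel_words: "(u, v) \<in> word_rel X R \<Longrightarrow> u \<in> words X \<and> v \<in> words X"
  by (induction rule: word_rel.induct) auto

lemma equiv_word_rel: "equiv (words X) (word_rel X R)"
proof (rule equivI)
  show "word_rel X R \<subseteq> words X \<times> words X" using word_rel_words by fastforce
  show "refl_on (words X) (word_rel X R)" by (simp add: refl_onI word_rel.refl)
  show "sym (word_rel X R)" by (simp add: symI word_rel.sym)
  show "trans (word_rel X R)" by (meson transI word_rel.trans)
qed

lemma presented_group_mult_class:
  assumes "u \<in> words X" "v \<in> words X"
  shows "word_rel X R `` {u} \<otimes>\<^bsub>presented_group X R\<^esub> word_rel X R `` {v} = word_rel X R `` {u @ v}"
proof -
  have "(u @ v, u' @ v') \<in> word_rel X R"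
    if "(u, u') \<in> word_rel X R" "(v, v') \<in> word_rel X R" for u' v'
    using word_rel.cong[OF that(1), of "[]" v] word_rel.cong[OF that(2), of u' "[]"]
      word_rel_words[OF that(1)] assms by (auto intro: word_rel.trans)
  then have "word_rel X R `` {u' @ v'} = word_rel X R `` {u @ v}"
    if "u' \<in> word_rel X R `` {u}" "v' \<in> word_rel X R `` {v}" for u' v'
    using that equiv_class_eq[OF equiv_word_rel] by fast
  moreover have "u \<in> word_rel X R `` {u}" "v \<in> word_rel X R `` {v}"
    using assms by (simp_all add: word_rel.refl)
  ultimately show ?thesis
    unfolding presented_group_def monoid.simps by blast
qed

lemma group_presented_group: "group (presented_group X R)"
proof (rule groupI)
  let ?c = "\<lambda>w. word_rel X R `` {w}"
  let ?P = "presented_group X R"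
  have car: "carrier ?P = ?c ` words X"
    by (auto simp: presented_group_def quotient_def)
  have one: "\<one>\<^bsub>?P\<^esub> = ?c []" by (simp add: presented_group_def)
  have m: "?c u \<otimes>\<^bsub>?P\<^esub> ?c v = ?c (u @ v)" if "u \<in> words X" "v \<in> words X" for u v
    using presented_group_mult_class[OF that] .
  have app: "u @ v \<in> words X" if "u \<in> words X" "v \<in> words X" for u v
    using that by (rule append_in_lists_conv[THEN iffD2, OF conjI])
  have ex: thesis if "x \<in> carrier ?P" "\<And>w. w \<in> words X \<Longrightarrow> x = ?c w \<Longrightarrow> thesis" for x thesis
    using that car by blast
  show "x \<otimes>\<^bsub>?P\<^esub> y \<in> carrier ?P" if x: "x \<in> carrier ?P" and y: "y \<in> carrier ?P" for x y
    by (rule ex[OF x], rule ex[OF y]) (use app in \<open>auto simp only: m car intro!: imageI\<close>)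
  show "\<one>\<^bsub>?P\<^esub> \<in> carrier ?P" using car one by blast
  show "x \<otimes>\<^bsub>?P\<^esub> y \<otimes>\<^bsub>?P\<^esub> z = x \<otimes>\<^bsub>?P\<^esub> (y \<otimes>\<^bsub>?P\<^esub> z)"
    if x: "x \<in> carrier ?P" and y: "y \<in> carrier ?P" and z: "z \<in> carrier ?P" for x y z
    by (rule ex[OF x], rule ex[OF y], rule ex[OF z]) (simp only: m app append_assoc)
  show "\<one>\<^bsub>?P\<^esub> \<otimes>\<^bsub>?P\<^esub> x = x" if x: "x \<in> carrier ?P" for x
    by (rule ex[OF x]) (simp only: one m lists.Nil append_Nil)
  have inv: "\<exists>w'\<in>words X. (w' @ w, []) \<in> word_rel X R" if "w \<in> words X" for w
    using that
  proof (induction w)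
    case Nil
    then show ?case using word_rel.refl[of "[]"] by force
  next
    case (Cons a w)
    obtain b x where a: "a = (b, x)" by fastforce
    have x: "x \<in> X" and w: "w \<in> words X" using Cons.hyps a by auto
    obtain w' where w': "w' \<in> words X" "(w' @ w, []) \<in> word_rel X R" using Cons.IH by blast
    have "([(\<not> b, x), (b, x)], []) \<in> word_rel X R"
      using word_rel.cancel[OF x, of "\<not> b"] by simp
    then have "(w' @ [(\<not> b, x), (b, x)] @ w, w' @ [] @ w) \<in> word_rel X R"
      using w'(1) w by (rule word_rel.cong)
    then have "((w' @ [(\<not> b, x)]) @ a # w, []) \<in> word_rel X R"
      using w'(2) a by (auto intro: word_rel.trans)
    moreover have "w' @ [(\<not> b, x)] \<in> words X" using w' x by auto
    ultimately show ?case by blast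
  qed
  show "\<exists>y\<in>carrier ?P. y \<otimes>\<^bsub>?P\<^esub> x = \<one>\<^bsub>?P\<^esub>" if x: "x \<in> carrier ?P" for x
  proof -
    obtain w where w: "w \<in> words X" "x = ?c w" using ex[OF x] by blast
    obtain w' where w': "w' \<in> words X" "(w' @ w, []) \<in> word_rel X R" using inv w(1) by blast
    have "?c w' \<otimes>\<^bsub>?P\<^esub> x = ?c []"
      using m[OF w'(1) w(1)] w(2) equiv_class_eq[OF equiv_word_rel w'(2)] by simp
    then show ?thesis using w'(1) car one by blast
  qed
qed


section \<open>Nonabelian tensor and exterior square\<close>

definition tensor_relations ::
  "('a, 'm) monoid_scheme \<Rightarrow> (('a \<times> 'a) word \<times> ('a \<times> 'a) word) set" where
  "tensor_relations G =
     {([(True, (g \<otimes>\<^bsub>G\<^esub> g', h))],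
       [(True, (conjugate G g g', conjugate G g h)), (True, (g, h))]) | g g' h.
        g \<in> carrier G \<and> g' \<in> carrier G \<and> h \<in> carrier G} \<union>
     {([(True, (g, h \<otimes>\<^bsub>G\<^esub> h'))],
       [(True, (g, h)), (True, (conjugate G h g, conjugate G h h'))]) | g h h'.
        g \<in> carrier G \<and> h \<in> carrier G \<and> h' \<in> carrier G}"

definition tensor_square :: "('a, 'm) monoid_scheme \<Rightarrow> ('a \<times> 'a) word set monoid" where
  "tensor_square G = presented_group (carrier G \<times> carrier G) (tensor_relations G)"

definition tensor :: "('a, 'm) monoid_scheme \<Rightarrow> 'a \<Rightarrow> 'a \<Rightarrow> ('a \<times> 'a) word set" where
  "tensor G g h = presented_gen (carrier G \<times> carrier G) (tensor_relations G) (g, h)"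

definition nabla :: "('a, 'm) monoid_scheme \<Rightarrow> ('a \<times> 'a) word set set" where
  "nabla G = generate (tensor_square G) {tensor G x x | x. x \<in> carrier G}"

definition exterior_square :: "('a, 'm) monoid_scheme \<Rightarrow> ('a \<times> 'a) word set set monoid" where
  "exterior_square G = tensor_square G Mod nabla G"


section \<open>The Schur multiplier as second integral homology\<close>

text \<open>The bar complex of \<open>G\<close> with trivial integer coefficients in degrees 3, 2, 1 (inhomogeneous,
  unnormalised): the chain group in degree \<open>n\<close> is free abelian on \<open>n\<close>-tuples of elements.\<close>

definition bar2 :: "('a, 'm) monoid_scheme \<Rightarrow> 'a \<times> 'a \<Rightarrow> 'a \<Rightarrow>\<^sub>0 int" where
  "bar2 G = (\<lambda>(g, h). frag_of h - frag_of (g \<otimes>\<^bsub>G\<^esub> h) + frag_of g)"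

definition bar3 :: "('a, 'm) monoid_scheme \<Rightarrow> 'a \<times> 'a \<times> 'a \<Rightarrow> ('a \<times> 'a) \<Rightarrow>\<^sub>0 int" where
  "bar3 G = (\<lambda>(g, h, k).
     frag_of (h, k) - frag_of (g \<otimes>\<^bsub>G\<^esub> h, k) + frag_of (g, h \<otimes>\<^bsub>G\<^esub> k) - frag_of (g, h))"

definition cycles2 :: "('a, 'm) monoid_scheme \<Rightarrow> (('a \<times> 'a) \<Rightarrow>\<^sub>0 int) set" where
  "cycles2 G = kernel (free_Abelian_group (carrier G \<times> carrier G))
     (free_Abelian_group (carrier G)) (frag_extend (bar2 G))"

definition boundaries2 :: "('a, 'm) monoid_scheme \<Rightarrow> (('a \<times> 'a) \<Rightarrow>\<^sub>0 int) set" where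
  "boundaries2 G = frag_extend (bar3 G) `
     carrier (free_Abelian_group (carrier G \<times> carrier G \<times> carrier G))"

definition schur_multiplier :: "('a, 'm) monoid_scheme \<Rightarrow> (('a \<times> 'a) \<Rightarrow>\<^sub>0 int) set monoid" where
  "schur_multiplier G =
     subgroup_generated (free_Abelian_group (carrier G \<times> carrier G)) (cycles2 G) Mod boundaries2 G"

lemma bar2_bar3:
  assumes "group G" "g \<in> carrier G" "h \<in> carrier G" "k \<in> carrier G"
  shows "frag_extend (bar2 G) (bar3 G (g, h, k)) = 0"
proof -
  interpret group G by fact
  show ?thesis using assms
    by (simp add: bar2_def bar3_def frag_extend_add frag_extend_diff m_assoc)
qed

end

theory Submission
  imports Defs "HOL-Number_Theory.Residues"
begin

text \<open>Let \<open>T = G \<and> G\<close> and \<open>S = T \<rtimes> G\<close>. The subgroups \<open>S\<^sub>i\<close> generated by \<open>\<gamma>\<^sub>i(G)\<close> and all \<open>x \<and> y\<close> with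
  \<open>x \<in> \<gamma>\<^sub>i\<^sub>-\<^sub>1(G)\<close> satisfy \<open>[S\<^sub>i, S\<^sub>j] \<subseteq> S\<^sub>i\<^sub>+\<^sub>j\<close>, and \<open>S\<^sub>c\<^sub>+\<^sub>2\<close> is trivial. For \<open>t = x \<and> y\<close> one has
  \<open>x\<^sup>n (x\<^sup>-\<^sup>1 t)\<^sup>n = x\<^sup>n \<and> y\<close> in \<open>S\<close>, so \<open>t = x (x\<^sup>-\<^sup>1 t)\<close> is a product of two elements whose orders divide
  \<open>e = exp(G)\<close>. The elements of order dividing a power of \<open>p\<close> in a group of class less than \<open>p\<close> are
  closed under products (via the Hall-Petrescu expansion, obtained here from polynomial sequences);
  applied to suitable sections this gives \<open>u\<^sup>e \<in> S\<^sub>p\<^sub>d\<^sub>+\<^sub>1\<close> for \<open>u \<in> S\<^sub>d\<^sub>+\<^sub>1\<close>. By iteration, the exponent of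
  \<open>T\<close> divides \<open>e\<^sup>n\<close> as soon as \<open>c + 1 \<le> p\<^sup>n\<close>, which covers every case except \<open>c = p\<close>, \<open>n = 1\<close>.

  There the expansion leaves \<open>t\<^sup>e [x, \<dots>, x, t]\<^sup>C = 1\<close> with \<open>C\<close> the binomial coefficient of \<open>e\<close> over \<open>p\<close> and
  \<open>p - 1\<close> entries \<open>x\<close>. Since \<open>x y\<^sup>j \<and> y = x \<and> y\<close>, the polynomial \<open>[x y\<^sup>j, \<dots>, x y\<^sup>j, t]\<^sup>C\<close> of degree \<open>p - 1\<close>
  in \<open>j\<close> is constant; summing over \<open>j\<close> modulo \<open>p\<close> isolates its leading coefficient \<open>[y, \<dots>, y, t]\<^sup>C = 1\<close>,
  and exchanging \<open>x\<close> and \<open>y\<close> gives \<open>t\<^sup>e = 1\<close>.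

  For the Schur multiplier, the universal 2-cocycle defines a central extension \<open>E\<close> of \<open>G\<close>; a 2-cycle
  lies in the derived subgroup of \<open>E\<close>, which is an image of \<open>G \<and> G\<close>.\<close>

section \<open>Commutator identities and N-series\<close>

text \<open>The power identity holds because, for fixed y, x |-> x \<and> y is a crossed
  homomorphism into T; hence x |-> (x \<and> y)^-1 x is a second homomorphic section of S over G,
  and x^-1 (x \<and> y) is the inverse of its value at x. The difficulty is that in class p or more
  a product of two elements of order dividing e need not have such an order: the factor of index i
  in the Hall-Petrescu expansion carries the exponent \<open>e choose i\<close>, a multiple of e for
  0 < i < p but in general only of e/p for i = p. So products are formed in sections of class below
  p. For c = p and n = 1 only a single e-th power is available, and the factor of index p has to be
  computed exactly. Depth alone does not kill the factors of index below p; their bases must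
  themselves be torsion, and this forces an induction on the class. Sections are not formed as
  quotients: torsion is stated relative to a subgroup N normalized by the terms in question.
  Polynomial sequences replace the collection process because their coefficients come with a known
  depth and the top one is an iterated difference.\<close>

context group
begin

lemma mult_inv_cancel_left:
  "a \<in> carrier G \<Longrightarrow> b \<in> carrier G \<Longrightarrow> a \<otimes> (inv a \<otimes> b) = b"
  "a \<in> carrier G \<Longrightarrow> b \<in> carrier G \<Longrightarrow> inv a \<otimes> (a \<otimes> b) = b"
  by (simp_all add: m_assoc[symmetric])

text \<open>With the default simp rules this brings group terms to right-associated reduced words,
  so that free group identities follow by \<open>simp\<close>.\<close>

lemmas word_simps = m_assoc inv_mult_group mult_inv_cancel_left

lemma commutator_closed [simp]:
  "a \<in> carrier G \<Longrightarrow> b \<in> carrier G \<Longrightarrow> commutator G a b \<in> carrier G"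
  by (simp add: commutator_def)

lemma commutator_mult_left:
  "a \<in> carrier G \<Longrightarrow> b \<in> carrier G \<Longrightarrow> c \<in> carrier G \<Longrightarrow>
    commutator G (a \<otimes> b) c = a \<otimes> commutator G b c \<otimes> inv a \<otimes> commutator G a c"
  by (simp add: commutator_def word_simps)

lemma commutator_mult_right:
  "a \<in> carrier G \<Longrightarrow> b \<in> carrier G \<Longrightarrow> c \<in> carrier G \<Longrightarrow>
    commutator G a (b \<otimes> c) = commutator G a b \<otimes> (b \<otimes> commutator G a c \<otimes> inv b)"
  by (simp add: commutator_def word_simps)

lemma commutator_inv_left:
  "a \<in> carrier G \<Longrightarrow> b \<in> carrier G \<Longrightarrow>
    commutator G (inv a) b = inv a \<otimes> inv (commutator G a b) \<otimes> a"
  by (simp add: commutator_def word_simps)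

lemma inv_commutator:
  "a \<in> carrier G \<Longrightarrow> b \<in> carrier G \<Longrightarrow> inv (commutator G a b) = commutator G b a"
  by (simp add: commutator_def word_simps)

lemma conj_eq_commutator_mult:
  "a \<in> carrier G \<Longrightarrow> b \<in> carrier G \<Longrightarrow> a \<otimes> b \<otimes> inv a = commutator G a b \<otimes> b"
  by (simp add: commutator_def word_simps)

lemma commutator_one [simp]:
  "a \<in> carrier G \<Longrightarrow> commutator G \<one> a = \<one>" "a \<in> carrier G \<Longrightarrow> commutator G a \<one> = \<one>"
  by (simp_all add: commutator_def)

lemma commutator_self [simp]: "a \<in> carrier G \<Longrightarrow> commutator G a a = \<one>"
  by (simp add: commutator_def word_simps)

lemma conj_commutator:
  "g \<in> carrier G \<Longrightarrow> a \<in> carrier G \<Longrightarrow> b \<in> carrier G \<Longrightarrow>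
    g \<otimes> commutator G a b \<otimes> inv g = commutator G (g \<otimes> a \<otimes> inv g) (g \<otimes> b \<otimes> inv g)"
  by (simp add: commutator_def word_simps)

lemma hall_witt:
  assumes "a \<in> carrier G" "b \<in> carrier G" "c \<in> carrier G"
  shows "commutator G (commutator G a b) (b \<otimes> c \<otimes> inv b) \<otimes>
    (commutator G (commutator G b c) (c \<otimes> a \<otimes> inv c) \<otimes>
     commutator G (commutator G c a) (a \<otimes> b \<otimes> inv a)) = \<one>"
  using assms by (simp add: commutator_def word_simps)

lemma conj_pow:
  assumes "a \<in> carrier G" "b \<in> carrier G"
  shows "(a \<otimes> b \<otimes> inv a) [^] (n::nat) = a \<otimes> b [^] n \<otimes> inv a"
  using assms by (induction n) (simp_all add: word_simps)

section \<open>Commutators of generated subgroups\<close>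

lemma subgroup_conj_preimage:
  assumes N: "subgroup N G" and g: "g \<in> carrier G"
  shows "subgroup {x \<in> carrier G. g \<otimes> x \<otimes> inv g \<in> N} G"
proof (rule subgroupI)
  show "{x \<in> carrier G. g \<otimes> x \<otimes> inv g \<in> N} \<noteq> {}"
    using g subgroup.one_closed[OF N] by (intro ex_in_conv[THEN iffD1] exI[of _ \<one>]) simp
  fix a assume a: "a \<in> {x \<in> carrier G. g \<otimes> x \<otimes> inv g \<in> N}"
  then have "inv (g \<otimes> a \<otimes> inv g) \<in> N" using subgroup.m_inv_closed[OF N] by blast
  then show "inv a \<in> {x \<in> carrier G. g \<otimes> x \<otimes> inv g \<in> N}" using a g by (simp add: word_simps)
  fix b assume b: "b \<in> {x \<in> carrier G. g \<otimes> x \<otimes> inv g \<in> N}"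
  then have "(g \<otimes> a \<otimes> inv g) \<otimes> (g \<otimes> b \<otimes> inv g) \<in> N" using a subgroup.m_closed[OF N] by blast
  then show "a \<otimes> b \<in> {x \<in> carrier G. g \<otimes> x \<otimes> inv g \<in> N}" using a b g by (simp add: word_simps)
qed blast

text \<open>\<open>N\<close> need not lie in \<open>M\<close>: in the torsion arguments
  \<open>N\<close> stays fixed while \<open>M\<close> shrinks.\<close>

definition normalizes :: "'a set \<Rightarrow> 'a set \<Rightarrow> bool" where
  "normalizes M N \<longleftrightarrow> (\<forall>g\<in>M. \<forall>x\<in>N. g \<otimes> x \<otimes> inv g \<in> N)"

lemma normalizesD: "normalizes M N \<Longrightarrow> g \<in> M \<Longrightarrow> x \<in> N \<Longrightarrow> g \<otimes> x \<otimes> inv g \<in> N"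
  by (simp add: normalizes_def)

lemma normalizesD_inv:
  "normalizes M N \<Longrightarrow> subgroup M G \<Longrightarrow> g \<in> M \<Longrightarrow> x \<in> N \<Longrightarrow> inv g \<otimes> x \<otimes> g \<in> N"
  using normalizesD[of M N "inv g" x] by (simp add: subgroup.m_inv_closed subgroup.mem_carrier)

lemma commutator_left_subgroup:
  assumes M: "subgroup M G" and N: "subgroup N G" "normalizes M N" and b: "b \<in> carrier G"
  shows "subgroup {a \<in> M. commutator G a b \<in> N} G"
proof (rule subgroupI)
  note [simp] = subgroup.mem_carrier[OF M] b
  show "{a \<in> M. commutator G a b \<in> N} \<noteq> {}"
    using subgroup.one_closed[OF M] subgroup.one_closed[OF N(1)] by force
  show "{a \<in> M. commutator G a b \<in> N} \<subseteq> carrier G" by auto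
  fix x assume x: "x \<in> {a \<in> M. commutator G a b \<in> N}"
  have "inv x \<otimes> inv (commutator G x b) \<otimes> x \<in> N"
    using x subgroup.m_inv_closed[OF N(1)] normalizesD_inv[OF N(2) M] by blast
  then show "inv x \<in> {a \<in> M. commutator G a b \<in> N}"
    using x subgroup.m_inv_closed[OF M] by (simp add: commutator_inv_left)
  fix y assume y: "y \<in> {a \<in> M. commutator G a b \<in> N}"
  have "x \<otimes> commutator G y b \<otimes> inv x \<otimes> commutator G x b \<in> N"
    using x y subgroup.m_closed[OF N(1)] normalizesD[OF N(2)] by blast
  then show "x \<otimes> y \<in> {a \<in> M. commutator G a b \<in> N}"
    using x y subgroup.m_closed[OF M] by (simp add: commutator_mult_left)
qed

lemma commutator_generate_left:
  assumes M: "subgroup M G" and N: "subgroup N G" "normalizes M N" and A: "A \<subseteq> M"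
    and b: "b \<in> carrier G" and c: "\<And>a. a \<in> A \<Longrightarrow> commutator G a b \<in> N"
    and a: "a \<in> generate G A"
  shows "commutator G a b \<in> N"
  using generate_subgroup_incl[OF _ commutator_left_subgroup[OF M N b], of A] A c a by blast

lemma commutator_swap_mem:
  assumes "subgroup N G" "a \<in> carrier G" "b \<in> carrier G" "commutator G a b \<in> N"
  shows "commutator G b a \<in> N"
  using assms inv_commutator[of a b] subgroup.m_inv_closed by fastforce

lemma commutator_generate:
  assumes M: "subgroup M G" and N: "subgroup N G" "normalizes M N" and A: "A \<subseteq> M" and B: "B \<subseteq> M"
    and c: "\<And>a b. a \<in> A \<Longrightarrow> b \<in> B \<Longrightarrow> commutator G a b \<in> N"
    and a: "a \<in> generate G A" and b: "b \<in> generate G B"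
  shows "commutator G a b \<in> N"
proof -
  note M' = subgroup.mem_carrier[OF M]
  have aM: "a \<in> carrier G" using a A M' generate_in_carrier by blast
  have "commutator G b' a \<in> N" if b': "b' \<in> B" for b'
    by (rule commutator_swap_mem[OF N(1)])
       (use commutator_generate_left[OF M N A _ _ a, of b'] b' B M' aM c in auto)
  then have "commutator G b a \<in> N"
    using commutator_generate_left[OF M N B aM _ b] by blast
  moreover have "b \<in> carrier G" using generate_in_carrier[of B b] b B M' by blast
  ultimately show ?thesis using commutator_swap_mem[OF N(1) _ aM] by simp
qed

lemma generate_subset_subgroup:
  "subgroup H G \<Longrightarrow> A \<subseteq> H \<Longrightarrow> generate G A \<subseteq> H"
  using generate_subgroup_incl by blast

lemma normalizes_generate:
  assumes M: "subgroup M G" and A: "A \<subseteq> carrier G"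
    and n: "\<And>g x. g \<in> M \<Longrightarrow> x \<in> A \<Longrightarrow> g \<otimes> x \<otimes> inv g \<in> generate G A"
  shows "normalizes M (generate G A)"
  unfolding normalizes_def
proof (intro ballI)
  fix g x assume g: "g \<in> M" and x: "x \<in> generate G A"
  have "generate G A \<subseteq> {x \<in> carrier G. g \<otimes> x \<otimes> inv g \<in> generate G A}"
    using generate_subset_subgroup[OF subgroup_conj_preimage[OF generate_is_subgroup[OF A]]]
      subgroup.mem_carrier[OF M g] A n[OF g] by blast
  then show "g \<otimes> x \<otimes> inv g \<in> generate G A" using x by blast
qed

end

text \<open>Index 0 is included so that \<open>Q 0\<close> normalizes every term, and so that n |->
  a^n with a in \<open>Q 1\<close> gets a degree as a polynomial sequence, namely 0.\<close>

definition nseries :: "('a, 'm) monoid_scheme \<Rightarrow> (nat \<Rightarrow> 'a set) \<Rightarrow> bool" where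
  "nseries G Q \<longleftrightarrow> (\<forall>i. subgroup (Q i) G) \<and> (\<forall>i. Q (Suc i) \<subseteq> Q i) \<and>
     (\<forall>i j. \<forall>a\<in>Q i. \<forall>b\<in>Q j. commutator G a b \<in> Q (i + j))"

context group
begin

lemma nseries_subgroup: "nseries G Q \<Longrightarrow> subgroup (Q i) G"
  by (simp add: nseries_def)

lemma nseries_mem_carrier: "nseries G Q \<Longrightarrow> a \<in> Q i \<Longrightarrow> a \<in> carrier G"
  using subgroup.mem_carrier[OF nseries_subgroup] .

lemma nseries_mono: "nseries G Q \<Longrightarrow> i \<le> j \<Longrightarrow> a \<in> Q j \<Longrightarrow> a \<in> Q i"
  using lift_Suc_antimono_le[of Q i j] unfolding nseries_def by blast

lemma nseries_commutator:
  "nseries G Q \<Longrightarrow> a \<in> Q i \<Longrightarrow> b \<in> Q j \<Longrightarrow> commutator G a b \<in> Q (i + j)"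
  by (simp add: nseries_def)

lemma nseries_commutator_le:
  "nseries G Q \<Longrightarrow> a \<in> Q i \<Longrightarrow> b \<in> Q j \<Longrightarrow> k \<le> i + j \<Longrightarrow> commutator G a b \<in> Q k"
  using nseries_commutator nseries_mono by blast

lemma nseries_closed:
  assumes "nseries G Q"
  shows "\<one> \<in> Q i" "a \<in> Q i \<Longrightarrow> inv a \<in> Q i" "a \<in> Q i \<Longrightarrow> b \<in> Q i \<Longrightarrow> a \<otimes> b \<in> Q i"
  using nseries_subgroup[OF assms, of i]
  by (auto intro: subgroup.one_closed subgroup.m_inv_closed subgroup.m_closed)

lemma nseries_conj:
  assumes Q: "nseries G Q" and a: "a \<in> Q 0" and b: "b \<in> Q i"
  shows "a \<otimes> b \<otimes> inv a \<in> Q i"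
  using nseries_commutator[OF Q a b] nseries_closed[OF Q] conj_eq_commutator_mult
    nseries_mem_carrier[OF Q a] nseries_mem_carrier[OF Q b] b by simp

lemma nseries_normalizes: "nseries G Q \<Longrightarrow> normalizes (Q 0) (Q i)"
  by (simp add: normalizes_def nseries_conj)

text \<open>With \<open>f\<close>, \<open>g\<close> the values of two sequences at n and
  \<open>s\<close>, \<open>t\<close> their differences there, this is the difference of their
  commutator. In the expansion every factor except [f, g] involves \<open>s\<close> or
  \<open>t\<close> and so lies one step deeper.\<close>

lemma nseries_commutator_diff:
  assumes Q: "nseries G Q" and f: "f \<in> Q i" and g: "g \<in> Q j" and s: "s \<in> Q (Suc i)" and t: "t \<in> Q (Suc j)"
  shows "commutator G (s \<otimes> f) (t \<otimes> g) \<otimes> inv (commutator G f g) \<in> Q (Suc (i + j))"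
proof -
  note mem = nseries_mem_carrier[OF Q]
  note [simp] = mem[OF f] mem[OF g] mem[OF s] mem[OF t]
  let ?N = "Q (Suc (i + j))"
  let ?c = "commutator G"
  define h where "h = t \<otimes> g"
  have h: "h \<in> Q j" unfolding h_def using nseries_closed(3)[OF Q] nseries_mono[OF Q _ t, of j] g by simp
  note [simp] = mem[OF h]
  have fg: "?c f g \<in> Q (i + j)" and fh: "?c f h \<in> Q (i + j)"
    using nseries_commutator[OF Q] f g h by auto
  have n: "?c s h \<in> ?N" "?c s (?c f h) \<in> ?N" "?c f t \<in> ?N" "?c t (?c f g) \<in> ?N"
    using nseries_commutator_le[OF Q s h] nseries_commutator_le[OF Q s fh]
      nseries_commutator_le[OF Q f t] nseries_commutator_le[OF Q t fg] by simp_all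
  have "?c f g \<in> Q 0" using nseries_mono[OF Q _ fg, of 0] by simp
  then have c: "?c f g \<otimes> ?c s h \<otimes> inv (?c f g) \<in> ?N" using nseries_conj[OF Q _ n(1)] by blast
  have "?c f h = ?c f t \<otimes> (?c t (?c f g) \<otimes> ?c f g)"
    unfolding h_def by (simp add: commutator_mult_right conj_eq_commutator_mult)
  moreover have "?c (s \<otimes> f) h = ?c s (?c f h) \<otimes> ?c f h \<otimes> ?c s h"
    by (simp add: commutator_mult_left conj_eq_commutator_mult)
  ultimately have "?c (s \<otimes> f) h \<otimes> inv (?c f g) =
      ?c s (?c f h) \<otimes> (?c f t \<otimes> (?c t (?c f g) \<otimes> (?c f g \<otimes> ?c s h \<otimes> inv (?c f g))))"
    by (simp add: m_assoc)
  then show ?thesis unfolding h_def[symmetric] using n c nseries_closed(3)[OF Q] by simp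
qed

end

section \<open>Polynomial sequences along an N-series\<close>

definition seq_group :: "('a, 'm) monoid_scheme \<Rightarrow> (nat \<Rightarrow> 'a) monoid" where
  "seq_group G = \<lparr>carrier = {f. \<forall>n. f n \<in> carrier G},
     monoid.mult = (\<lambda>f g n. f n \<otimes>\<^bsub>G\<^esub> g n), one = (\<lambda>n. \<one>\<^bsub>G\<^esub>)\<rparr>"

definition diff_seq :: "('a, 'm) monoid_scheme \<Rightarrow> (nat \<Rightarrow> 'a) \<Rightarrow> nat \<Rightarrow> 'a" where
  "diff_seq G f n = f (Suc n) \<otimes>\<^bsub>G\<^esub> inv\<^bsub>G\<^esub> f n"

text \<open>A polynomial sequence in degree \<open>d\<close> has its \<open>k\<close>-th differences in \<open>Q (d + k)\<close>, for all \<open>k\<close>. That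
  products of such sequences are polynomial needs commutators of sequences not yet known to be
  polynomial; bounding \<open>k\<close> and inducting on the bound avoids this circularity.\<close>

primrec poly_approx ::
  "('a, 'm) monoid_scheme \<Rightarrow> (nat \<Rightarrow> 'a set) \<Rightarrow> nat \<Rightarrow> nat \<Rightarrow> (nat \<Rightarrow> 'a) set" where
  "poly_approx G Q 0 d = {f. \<forall>n. f n \<in> Q d}"
| "poly_approx G Q (Suc k) d =
     {f \<in> poly_approx G Q k d. diff_seq G f \<in> poly_approx G Q k (Suc d)}"

definition poly_seq ::
  "('a, 'm) monoid_scheme \<Rightarrow> (nat \<Rightarrow> 'a set) \<Rightarrow> nat \<Rightarrow> (nat \<Rightarrow> 'a) set" where
  "poly_seq G Q d = (\<Inter>k. poly_approx G Q k d)"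

context group
begin

lemma seq_group_simps [simp]:
  "f \<in> carrier (seq_group G) \<longleftrightarrow> (\<forall>n. f n \<in> carrier G)"
  "f \<otimes>\<^bsub>seq_group G\<^esub> g = (\<lambda>n. f n \<otimes> g n)"
  "\<one>\<^bsub>seq_group G\<^esub> = (\<lambda>n. \<one>)"
  by (simp_all add: seq_group_def)

lemma group_seq_group: "group (seq_group G)"
proof (rule groupI)
  fix f assume f: "f \<in> carrier (seq_group G)"
  then show "\<exists>g\<in>carrier (seq_group G). g \<otimes>\<^bsub>seq_group G\<^esub> f = \<one>\<^bsub>seq_group G\<^esub>"
    by (intro bexI[of _ "\<lambda>n. inv f n"]) auto
qed (auto simp: m_assoc)

lemma inv_seq_group [simp]:
  "\<forall>n. f n \<in> carrier G \<Longrightarrow> inv\<^bsub>seq_group G\<^esub> f = (\<lambda>n. inv f n)"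
  by (rule group.inv_equality[OF group_seq_group]) auto

lemma commutator_seq_group:
  "\<forall>n. f n \<in> carrier G \<Longrightarrow> \<forall>n. g n \<in> carrier G \<Longrightarrow>
    commutator (seq_group G) f g = (\<lambda>n. commutator G (f n) (g n))"
  by (simp add: commutator_def)

lemma diff_seq_closed [simp]: "\<forall>n. f n \<in> carrier G \<Longrightarrow> diff_seq G f n \<in> carrier G"
  by (simp add: diff_seq_def)

lemma shift_eq_diff_seq:
  "\<forall>n. f n \<in> carrier G \<Longrightarrow> f (Suc n) = diff_seq G f n \<otimes> f n"
  by (simp add: diff_seq_def m_assoc)

text \<open>The Lazard-Leibman theorem that polynomial sequences form a group, in truncated form.
  With D for \<open>diff_seq\<close>, D(fg) = Df (f Dg f^-1), and D[f, g] is the element of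
  \<open>nseries_commutator_diff\<close> for s = Df, t = Dg. Both need the N-series property, in the
  group of sequences, only for the smaller bound.\<close>

lemma nseries_poly_approx:
  assumes Q: "nseries G Q"
  shows "nseries (seq_group G) (poly_approx G Q k)"
proof (induction k)
  case 0
  have "subgroup {f. \<forall>n::nat. f n \<in> Q d} (seq_group G)" for d
  proof (rule group.subgroupI[OF group_seq_group])
    have "(\<lambda>n. \<one>) \<in> {f. \<forall>n::nat. f n \<in> Q d}" using nseries_closed(1)[OF Q] by simp
    then show "{f. \<forall>n::nat. f n \<in> Q d} \<noteq> {}" by (metis emptyE)
    fix f assume f: "f \<in> {f. \<forall>n::nat. f n \<in> Q d}"
    then have car: "\<forall>n. f n \<in> carrier G" using nseries_mem_carrier[OF Q] by blast
    then show "inv\<^bsub>seq_group G\<^esub> f \<in> {f. \<forall>n::nat. f n \<in> Q d}"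
      using f nseries_closed(2)[OF Q] by simp
    fix g assume "g \<in> {f. \<forall>n::nat. f n \<in> Q d}"
    then show "f \<otimes>\<^bsub>seq_group G\<^esub> g \<in> {f. \<forall>n::nat. f n \<in> Q d}"
      using f nseries_closed(3)[OF Q] by simp
  next
    show "{f. \<forall>n::nat. f n \<in> Q d} \<subseteq> carrier (seq_group G)"
      using nseries_mem_carrier[OF Q] unfolding subset_iff seq_group_simps by blast
  qed
  moreover have "{f. \<forall>n::nat. f n \<in> Q (Suc d)} \<subseteq> {f. \<forall>n::nat. f n \<in> Q d}" for d
    using nseries_mono[OF Q, of d "Suc d"] by auto
  moreover have "commutator (seq_group G) f g \<in> {f. \<forall>n::nat. f n \<in> Q (i + j)}"
    if "f \<in> {f. \<forall>n::nat. f n \<in> Q i}" "g \<in> {f. \<forall>n::nat. f n \<in> Q j}" for f g i j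
  proof -
    have "\<forall>n. f n \<in> carrier G" "\<forall>n. g n \<in> carrier G" using that nseries_mem_carrier[OF Q] by blast+
    then show ?thesis using that nseries_commutator[OF Q] by (simp add: commutator_seq_group)
  qed
  ultimately show ?case unfolding nseries_def by simp
next
  case (Suc k)
  let ?S = "seq_group G" and ?P = "poly_approx G Q k" and ?P' = "poly_approx G Q (Suc k)"
  interpret S: group ?S by (rule group_seq_group)
  note P = Suc.IH
  have car: "f n \<in> carrier G" if "f \<in> ?P d" for f d n
    using S.nseries_mem_carrier[OF P that] by simp
  have shift: "(\<lambda>n. f (Suc n)) = diff_seq G f \<otimes>\<^bsub>?S\<^esub> f" if "f \<in> ?P d" for f d
    using car[OF that] by (auto simp: shift_eq_diff_seq[symmetric])
  have diff: "diff_seq G f = (\<lambda>n. f (Suc n)) \<otimes>\<^bsub>?S\<^esub> inv\<^bsub>?S\<^esub> f" if "f \<in> ?P d" for f d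
    using car[OF that] by (auto simp: diff_seq_def)
  have low: "f \<in> ?P 0" if "f \<in> ?P d" for f d using S.nseries_mono[OF P _ that] by simp
  have sub: "subgroup (?P' d) ?S" for d
  proof (rule S.subgroupI)
    have "\<one>\<^bsub>?S\<^esub> \<in> ?P d" "\<one>\<^bsub>?S\<^esub> \<in> ?P (Suc d)" using S.nseries_closed(1)[OF P] by blast+
    moreover have "diff_seq G \<one>\<^bsub>?S\<^esub> = \<one>\<^bsub>?S\<^esub>" by (auto simp: diff_seq_def)
    ultimately show "?P' d \<noteq> {}" by force
    show "?P' d \<subseteq> carrier ?S" using S.nseries_mem_carrier[OF P] by auto
    fix f assume "f \<in> ?P' d"
    then have f: "f \<in> ?P d" "diff_seq G f \<in> ?P (Suc d)" by auto
    note fi = S.nseries_closed(2)[OF P f(1)]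
    have "diff_seq G (inv\<^bsub>?S\<^esub> f) = inv\<^bsub>?S\<^esub> f \<otimes>\<^bsub>?S\<^esub> inv\<^bsub>?S\<^esub> (diff_seq G f) \<otimes>\<^bsub>?S\<^esub> inv\<^bsub>?S\<^esub> (inv\<^bsub>?S\<^esub> f)"
      using car[OF f(1)] car[OF f(2)] car[OF fi] by (auto simp: diff_seq_def word_simps)
    then have "diff_seq G (inv\<^bsub>?S\<^esub> f) \<in> ?P (Suc d)"
      using S.nseries_conj[OF P low[OF fi] S.nseries_closed(2)[OF P f(2)]] by simp
    then show "inv\<^bsub>?S\<^esub> f \<in> ?P' d" using fi by simp
    fix g assume "g \<in> ?P' d"
    then have g: "g \<in> ?P d" "diff_seq G g \<in> ?P (Suc d)" by auto
    note fg = S.nseries_closed(3)[OF P f(1) g(1)]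
    have "diff_seq G (f \<otimes>\<^bsub>?S\<^esub> g) = diff_seq G f \<otimes>\<^bsub>?S\<^esub> (f \<otimes>\<^bsub>?S\<^esub> diff_seq G g \<otimes>\<^bsub>?S\<^esub> inv\<^bsub>?S\<^esub> f)"
      using car[OF f(1)] car[OF g(1)] by (auto simp: diff_seq_def word_simps)
    then have "diff_seq G (f \<otimes>\<^bsub>?S\<^esub> g) \<in> ?P (Suc d)"
      using S.nseries_closed(3)[OF P f(2) S.nseries_conj[OF P low[OF f(1)] g(2)]] by simp
    then show "f \<otimes>\<^bsub>?S\<^esub> g \<in> ?P' d" using fg by simp
  qed
  have mono: "?P' (Suc d) \<subseteq> ?P' d" for d
    using S.nseries_mono[OF P, of d "Suc d"] S.nseries_mono[OF P, of "Suc d" "Suc (Suc d)"] by auto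
  have comm: "commutator ?S f g \<in> ?P' (i + j)" if "f \<in> ?P' i" "g \<in> ?P' j" for f g i j
  proof -
    have f: "f \<in> ?P i" "diff_seq G f \<in> ?P (Suc i)" and g: "g \<in> ?P j" "diff_seq G g \<in> ?P (Suc j)"
      using that by auto
    note fg = S.nseries_commutator[OF P f(1) g(1)]
    have "diff_seq G (commutator ?S f g) =
        commutator ?S (\<lambda>n. f (Suc n)) (\<lambda>n. g (Suc n)) \<otimes>\<^bsub>?S\<^esub> inv\<^bsub>?S\<^esub> commutator ?S f g"
      using diff[OF fg] car[OF f(1)] car[OF g(1)] by (simp add: commutator_seq_group)
    then have "diff_seq G (commutator ?S f g) \<in> ?P (Suc (i + j))"
      unfolding shift[OF f(1)] shift[OF g(1)]
      using S.nseries_commutator_diff[OF P f(1) g(1) f(2) g(2)] by simp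
    then show ?thesis using fg by simp
  qed
  show ?case unfolding nseries_def using sub mono comm by blast
qed

lemma nseries_poly_seq:
  assumes Q: "nseries G Q"
  shows "nseries (seq_group G) (poly_seq G Q)"
proof -
  interpret S: group "seq_group G" by (rule group_seq_group)
  note P = nseries_poly_approx[OF Q]
  have "subgroup (poly_seq G Q d) (seq_group G)" for d
    unfolding poly_seq_def using S.nseries_subgroup[OF P]
    by (intro S.subgroups_Inter) auto
  moreover have "poly_seq G Q (Suc d) \<subseteq> poly_seq G Q d" for d
    unfolding poly_seq_def using P unfolding nseries_def by blast
  moreover have "commutator (seq_group G) f g \<in> poly_seq G Q (i + j)"
    if "f \<in> poly_seq G Q i" "g \<in> poly_seq G Q j" for f g i j
    using that S.nseries_commutator[OF P] unfolding poly_seq_def by simp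
  ultimately show ?thesis unfolding nseries_def by blast
qed

lemma poly_seq_iff:
  "f \<in> poly_seq G Q d \<longleftrightarrow> (\<forall>n. f n \<in> Q d) \<and> diff_seq G f \<in> poly_seq G Q (Suc d)"
proof
  assume f: "f \<in> poly_seq G Q d"
  have "f \<in> poly_approx G Q 0 d" "\<forall>k. f \<in> poly_approx G Q (Suc k) d"
    using f unfolding poly_seq_def by blast+
  then show "(\<forall>n. f n \<in> Q d) \<and> diff_seq G f \<in> poly_seq G Q (Suc d)"
    by (simp add: poly_seq_def)
next
  assume f: "(\<forall>n. f n \<in> Q d) \<and> diff_seq G f \<in> poly_seq G Q (Suc d)"
  have "f \<in> poly_approx G Q k d" for k
    using f by (induction k) (auto simp: poly_seq_def)
  then show "f \<in> poly_seq G Q d" by (simp add: poly_seq_def)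
qed

end

section \<open>Newton expansions of polynomial sequences\<close>

text \<open>There is no factor of index 0, since only sequences with value one at 0 are
  expanded.\<close>

primrec newton_product :: "('a, 'm) monoid_scheme \<Rightarrow> (nat \<Rightarrow> 'a) \<Rightarrow> nat \<Rightarrow> nat \<Rightarrow> 'a" where
  "newton_product G a 0 n = \<one>\<^bsub>G\<^esub>"
| "newton_product G a (Suc r) n =
     newton_product G a r n \<otimes>\<^bsub>G\<^esub> a (Suc r) [^]\<^bsub>G\<^esub> (n choose Suc r)"

context group
begin

lemma nseries_pow: "nseries G Q \<Longrightarrow> a \<in> Q i \<Longrightarrow> a [^] (n::nat) \<in> Q i"
  by (induction n) (simp_all add: nseries_closed)

lemma subgroup_pow: "subgroup H G \<Longrightarrow> a \<in> H \<Longrightarrow> a [^] (n::nat) \<in> H"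
  by (induction n) (simp_all add: subgroup.one_closed subgroup.m_closed)

lemma poly_seq_value: "f \<in> poly_seq G Q d \<Longrightarrow> f n \<in> Q d"
  using poly_seq_iff by blast

lemma poly_seq_diff: "f \<in> poly_seq G Q d \<Longrightarrow> diff_seq G f \<in> poly_seq G Q (Suc d)"
  using poly_seq_iff by blast

lemma poly_seq_mult:
  assumes "nseries G Q" "f \<in> poly_seq G Q d" "g \<in> poly_seq G Q d"
  shows "(\<lambda>n. f n \<otimes> g n) \<in> poly_seq G Q d"
  using group.nseries_closed(3)[OF group_seq_group nseries_poly_seq[OF assms(1)] assms(2,3)] by simp

lemma poly_seq_one: "nseries G Q \<Longrightarrow> (\<lambda>n. \<one>) \<in> poly_seq G Q d"
  using group.nseries_closed(1)[OF group_seq_group nseries_poly_seq, of Q d] by simp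

lemma poly_seq_carrier: "nseries G Q \<Longrightarrow> f \<in> poly_seq G Q d \<Longrightarrow> f n \<in> carrier G"
  using poly_seq_value nseries_mem_carrier by blast

lemma poly_seq_inv:
  assumes "nseries G Q" "f \<in> poly_seq G Q d"
  shows "(\<lambda>n. inv f n) \<in> poly_seq G Q d"
  using group.nseries_closed(2)[OF group_seq_group nseries_poly_seq[OF assms(1)] assms(2)]
    poly_seq_carrier[OF assms] by simp

lemma poly_seq_commutator:
  assumes "nseries G Q" "f \<in> poly_seq G Q i" "g \<in> poly_seq G Q j"
  shows "(\<lambda>n. commutator G (f n) (g n)) \<in> poly_seq G Q (i + j)"
  using group.nseries_commutator[OF group_seq_group nseries_poly_seq[OF assms(1)] assms(2,3)]
    commutator_seq_group[of f g] poly_seq_carrier[OF assms(1,2)] poly_seq_carrier[OF assms(1,3)]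
  by simp

lemma poly_seq_mono:
  assumes "nseries G Q" "i \<le> j" "f \<in> poly_seq G Q j"
  shows "f \<in> poly_seq G Q i"
  using group.nseries_mono[OF group_seq_group nseries_poly_seq[OF assms(1)] assms(2,3)] .

lemma poly_seq_const:
  assumes "nseries G Q" "a \<in> Q d"
  shows "(\<lambda>n. a) \<in> poly_seq G Q d"
proof -
  have "diff_seq G (\<lambda>n. a) = (\<lambda>n. \<one>)"
    using nseries_mem_carrier[OF assms] by (auto simp: diff_seq_def)
  then show ?thesis using assms(2) poly_seq_one[OF assms(1)] by (subst poly_seq_iff) simp
qed

lemma diff_seq_pow_choose:
  "a \<in> carrier G \<Longrightarrow> diff_seq G (\<lambda>n. a [^] (n choose Suc i)) = (\<lambda>n. a [^] (n choose i))"
  by (auto simp: diff_seq_def nat_pow_mult[symmetric] m_assoc)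

lemma poly_seq_pow_choose:
  assumes "nseries G Q" "a \<in> Q (d + i)"
  shows "(\<lambda>n. a [^] (n choose i)) \<in> poly_seq G Q d"
  using assms(2)
proof (induction i arbitrary: d)
  case 0
  then show ?case using poly_seq_const[OF assms(1)] nseries_mem_carrier[OF assms(1)] by simp
next
  case (Suc i)
  have "(\<lambda>n. a [^] (n choose i)) \<in> poly_seq G Q (Suc d)" using Suc by simp
  moreover have "a [^] (n choose Suc i) \<in> Q d" for n
    using nseries_pow[OF assms(1)] nseries_mono[OF assms(1) _ Suc.prems, of d] by simp
  ultimately show ?case
    using diff_seq_pow_choose[OF nseries_mem_carrier[OF assms(1) Suc.prems]]
    by (subst poly_seq_iff) simp
qed

lemma poly_seq_pow:
  assumes "nseries G Q" "a \<in> Q (Suc d)"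
  shows "(\<lambda>n. a [^] n) \<in> poly_seq G Q d"
  using poly_seq_pow_choose[OF assms(1), of a d 1] assms(2) by simp

text \<open>If f is trivial up to i, then Df is trivial below i and takes the value f (i + 1) at i.
  Each difference thus adds one step of depth to the same value.\<close>

lemma poly_seq_first_value:
  assumes "nseries G Q" "f \<in> poly_seq G Q d" "\<And>m. m < i \<Longrightarrow> f m = \<one>"
  shows "f i \<in> Q (d + i)"
  using assms(2,3)
proof (induction i arbitrary: f d)
  case 0
  then show ?case using poly_seq_value by simp
next
  case (Suc i)
  have "diff_seq G f i \<in> Q (Suc d + i)"
    by (rule Suc.IH[OF poly_seq_diff[OF Suc.prems(1)]]) (simp add: diff_seq_def Suc.prems)
  then show ?case
    using Suc.prems(2)[of i] poly_seq_carrier[OF assms(1) Suc.prems(1)] by (simp add: diff_seq_def)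
qed

lemma poly_seq_newton_product:
  assumes "nseries G Q" "\<And>i. a i \<in> Q (d + i)"
  shows "newton_product G a r \<in> poly_seq G Q d"
proof (induction r)
  case 0
  then show ?case using poly_seq_one[OF assms(1)] by simp
next
  case (Suc r)
  then show ?case
    using poly_seq_mult[OF assms(1) Suc poly_seq_pow_choose[OF assms, of "Suc r"]] by simp
qed

lemma newton_product_cong:
  "(\<And>i. i \<le> r \<Longrightarrow> a i = b i) \<Longrightarrow> newton_product G a r = newton_product G b r"
  by (induction r) auto

text \<open>Taylor's formula: after division by the first r factors the sequence is trivial up to r,
  so by \<open>poly_seq_first_value\<close> its value at r + 1 is deep enough to be the next
  coefficient. The new factor leaves the values up to r alone, its binomial exponent being 0
  there.\<close>

lemma newton_expansion:
  assumes Q: "nseries G Q" and f: "f \<in> poly_seq G Q d" "f 0 = \<one>"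
  shows "\<exists>a. (\<forall>i. a i \<in> Q (d + i)) \<and> (\<forall>n\<le>r. f n = newton_product G a r n)"
proof (induction r)
  case 0
  then show ?case using nseries_closed(1)[OF Q] f(2) by (intro exI[of _ "\<lambda>i. \<one>"]) simp
next
  case (Suc r)
  then obtain a where a: "\<And>i. a i \<in> Q (d + i)" "\<And>n. n \<le> r \<Longrightarrow> f n = newton_product G a r n"
    by blast
  define g where "g n = inv (newton_product G a r n) \<otimes> f n" for n
  note car = poly_seq_carrier[OF Q poly_seq_newton_product[OF Q a(1)]] poly_seq_carrier[OF Q f(1)]
  have "g \<in> poly_seq G Q d"
    unfolding g_def
    using poly_seq_mult[OF Q poly_seq_inv[OF Q poly_seq_newton_product[OF Q a(1)]] f(1)] .
  then have g: "g (Suc r) \<in> Q (d + Suc r)"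
    by (rule poly_seq_first_value[OF Q]) (use car a(2) in \<open>simp add: g_def\<close>)
  define b where "b = a(Suc r := g (Suc r))"
  have "newton_product G b r = newton_product G a r"
    unfolding b_def by (rule newton_product_cong) simp
  moreover have "b (Suc r) = g (Suc r)" by (simp add: b_def)
  ultimately have "f n = newton_product G b (Suc r) n" if "n \<le> Suc r" for n
    using that a(2)[of n] car nseries_mem_carrier[OF Q g]
    by (cases "n = Suc r") (simp_all add: g_def mult_inv_cancel_left binomial_eq_0)
  moreover have "b i \<in> Q (d + i)" for i using a(1) g by (simp add: b_def)
  ultimately show ?case by blast
qed

section \<open>Evaluating Newton products\<close>

lemma newton_product_split:
  assumes "subgroup N G" "\<And>i. a i \<in> carrier G"
    and "\<And>i. 2 \<le> i \<Longrightarrow> i \<le> r \<Longrightarrow> a i [^] (n choose i) \<in> N" "1 \<le> r"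
  shows "\<exists>z\<in>N. newton_product G a r n = a 1 [^] n \<otimes> z"
  using assms(4,3)
proof (induction r rule: dec_induct)
  case base
  then show ?case using assms(2) by (intro bexI[OF _ subgroup.one_closed[OF assms(1)]]) simp
next
  case (step r)
  then obtain z where z: "z \<in> N" "newton_product G a r n = a 1 [^] n \<otimes> z" by auto
  let ?b = "a (Suc r) [^] (n choose Suc r)"
  have "?b \<in> N" using step.prems[of "Suc r"] step.hyps by simp
  then show ?case
    using z subgroup.m_closed[OF assms(1)] subgroup.mem_carrier[OF assms(1)] assms(2)
    by (intro bexI[of _ "z \<otimes> ?b"]) (simp_all add: m_assoc)
qed

lemma newton_product_one:
  assumes "\<And>i. a i \<in> carrier G" "1 \<le> r"
  shows "newton_product G a r 1 = a 1"
proof -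
  have "\<exists>z\<in>{\<one>}. newton_product G a r 1 = a 1 [^] (1::nat) \<otimes> z"
    by (rule newton_product_split[OF triv_subgroup assms(1) _ assms(2)]) (simp add: binomial_eq_0)
  then show ?thesis using assms(1) by simp
qed

lemma newton_product_two_terms:
  assumes "\<And>i. a i \<in> carrier G" "2 \<le> p" "p \<le> r"
    and "\<And>i. 2 \<le> i \<Longrightarrow> i \<noteq> p \<Longrightarrow> a i [^] (n choose i) = \<one>"
  shows "newton_product G a r n = a 1 [^] n \<otimes> a p [^] (n choose p)"
  using assms(3)
proof (induction r rule: dec_induct)
  case base
  obtain q where q: "p = Suc q" "1 \<le> q" using assms(2) by (cases p) auto
  have "\<exists>z\<in>{\<one>}. newton_product G a q n = a 1 [^] n \<otimes> z"
    by (rule newton_product_split[OF triv_subgroup assms(1) _ q(2)]) (use assms(4) q in auto)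
  then show ?case using q assms(1) by simp
next
  case (step r)
  then show ?case using assms(1) assms(4)[of "Suc r"] assms(2) by simp
qed

text \<open>The commutator of \<open>f\<close> with the difference of \<open>g\<close> measures the failure of differences to be
  multiplicative. It lies two steps deeper, because \<open>d > 0\<close>.\<close>

lemma funpow_diff_seq_mult:
  assumes Q: "nseries G Q" and f: "f \<in> poly_seq G Q d" and g: "g \<in> poly_seq G Q d"
    and d: "0 < d" and triv: "Q (Suc (d + k)) = {\<one>}"
  shows "(diff_seq G ^^ k) (\<lambda>n. f n \<otimes> g n) 0 = (diff_seq G ^^ k) f 0 \<otimes> (diff_seq G ^^ k) g 0"
  using f g d triv
proof (induction k arbitrary: f g d)
  case 0
  then show ?case by simp
next
  case (Suc k)
  note car = poly_seq_carrier[OF Q Suc.prems(1)] poly_seq_carrier[OF Q Suc.prems(2)]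
  let ?f = "diff_seq G f" and ?g = "diff_seq G g"
  define h where "h n = commutator G (f n) (?g n)" for n
  have f': "?f \<in> poly_seq G Q (Suc d)" and g': "?g \<in> poly_seq G Q (Suc d)"
    using Suc.prems(1,2) poly_seq_diff by blast+
  have "h \<in> poly_seq G Q (d + Suc d)"
    unfolding h_def by (rule poly_seq_commutator[OF Q Suc.prems(1) g'])
  then have h2: "h \<in> poly_seq G Q (Suc (Suc d))"
    by (rule poly_seq_mono[OF Q, rotated]) (use Suc.prems(3) in simp)
  have "(diff_seq G ^^ k) h \<in> poly_seq G Q (Suc (Suc d) + k)"
    using h2 by (induction k) (auto dest: poly_seq_diff)
  then have "(diff_seq G ^^ k) h 0 \<in> Q (Suc (d + Suc k))"
    using poly_seq_value by fastforce
  then have h0: "(diff_seq G ^^ k) h 0 = \<one>" using Suc.prems(4) by blast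
  have h1: "h \<in> poly_seq G Q (Suc d)" using poly_seq_mono[OF Q _ h2] by simp
  have "diff_seq G (\<lambda>n. f n \<otimes> g n) = (\<lambda>n. ?f n \<otimes> (h n \<otimes> ?g n))"
    using car by (auto simp: h_def diff_seq_def commutator_def word_simps)
  then have "(diff_seq G ^^ Suc k) (\<lambda>n. f n \<otimes> g n) 0 = (diff_seq G ^^ k) (\<lambda>n. ?f n \<otimes> (h n \<otimes> ?g n)) 0"
    by (simp add: funpow_Suc_right del: funpow.simps)
  also have "\<dots> = (diff_seq G ^^ k) ?f 0 \<otimes> ((diff_seq G ^^ k) h 0 \<otimes> (diff_seq G ^^ k) ?g 0)"
    using Suc.IH[OF f' poly_seq_mult[OF Q h1 g']] Suc.IH[OF h1 g'] Suc.prems(4) by simp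
  also have "\<dots> = (diff_seq G ^^ Suc k) f 0 \<otimes> (diff_seq G ^^ Suc k) g 0"
  proof -
    have "(diff_seq G ^^ k) ?g \<in> poly_seq G Q (Suc d + k)"
      using g' by (induction k) (auto dest: poly_seq_diff)
    then show ?thesis
      using h0 poly_seq_carrier[OF Q] by (simp add: funpow_Suc_right del: funpow.simps)
  qed
  finally show ?case .
qed

lemma funpow_diff_seq_cong:
  "(\<And>n. n \<le> k + m \<Longrightarrow> f n = g n) \<Longrightarrow> (diff_seq G ^^ k) f m = (diff_seq G ^^ k) g m"
  by (induction k arbitrary: m) (simp_all add: diff_seq_def)

lemma funpow_diff_seq_pow_choose:
  assumes "a \<in> carrier G"
  shows "(diff_seq G ^^ k) (\<lambda>n. a [^] (n choose i)) =
    (if k \<le> i then (\<lambda>n. a [^] (n choose (i - k))) else (\<lambda>n. \<one>))"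
proof (induction k)
  case (Suc k)
  have "diff_seq G (\<lambda>n. a [^] (n choose (i - k))) =
      (if k < i then (\<lambda>n. a [^] (n choose (i - Suc k))) else (\<lambda>n. \<one>))"
  proof (cases "k < i")
    case True
    then obtain j where "i - k = Suc j" "i - Suc k = j" by (metis Suc_diff_Suc)
    then show ?thesis using diff_seq_pow_choose[OF assms, of j] True by simp
  next
    case False
    then show ?thesis using assms by (auto simp: diff_seq_def)
  qed
  moreover have "diff_seq G (\<lambda>n. c) = (\<lambda>n. \<one>)" if "c \<in> carrier G" for c :: 'a
    using that by (auto simp: diff_seq_def)
  ultimately show ?case using Suc assms by simp
qed simp

text \<open>Under \<open>triv\<close> the k-th difference at 0 is multiplicative. Of the factor with
  index i it leaves nothing for i < k, and a power with exponent \<open>0 choose (i - k)\<close>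
  otherwise, so only the coefficient of index k survives.\<close>

lemma newton_top_coefficient:
  assumes Q: "nseries G Q" and d: "0 < d" and a: "\<And>i. a i \<in> Q (d + i)"
    and k: "0 < k" "k \<le> r" and triv: "Q (Suc (d + k)) = {\<one>}"
    and f: "\<And>n. n \<le> r \<Longrightarrow> f n = newton_product G a r n"
  shows "a k = (diff_seq G ^^ k) f 0"
proof -
  note a' = nseries_mem_carrier[OF Q a]
  have "(diff_seq G ^^ k) (newton_product G a s) 0 = (if k \<le> s then a k else \<one>)" for s
  proof (induction s)
    case 0
    have "newton_product G a 0 = (\<lambda>n. \<one> [^] (n choose 0))" by auto
    then show ?case using k funpow_diff_seq_pow_choose[of \<one> k 0] by simp
  next
    case (Suc s)
    have *: "newton_product G a (Suc s) =
        (\<lambda>n. newton_product G a s n \<otimes> a (Suc s) [^] (n choose Suc s))" by auto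
    show ?case
      unfolding * funpow_diff_seq_mult[OF Q poly_seq_newton_product[OF Q a]
        poly_seq_pow_choose[OF Q a] d triv] Suc
      using k a' by (auto simp: funpow_diff_seq_pow_choose le_Suc_eq Suc_diff_le)
  qed
  moreover have "(diff_seq G ^^ k) f 0 = (diff_seq G ^^ k) (newton_product G a r) 0"
    by (rule funpow_diff_seq_cong) (use f k in auto)
  ultimately show ?thesis using k by simp
qed

end

section \<open>Divisibility of binomial coefficients of prime powers\<close>

lemma prime_power_dvd_choose:
  assumes "prime (p::nat)" "0 < i" "i < p"
  shows "p ^ k dvd (p ^ k choose i)"
proof -
  have "i * (p ^ k choose i) = p ^ k * ((p ^ k - 1) choose (i - 1))"
    using assms(2) by (rule times_binomial_minus1_eq)
  moreover have "coprime (p ^ k) i"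
    using assms by (meson coprime_power_left_iff nat_dvd_not_less prime_imp_coprime)
  ultimately show ?thesis by (metis coprime_dvd_mult_right_iff dvd_triv_left)
qed

text \<open>At index p the identity used for smaller indices may lose one factor p. This is the
  source of the exceptional case.\<close>

lemma prime_power_dvd_mult_choose:
  assumes "prime (p::nat)"
  shows "p ^ k dvd p * (p ^ k choose p)"
  using times_binomial_minus1_eq[of p "p ^ k"] prime_gt_0_nat[OF assms] by simp

section \<open>Products of torsion elements in class less than p\<close>

context group
begin

text \<open>Used to lower the class: the group generated by \<open>A\<close> receives a series with
  prescribed terms from index 2 on, and these may be taken deep when the generators nearly commute.
  Both top terms are the whole generated group.\<close>

lemma nseries_adjoin:
  assumes M: "subgroup M G" and A: "A \<subseteq> M"
    and K: "\<And>i. 2 \<le> i \<Longrightarrow> subgroup (K i) G \<and> normalizes M (K i) \<and> K (Suc i) \<subseteq> K i"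
    and KK: "\<And>i j a b. 2 \<le> i \<Longrightarrow> 2 \<le> j \<Longrightarrow> a \<in> K i \<Longrightarrow> b \<in> K j \<Longrightarrow> commutator G a b \<in> K (i + j)"
    and AA: "\<And>a b. a \<in> A \<Longrightarrow> b \<in> A \<Longrightarrow> commutator G a b \<in> K 2"
    and AK: "\<And>i a b. 2 \<le> i \<Longrightarrow> a \<in> A \<Longrightarrow> b \<in> K i \<Longrightarrow> commutator G a b \<in> K (Suc i)"
    and K2: "K 2 \<subseteq> generate G A"
  shows "nseries G (\<lambda>i. if i < 2 then generate G A else K i)"
proof -
  let ?R = "\<lambda>i. if i < 2 then generate G A else K i"
  have Ac: "A \<subseteq> carrier G" using A subgroup.subset[OF M] by blast
  have sub: "subgroup (?R i) G" for i
    using K[of i] generate_is_subgroup[OF Ac] by (cases "i < 2") auto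
  have mono: "?R (Suc i) \<subseteq> ?R i" for i
  proof -
    consider "Suc i < 2" | "i = 1" | "2 \<le> i" by linarith
    then show ?thesis using K[of i] K2 by cases (auto simp: numeral_2_eq_2)
  qed
  have AK': "commutator G a b \<in> K (Suc i)" if "2 \<le> i" "a \<in> generate G A" "b \<in> K i" for i a b
    using commutator_generate_left[OF M _ _ A _ _ that(2), of "K (Suc i)" b] AK that
      K[of i] K[of "Suc i"] subgroup.mem_carrier by fastforce
  have comm: "commutator G a b \<in> ?R (i + j)" if ij: "i \<le> j" and a: "a \<in> ?R i" and b: "b \<in> ?R j" for i j a b
  proof -
    have le: "?R m \<subseteq> ?R n" if "n \<le> m" for m n
      using lift_Suc_antimono_le[of ?R, OF mono that] .
    consider "j < 2" | "i < 2" "2 \<le> j" | "2 \<le> i" "2 \<le> j" using ij by linarith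
    then show ?thesis
    proof cases
      case 1
      then have "commutator G a b \<in> ?R 2"
        using commutator_generate[OF M _ _ A A AA, of a b] a b ij K[of 2] by simp
      then show ?thesis using le[of "i + j" 2] 1 ij by auto
    next
      case 2
      then have "commutator G a b \<in> ?R (Suc j)" using AK'[of j a b] a b by simp
      then show ?thesis using le[of "i + j" "Suc j"] 2 by auto
    next
      case 3
      then show ?thesis using KK[of i j a b] a b by simp
    qed
  qed
  have "commutator G a b \<in> ?R (i + j)" if a: "a \<in> ?R i" and b: "b \<in> ?R j" for i j a b
  proof (cases "i \<le> j")
    case False
    then have "commutator G b a \<in> ?R (j + i)" using comm[OF _ b a] by simp
    then have "commutator G b a \<in> ?R (i + j)" by (simp only: add.commute)
    then show ?thesis
      using commutator_swap_mem[OF sub] subgroup.mem_carrier[OF sub a] subgroup.mem_carrier[OF sub b]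
      by blast
  qed (use comm that in blast)
  then show ?thesis unfolding nseries_def using sub mono by blast
qed

text \<open>Induction on s, which bounds the class modulo \<open>N\<close>. Expanding x^n u^n at n =
  p^k finishes the proof once the coefficients of index 2 and more are torsion modulo
  \<open>N\<close>, so the task is to find an N-series with torsion terms from index 2 on. The
  induction hypothesis is used twice in groups of smaller class: inside \<open>Q 2\<close>, and
  inside the group generated by \<open>x\<close> and \<open>Q 2\<close>.\<close>

theorem torsion_mult_closed:
  assumes p: "prime (p::nat)" and Q: "nseries G Q" and s: "s < p"
    and N: "subgroup N G" "normalizes (Q 1) N" "Q (Suc s) \<subseteq> N"
    and x: "x \<in> Q 1" "x [^] (p ^ k) \<in> N" and u: "u \<in> Q 1" "u [^] (p ^ k) \<in> N"
  shows "(x \<otimes> u) [^] (p ^ k) \<in> N"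
  using Q s N(2,3) x u
proof (induction s arbitrary: Q x u)
  case 0
  then have "x \<otimes> u \<in> N" using nseries_closed(3)[OF 0(1), of x 1 u] by auto
  then show ?case using subgroup_pow[OF N(1)] by blast
next
  case (Suc s)
  let ?e = "p ^ k"
  note Q = Suc.prems(1) and x = Suc.prems(5,6) and u = Suc.prems(7,8)
  note mem = nseries_mem_carrier[OF Q]
  note [simp] = mem[OF x(1)] mem[OF u(1)]
  have Q21: "a \<in> Q 1" if "a \<in> Q 2" for a using nseries_mono[OF Q _ that, of 1] by simp
  have Q0: "a \<in> Q 0" if "a \<in> Q i" for a i using nseries_mono[OF Q _ that, of 0] by simp
  \<comment> \<open>The higher coefficients will be taken from \<open>V\<close>, a subgroup by the
    induction hypothesis for the series shifted by one.\<close>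
  define V where "V = {a \<in> Q 2. a [^] ?e \<in> N}"
  have Q': "nseries G (\<lambda>i. Q (Suc i))"
    unfolding nseries_def
    using nseries_subgroup[OF Q] nseries_mono[OF Q, of "Suc i" "Suc (Suc i)" for i]
      nseries_commutator_le[OF Q, of _ "Suc i" _ "Suc j" "Suc (i + j)" for i j] by auto
  have norm2: "normalizes (Q 2) N" using Suc.prems(3) Q21 by (auto simp: normalizes_def)
  have V: "subgroup V G"
  proof (rule subgroupI)
    show "V \<subseteq> carrier G" using mem by (auto simp: V_def)
    show "V \<noteq> {}"
      using nseries_closed(1)[OF Q, of 2] subgroup.one_closed[OF N(1)] by (auto simp: V_def)
    fix a assume a: "a \<in> V"
    then show "inv a \<in> V"
      using nseries_closed(2)[OF Q, of a 2] subgroup.m_inv_closed[OF N(1)] mem[of a 2]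
      by (auto simp: V_def nat_pow_inv)
    fix b assume b: "b \<in> V"
    show "a \<otimes> b \<in> V"
      using Suc.IH[OF Q', of a b] a b Suc.prems(2,4) norm2 nseries_closed(3)[OF Q, of a 2 b]
      by (simp add: V_def numeral_2_eq_2)
  qed
  have V_conj: "normalizes (Q 1) V"
    unfolding normalizes_def
  proof (intro ballI)
    fix g a assume g: "g \<in> Q 1" and a: "a \<in> V"
    then have "(g \<otimes> a \<otimes> inv g) [^] ?e \<in> N"
      using normalizesD[OF Suc.prems(3) g, of "a [^] ?e"] mem[OF g] mem[of a 2] by (simp add: conj_pow V_def)
    then show "g \<otimes> a \<otimes> inv g \<in> V" using nseries_conj[OF Q Q0[OF g]] a by (simp add: V_def)
  qed
  have M: "subgroup (Q 1) G" using nseries_subgroup[OF Q] .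
  have normM: "normalizes (Q 1) (Q i)" for i using nseries_normalizes[OF Q] Q0 by (auto simp: normalizes_def)
  let ?c = "commutator G x u"
  have cQ: "?c \<in> Q 2" using nseries_commutator[OF Q x(1) u(1)] by (simp add: numeral_2_eq_2)
  \<comment> \<open>[x, u] = x (u x^-1 u^-1) is a product of two torsion elements of the group
    generated by \<open>x\<close> and \<open>Q 2\<close>. Since [x, x] = 1, commutators in that
    group lie in \<open>Q 3\<close>, so its class is smaller.\<close>
  have c: "?c \<in> V"
  proof -
    let ?A = "insert x (Q 2)"
    let ?R = "\<lambda>i. if i < 2 then generate G ?A else Q (Suc i)"
    have A: "?A \<subseteq> Q 1" using x Q21 by blast
    have R: "nseries G ?R"
    proof (rule nseries_adjoin[OF M A])
      show "subgroup (Q (Suc i)) G \<and> normalizes (Q 1) (Q (Suc i)) \<and> Q (Suc (Suc i)) \<subseteq> Q (Suc i)" for i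
        using nseries_subgroup[OF Q] normM nseries_mono[OF Q, of "Suc i" "Suc (Suc i)"] by auto
      show "commutator G a b \<in> Q (Suc (i + j))" if "a \<in> Q (Suc i)" "b \<in> Q (Suc j)" for i j a b
        using nseries_commutator_le[OF Q that] by simp
      show "commutator G a b \<in> Q (Suc 2)" if a: "a \<in> ?A" and b: "b \<in> ?A" for a b
      proof (cases "a = x \<and> b = x")
        case True
        then show ?thesis using nseries_closed(1)[OF Q] by simp
      next
        case False
        then consider "a \<in> Q 2" "b \<in> Q 1" | "a \<in> Q 1" "b \<in> Q 2" using a b A by auto
        then show ?thesis by cases (use nseries_commutator[OF Q] in force)+
      qed
      show "commutator G a b \<in> Q (Suc (Suc i))" if "a \<in> ?A" "b \<in> Q (Suc i)" for i a b
        using nseries_commutator[OF Q, of a 1 b "Suc i"] that A by auto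
      have "Q 2 \<subseteq> generate G ?A" by (meson generate.incl insertCI subsetI)
      then show "Q (Suc 2) \<subseteq> generate G ?A" using nseries_mono[OF Q, of 2 "Suc 2"] by auto
    qed
    have gen: "generate G ?A \<subseteq> Q 1" by (rule generate_subset_subgroup[OF M A])
    have xA: "x \<in> generate G ?A" by (simp add: generate.incl)
    have eq: "u \<otimes> inv x \<otimes> inv u = inv x \<otimes> ?c" by (simp add: commutator_def word_simps)
    have c': "inv x \<otimes> ?c \<in> generate G ?A"
      using xA cQ by (intro generate.eng generate.inv generate.incl) auto
    have "(u \<otimes> inv x \<otimes> inv u) [^] ?e \<in> N"
      using normalizesD[OF Suc.prems(3) u(1) subgroup.m_inv_closed[OF N(1) x(2)]]
      by (simp add: conj_pow nat_pow_inv)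
    moreover have "normalizes (generate G ?A) N" using Suc.prems(3) gen by (auto simp: normalizes_def)
    ultimately have "(x \<otimes> (inv x \<otimes> ?c)) [^] ?e \<in> N" if "s \<noteq> 0"
      using that Suc.IH[OF R, of x "inv x \<otimes> ?c"] Suc.prems(2,4) xA x(2) eq c' by simp
    \<comment> \<open>The prescribed terms of the new series begin at index 2, so the case in which
      \<open>Q 2\<close> already lies in \<open>N\<close> is separate.\<close>
    moreover have "(x \<otimes> (inv x \<otimes> ?c)) [^] ?e \<in> N" if "s = 0"
    proof -
      have "?c \<in> N" using cQ Suc.prems(4) that by (auto simp: numeral_2_eq_2)
      then show ?thesis using subgroup_pow[OF N(1)] by (simp add: word_simps)
    qed
    ultimately have "(x \<otimes> (inv x \<otimes> ?c)) [^] ?e \<in> N" by blast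
    then show ?thesis using cQ by (simp add: V_def word_simps)
  qed
  \<comment> \<open>Commutators of these generators lie in \<open>V\<close>, which gives a series
    with every term from index 2 on inside \<open>V\<close>.\<close>
  let ?B = "{x, u} \<union> V"
  let ?R = "\<lambda>i. if i < 2 then generate G ?B else Q i \<inter> V"
  have B: "?B \<subseteq> Q 1" using x u Q21 by (auto simp: V_def)
  have R: "nseries G ?R"
  proof (rule nseries_adjoin[OF M B])
    show "subgroup (Q i \<inter> V) G \<and> normalizes (Q 1) (Q i \<inter> V) \<and> Q (Suc i) \<inter> V \<subseteq> Q i \<inter> V" for i
      using subgroups_Inter_pair[OF nseries_subgroup[OF Q] V] normM V_conj
        nseries_mono[OF Q, of i "Suc i"] by (auto simp: normalizes_def)
    have VV: "commutator G a b \<in> V" if "a \<in> Q 1" "b \<in> V" for a b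
    proof -
      have "a \<otimes> b \<otimes> inv a \<otimes> inv b \<in> V"
        using normalizesD[OF V_conj that] subgroup.m_inv_closed[OF V that(2)] subgroup.m_closed[OF V] by blast
      then show ?thesis by (simp add: commutator_def)
    qed
    show "commutator G a b \<in> Q (i + j) \<inter> V" if "a \<in> Q i \<inter> V" "b \<in> Q j \<inter> V" for i j a b
      using nseries_commutator[OF Q, of a i b j] that VV B by auto
    show "commutator G a b \<in> Q 2 \<inter> V" if a: "a \<in> ?B" and b: "b \<in> ?B" for a b
    proof -
      have 1: "a \<in> Q 1" "b \<in> Q 1" using a b B by auto
      note car = mem[OF 1(1)] mem[OF 1(2)]
      have "commutator G a b \<in> V"
      proof (cases "a \<in> V \<or> b \<in> V")
        case True
        then show ?thesis using VV[of a b] VV[of b a] 1 commutator_swap_mem[OF V car(2,1)] by blast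
      next
        case False
        then have "a = x \<or> a = u" "b = x \<or> b = u" using a b by auto
        then show ?thesis
          using c commutator_swap_mem[OF V _ _ c] subgroup.one_closed[OF V] by auto
      qed
      then show ?thesis by (simp add: V_def)
    qed
    show "commutator G a b \<in> Q (Suc i) \<inter> V" if "a \<in> ?B" "b \<in> Q i \<inter> V" for i a b
    proof -
      have "a \<in> Q 1" using that B by auto
      then show ?thesis using nseries_commutator[OF Q, of a 1 b i] VV that by auto
    qed
    show "Q 2 \<inter> V \<subseteq> generate G ?B" by (meson IntD2 UnI2 generate.incl subsetI)
  qed
  \<comment> \<open>Its first coefficient is f 1 = x u, and its value at p^k lies in
    \<open>N\<close> by assumption.\<close>
  define f where "f n = x [^] n \<otimes> u [^] n" for n :: nat
  have "x \<in> ?R 1" "u \<in> ?R 1" by (simp_all add: generate.incl)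
  then have f: "f \<in> poly_seq G ?R 0"
    unfolding f_def using poly_seq_mult[OF R poly_seq_pow[OF R] poly_seq_pow[OF R]] by simp
  obtain a where a: "\<And>i. a i \<in> ?R (0 + i)" "\<And>n. n \<le> ?e \<Longrightarrow> f n = newton_product G a ?e n"
    using newton_expansion[OF R f, of ?e] by (auto simp: f_def)
  have ac: "a i \<in> carrier G" for i using nseries_mem_carrier[OF R a(1)] .
  have e1: "1 \<le> ?e" using p by (simp add: Suc_le_eq prime_gt_0_nat)
  have a1: "a 1 = x \<otimes> u" using a(2)[OF e1] newton_product_one[OF ac e1] by (simp add: f_def)
  have "\<exists>z\<in>N. newton_product G a ?e ?e = a 1 [^] ?e \<otimes> z"
  proof (rule newton_product_split[OF N(1) ac _ e1])
    fix i :: nat assume i: "2 \<le> i"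
    then have ai: "a i \<in> Q i \<inter> V" using a(1)[of i] by simp
    show "a i [^] (?e choose i) \<in> N"
    proof (cases "i < p")
      case True
      then obtain q where "(?e choose i) = ?e * q"
        using prime_power_dvd_choose[OF p, of i k] i by auto
      then show ?thesis using ai subgroup_pow[OF N(1)] ac by (simp add: V_def nat_pow_pow[symmetric])
    next
      \<comment> \<open>Here i >= p >= s + 2, and depth replaces the divisibility of the binomial
        coefficient.\<close>
      case False
      then have "a i \<in> N" using nseries_mono[OF Q, of "Suc (Suc s)" i "a i"] ai Suc.prems(2,4) by auto
      then show ?thesis using subgroup_pow[OF N(1)] by blast
    qed
  qed
  then obtain z where z: "z \<in> N" "f ?e = (x \<otimes> u) [^] ?e \<otimes> z" using a(2)[of ?e] a1 by auto
  then have "(x \<otimes> u) [^] ?e = f ?e \<otimes> inv z"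
    using subgroup.mem_carrier[OF N(1)] by (simp add: m_assoc)
  moreover have "f ?e \<in> N" unfolding f_def using x(2) u(2) subgroup.m_closed[OF N(1)] by blast
  ultimately show ?case using z(1) subgroup.m_closed[OF N(1)] subgroup.m_inv_closed[OF N(1)] by simp
qed

end

section \<open>The filtration attached to a crossed pairing\<close>

lemma power_Suc_eq_sum_power_sums:
  "(n::nat) ^ Suc l = (\<Sum>i\<le>l. (Suc l choose i) * (\<Sum>j<n. j ^ i))"
proof (induction n)
  case (Suc n)
  have "Suc n ^ Suc l = (\<Sum>i\<le>Suc l. (Suc l choose i) * n ^ i)"
    using binomial[of n 1 "Suc l"] by simp
  also have "\<dots> = (\<Sum>i\<le>l. (Suc l choose i) * n ^ i) + n ^ Suc l" by simp
  finally show ?case using Suc by (simp add: sum.distrib distrib_left)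
qed simp

text \<open>Solve the telescoped binomial formula for the last power sum: its coefficient l + 1 is
  less than p, hence invertible modulo p. As 0^0 = 1, the sum for l = 0 is p.\<close>

lemma prime_dvd_power_sum:
  assumes "prime (p::nat)" "l < p - 1"
  shows "p dvd (\<Sum>j<p. j ^ l)"
  using assms(2)
proof (induction l rule: less_induct)
  case (less l)
  have "p ^ Suc l = (\<Sum>i<l. (Suc l choose i) * (\<Sum>j<p. j ^ i)) + Suc l * (\<Sum>j<p. j ^ l)"
    unfolding power_Suc_eq_sum_power_sums lessThan_Suc_atMost[symmetric] by simp
  moreover have "p dvd (\<Sum>i<l. (Suc l choose i) * (\<Sum>j<p. j ^ i))"
  proof (rule dvd_sum)
    fix i assume "i \<in> {..<l}"
    then have "p dvd (\<Sum>j<p. j ^ i)" using less.IH[of i] less.prems by simp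
    then show "p dvd (Suc l choose i) * (\<Sum>j<p. j ^ i)" by (rule dvd_mult)
  qed
  moreover have "p dvd p ^ Suc l" by simp
  ultimately have "p dvd Suc l * (\<Sum>j<p. j ^ l)"
    by (simp only: dvd_add_right_iff)
  moreover have "\<not> p dvd Suc l" using less.prems by (auto dest: dvd_imp_le)
  ultimately show ?case using assms(1) by (simp add: prime_dvd_mult_iff del: mult_Suc)
qed

text \<open>By Fermat each j > 0 contributes 1 modulo p; \<open>Suc\<close> expresses the value -1
  in natural numbers.\<close>

lemma prime_dvd_Suc_power_sum:
  assumes p: "prime (p::nat)"
  shows "p dvd Suc (\<Sum>j<p. j ^ (p - 1))"
proof -
  have p0: "0 < p" "0 < p - 1" using prime_gt_1_nat[OF p] by auto
  have "{..<p} = insert 0 {1..<p}" using p0 by auto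
  then have "(\<Sum>j<p. j ^ (p - 1)) = (\<Sum>j\<in>{1..<p}. j ^ (p - 1))" using p0 by simp
  moreover have "[(\<Sum>j\<in>{1..<p}. j ^ (p - 1)) = (\<Sum>j\<in>{1..<p}. 1)] (mod p)"
    by (rule cong_sum) (use p fermat_theorem nat_dvd_not_less in auto)
  ultimately have "[1 + (\<Sum>j<p. j ^ (p - 1)) = 1 + (p - 1)] (mod p)"
    by (intro cong_add cong_refl) simp
  then show ?thesis using p0 by (simp add: cong_def mod_eq_0_iff_dvd)
qed

section \<open>Ordered products and reindexed series\<close>

primrec seq_prod :: "('a, 'm) monoid_scheme \<Rightarrow> (nat \<Rightarrow> 'a) \<Rightarrow> nat \<Rightarrow> 'a" where
  "seq_prod G f 0 = \<one>\<^bsub>G\<^esub>"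
| "seq_prod G f (Suc n) = seq_prod G f n \<otimes>\<^bsub>G\<^esub> f n"

context group
begin

lemma seq_prod_closed: "(\<And>j. f j \<in> carrier G) \<Longrightarrow> seq_prod G f n \<in> carrier G"
  by (induction n) auto

lemma seq_prod_mult:
  assumes f: "\<And>j. f j \<in> carrier G" and g: "\<And>j. g j \<in> carrier G"
    and comm: "\<And>j a. a \<in> carrier G \<Longrightarrow> g j \<otimes> a = a \<otimes> g j"
  shows "seq_prod G (\<lambda>j. f j \<otimes> g j) n = seq_prod G f n \<otimes> seq_prod G g n"
proof -
  note car = seq_prod_closed[of f, OF f] seq_prod_closed[of g, OF g]
  have gf: "seq_prod G g n \<otimes> a = a \<otimes> seq_prod G g n" if a: "a \<in> carrier G" for a n
  proof (induction n)
    case (Suc n)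
    have "seq_prod G g n \<otimes> g n \<otimes> a = seq_prod G g n \<otimes> a \<otimes> g n"
      using a g car comm[OF a] by (simp add: m_assoc)
    also have "\<dots> = a \<otimes> (seq_prod G g n \<otimes> g n)" using a g car Suc by (simp add: m_assoc)
    finally show ?case by simp
  qed (use a in simp)
  show ?thesis
  proof (induction n)
    case (Suc n)
    have "seq_prod G f n \<otimes> f n \<otimes> (seq_prod G g n \<otimes> g n) =
        seq_prod G f n \<otimes> (f n \<otimes> seq_prod G g n) \<otimes> g n" using f g car by (simp add: m_assoc)
    also have "\<dots> = seq_prod G f n \<otimes> seq_prod G g n \<otimes> (f n \<otimes> g n)"
      unfolding gf[OF f, symmetric] using f g car by (simp add: m_assoc)
    finally show ?case using Suc by simp
  qed simp
qed

lemma seq_prod_const: "c \<in> carrier G \<Longrightarrow> seq_prod G (\<lambda>j. c [^] (q j :: nat)) n = c [^] (\<Sum>j<n. q j)"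
  by (induction n) (simp_all add: nat_pow_mult)

lemma torsion_generate:
  assumes p: "prime (p::nat)" and Q: "nseries G Q" and s: "s < p"
    and N: "subgroup N G" "normalizes (Q 1) N" "Q (Suc s) \<subseteq> N"
    and A: "A \<subseteq> Q 1" "\<And>a. a \<in> A \<Longrightarrow> a [^] (p ^ k) \<in> N" and a: "a \<in> generate G A"
  shows "a [^] (p ^ k) \<in> N"
proof -
  have "subgroup {a \<in> Q 1. a [^] (p ^ k) \<in> N} G"
  proof (rule subgroupI)
    show "{a \<in> Q 1. a [^] (p ^ k) \<in> N} \<noteq> {}"
      using nseries_closed(1)[OF Q, of 1] subgroup.one_closed[OF N(1)] by auto
  qed (use nseries_mem_carrier[OF Q] nseries_closed[OF Q] subgroup.m_inv_closed[OF N(1)]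
      torsion_mult_closed[OF p Q s N] in \<open>auto simp: nat_pow_inv\<close>)
  then show ?thesis using generate_subset_subgroup A a by blast
qed

text \<open>Reindexing moves \<open>Q m\<close> to index 1, where the torsion results apply, and
  \<open>Q (m * p)\<close> to index p.\<close>

lemma nseries_multiples:
  assumes "nseries G Q"
  shows "nseries G (\<lambda>i. Q (m * i))"
  unfolding nseries_def
  using nseries_subgroup[OF assms] nseries_mono[OF assms, of "m * i" "m * Suc i" for i]
    nseries_commutator[OF assms, of _ "m * i" _ "m * j" for i j]
  by (auto simp: distrib_left)

end

text \<open>The facts about G \<and> G and its semidirect product with G that the argument needs,
  expressed inside one group: \<open>\<Gamma> i\<close> is the i-th lower central term of G, with
  index 0 repeating index 1, and \<open>w x y\<close> is x \<and> y. In \<open>w_boundary\<close>, h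
  is the image of t under x \<and> y |-> [x, y]; t acts on the exterior square as h does, and the
  commutator of g with t is again a wedge, up to inversion.\<close>

locale crossed_pairing = group S for S (structure) +
  fixes \<Gamma> :: "nat \<Rightarrow> 'a set" and w :: "'a \<Rightarrow> 'a \<Rightarrow> 'a"
  assumes \<Gamma>_subgroup: "subgroup (\<Gamma> i) S"
    and \<Gamma>_mono: "\<Gamma> (Suc i) \<subseteq> \<Gamma> i"
    and \<Gamma>_1: "\<Gamma> 1 = \<Gamma> 0"
    and \<Gamma>_Suc: "1 \<le> i \<Longrightarrow> \<Gamma> (Suc i) = generate S {commutator S x g | x g. x \<in> \<Gamma> i \<and> g \<in> \<Gamma> 0}"
    and w_closed: "x \<in> \<Gamma> 0 \<Longrightarrow> y \<in> \<Gamma> 0 \<Longrightarrow> w x y \<in> carrier S"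
    and carrier_generate: "carrier S \<subseteq> generate S (\<Gamma> 0 \<union> {w x y | x y. x \<in> \<Gamma> 0 \<and> y \<in> \<Gamma> 0})"
    and w_boundary: "2 \<le> i \<Longrightarrow> t \<in> generate S {w x y | x y. x \<in> \<Gamma> (i - 1) \<and> y \<in> \<Gamma> 0} \<Longrightarrow>
      \<exists>h\<in>\<Gamma> i. (\<forall>g\<in>\<Gamma> 0. commutator S g t = inv (w h g)) \<and>
        (\<forall>u\<in>generate S {w x y | x y. x \<in> \<Gamma> 0 \<and> y \<in> \<Gamma> 0}. commutator S t u = commutator S h u)"
    and w_pow: "x \<in> \<Gamma> 0 \<Longrightarrow> y \<in> \<Gamma> 0 \<Longrightarrow> x [^] n \<otimes> (inv x \<otimes> w x y) [^] (n::nat) = w (x [^] n) y"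
    and w_one: "y \<in> \<Gamma> 0 \<Longrightarrow> w \<one> y = \<one>"
    and w_shift: "x \<in> \<Gamma> 0 \<Longrightarrow> y \<in> \<Gamma> 0 \<Longrightarrow> w (x \<otimes> y [^] (j::nat)) y = w x y"
    and w_swap: "x \<in> \<Gamma> 0 \<Longrightarrow> y \<in> \<Gamma> 0 \<Longrightarrow> w y x = inv (w x y)"
begin

text \<open>Like [x, y], the wedge is given one weight more than x. Truncated subtraction and
  \<open>\<Gamma>_1\<close> make the sets for i = 0, 1, 2 equal, so \<open>boundary\<close> can give
  h the weight \<open>max i 2\<close>.\<close>

definition pairs :: "nat \<Rightarrow> 'a set" where
  "pairs i = {w x y | x y. x \<in> \<Gamma> (i - 1) \<and> y \<in> \<Gamma> 0}"

definition filt :: "nat \<Rightarrow> 'a set" where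
  "filt i = generate S (pairs i \<union> \<Gamma> i)"

lemma \<Gamma>_le: "i \<le> j \<Longrightarrow> x \<in> \<Gamma> j \<Longrightarrow> x \<in> \<Gamma> i"
  using lift_Suc_antimono_le[of \<Gamma>, OF \<Gamma>_mono] by blast

lemma \<Gamma>_0: "x \<in> \<Gamma> i \<Longrightarrow> x \<in> \<Gamma> 0"
  using \<Gamma>_le[of 0] by simp

lemma \<Gamma>_carrier: "x \<in> \<Gamma> i \<Longrightarrow> x \<in> carrier S"
  using subgroup.mem_carrier[OF \<Gamma>_subgroup] .

lemma pairs_carrier: "x \<in> pairs i \<Longrightarrow> x \<in> carrier S"
  using w_closed \<Gamma>_0 by (auto simp: pairs_def)

lemma pairs_le: "i \<le> j \<Longrightarrow> x \<in> pairs j \<Longrightarrow> x \<in> pairs i"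
  using \<Gamma>_le[of "i - 1" "j - 1"] by (fastforce simp: pairs_def)

lemma pairs_small: "i \<le> 2 \<Longrightarrow> pairs i = pairs 2"
proof -
  assume "i \<le> 2"
  then have "\<Gamma> (i - 1) = \<Gamma> (2 - 1)" using \<Gamma>_1 by (cases "i = 2") (auto simp: le_Suc_eq numeral_2_eq_2)
  then show ?thesis by (simp add: pairs_def)
qed

lemma pairs_max: "pairs i = pairs (max i 2)"
  using pairs_small[of i] by (cases "i \<le> 2") (auto simp: max_def)

lemma pairs_two: "pairs 2 = {w x y | x y. x \<in> \<Gamma> 0 \<and> y \<in> \<Gamma> 0}"
  using \<Gamma>_1 by (simp add: pairs_def)

lemma generate_pairs_carrier: "t \<in> generate S (pairs i) \<Longrightarrow> t \<in> carrier S"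
  using generate_in_carrier[of "pairs i"] pairs_carrier by blast

lemma generators_carrier: "pairs i \<union> \<Gamma> i \<subseteq> carrier S"
  using pairs_carrier \<Gamma>_carrier by blast

lemma filt_subgroup: "subgroup (filt i) S"
  unfolding filt_def by (rule generate_is_subgroup[OF generators_carrier])

lemma filt_carrier: "x \<in> filt i \<Longrightarrow> x \<in> carrier S"
  using subgroup.mem_carrier[OF filt_subgroup] .

lemma filt_le: "i \<le> j \<Longrightarrow> x \<in> filt j \<Longrightarrow> x \<in> filt i"
  using mono_generate[of "pairs j \<union> \<Gamma> j" "pairs i \<union> \<Gamma> i"] pairs_le \<Gamma>_le
  unfolding filt_def by blast

lemma pairs_filt: "x \<in> pairs i \<Longrightarrow> x \<in> filt i"
  by (simp add: filt_def generate.incl)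

lemma \<Gamma>_filt: "x \<in> \<Gamma> i \<Longrightarrow> x \<in> filt i"
  by (simp add: filt_def generate.incl)

lemma generate_pairs_filt: "x \<in> generate S (pairs i) \<Longrightarrow> x \<in> filt i"
  using mono_generate[of "pairs i" "pairs i \<union> \<Gamma> i"] unfolding filt_def by blast

lemma filt_small:
  assumes "i \<le> 1"
  shows "filt i = carrier S"
proof -
  have "\<Gamma> i = \<Gamma> 0" using assms \<Gamma>_1 by (cases "i = 0") (auto simp: le_Suc_eq)
  moreover have "pairs i = {w x y | x y. x \<in> \<Gamma> 0 \<and> y \<in> \<Gamma> 0}"
    using assms pairs_small[of i] pairs_two by simp
  ultimately have "carrier S \<subseteq> filt i" using carrier_generate by (simp add: filt_def Un_commute)
  then show ?thesis using filt_carrier by blast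
qed

lemma \<Gamma>_commutator: "1 \<le> i \<Longrightarrow> x \<in> \<Gamma> i \<Longrightarrow> g \<in> \<Gamma> 0 \<Longrightarrow> commutator S x g \<in> \<Gamma> (Suc i)"
  using \<Gamma>_Suc[of i] by (auto intro: generate.incl)

lemma boundary:
  assumes "t \<in> generate S (pairs i)"
  obtains h where "h \<in> \<Gamma> (max i 2)"
    "\<And>g. g \<in> \<Gamma> 0 \<Longrightarrow> commutator S g t = inv (w h g)"
    "\<And>u. u \<in> generate S (pairs 2) \<Longrightarrow> commutator S t u = commutator S h u"
proof -
  have "t \<in> generate S {w x y | x y. x \<in> \<Gamma> (max i 2 - 1) \<and> y \<in> \<Gamma> 0}"
    using assms pairs_max[of i] by (simp add: pairs_def)
  from w_boundary[OF _ this] show ?thesis using that unfolding pairs_two by auto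
qed

lemma commutator_\<Gamma>_pairs:
  assumes g: "g \<in> \<Gamma> 0" and t: "t \<in> generate S (pairs i)"
  shows "commutator S g t \<in> filt (Suc i)"
proof -
  obtain h where h: "h \<in> \<Gamma> (max i 2)" "commutator S g t = inv (w h g)"
    using boundary[OF t] g by metis
  have "w h g \<in> pairs (Suc i)" using h(1) \<Gamma>_le[of i "max i 2" h] g by (auto simp: pairs_def)
  then show ?thesis using h(2) pairs_filt subgroup.m_inv_closed[OF filt_subgroup] by simp
qed

lemma commutator_generators:
  assumes i: "1 \<le> i" and g: "g \<in> \<Gamma> 0 \<union> generate S (pairs 2)" and x: "x \<in> pairs i \<union> \<Gamma> i"
  shows "commutator S g x \<in> filt (Suc i)"
proof -
  have gc: "g \<in> carrier S" using g \<Gamma>_carrier generate_pairs_carrier by blast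
  have xc: "x \<in> carrier S" using x generators_carrier by blast
  have x2: "x \<in> pairs 2" if "x \<in> pairs i" using that pairs_max[of i] pairs_le[of 2 "max i 2"] by simp
  consider "g \<in> \<Gamma> 0" "x \<in> pairs i" | "g \<in> \<Gamma> 0" "x \<in> \<Gamma> i"
    | "g \<in> generate S (pairs 2)" "x \<in> pairs i" | "g \<in> generate S (pairs 2)" "x \<in> \<Gamma> i"
    using g x by blast
  then show ?thesis
  proof cases
    case 1
    then show ?thesis using commutator_\<Gamma>_pairs generate.incl by metis
  next
    case 2
    then show ?thesis
      using commutator_swap_mem[OF filt_subgroup xc gc] \<Gamma>_filt[OF \<Gamma>_commutator[OF i]] by blast
  next
    case 3
    then obtain h where h: "h \<in> \<Gamma> 2" "commutator S g x = commutator S h x"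
      using boundary[OF 3(1)] x2 generate.incl by (metis max.idem)
    then show ?thesis using commutator_\<Gamma>_pairs[OF \<Gamma>_0[OF h(1)]] generate.incl 3(2) by metis
  next
    case 4
    then obtain h where h: "h \<in> \<Gamma> 2" "commutator S x g = inv (w h x)"
      using boundary[OF 4(1)] \<Gamma>_0 by (metis max.idem)
    \<comment> \<open>h is only known to lie in \<open>\<Gamma> 2\<close>; after the swap the weight
      is read off x, which lies in \<open>\<Gamma> i\<close>.\<close>
    then have "commutator S x g = w x h" using w_swap[OF \<Gamma>_0[OF h(1)] \<Gamma>_0[OF 4(2)]] by simp
    moreover have "w x h \<in> pairs (Suc i)" using 4(2) \<Gamma>_0[OF h(1)] by (auto simp: pairs_def)
    ultimately show ?thesis using pairs_filt commutator_swap_mem[OF filt_subgroup xc gc] by simp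
  qed
qed

lemma filt_normal: "normalizes (carrier S) (filt i)"
proof (cases "1 \<le> i")
  case False
  then show ?thesis using filt_small[of i] by (simp add: normalizes_def)
next
  case True
  \<comment> \<open>Both conjugations are demanded so that the set is closed under inverses.\<close>
  let ?X = "{g \<in> carrier S. \<forall>x\<in>filt i. g \<otimes> x \<otimes> inv g \<in> filt i \<and> inv g \<otimes> x \<otimes> g \<in> filt i}"
  have sub: "subgroup ?X S"
  proof (rule subgroupI)
    show "?X \<noteq> {}" using filt_carrier by (auto intro!: exI[of _ \<one>])
    show "a \<otimes> b \<in> ?X" if a: "a \<in> ?X" and b: "b \<in> ?X" for a b
    proof -
      have "a \<otimes> b \<otimes> x \<otimes> inv (a \<otimes> b) = a \<otimes> (b \<otimes> x \<otimes> inv b) \<otimes> inv a"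
        "inv (a \<otimes> b) \<otimes> x \<otimes> (a \<otimes> b) = inv b \<otimes> (inv a \<otimes> x \<otimes> a) \<otimes> b" if "x \<in> filt i" for x
        using a b filt_carrier[OF that] by (simp_all add: word_simps)
      then show ?thesis using a b by auto
    qed
  qed auto
  have conj: "g \<otimes> x \<otimes> inv g \<in> filt i" if g: "g \<in> \<Gamma> 0 \<union> generate S (pairs 2)" and x: "x \<in> filt i" for g x
  proof -
    have gc: "g \<in> carrier S" using g \<Gamma>_carrier generate_pairs_carrier by blast
    have "g \<otimes> y \<otimes> inv g \<in> filt i" if y: "y \<in> pairs i \<union> \<Gamma> i" for y
    proof -
      have "commutator S g y \<in> filt i"
        using filt_le[of i "Suc i"] commutator_generators[OF True g y] by simp
      moreover have "y \<in> filt i" using y pairs_filt \<Gamma>_filt by blast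
      ultimately show ?thesis
        using conj_eq_commutator_mult[OF gc, of y] filt_carrier subgroup.m_closed[OF filt_subgroup]
        by simp
    qed
    then have "filt i \<subseteq> {x \<in> carrier S. g \<otimes> x \<otimes> inv g \<in> filt i}"
      using generate_subset_subgroup[OF subgroup_conj_preimage[OF filt_subgroup gc],
          of "pairs i \<union> \<Gamma> i"] generators_carrier
      unfolding filt_def by blast
    then show ?thesis using x by blast
  qed
  have "\<Gamma> 0 \<union> pairs 2 \<subseteq> ?X"
  proof
    fix g assume g: "g \<in> \<Gamma> 0 \<union> pairs 2"
    have "subgroup (generate S (pairs 2)) S" using generate_is_subgroup pairs_carrier by blast
    then have "inv g \<in> \<Gamma> 0 \<union> generate S (pairs 2)" "g \<in> \<Gamma> 0 \<union> generate S (pairs 2)"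
      using g subgroup.m_inv_closed[OF \<Gamma>_subgroup] by (auto intro: generate.incl generate.inv)
    moreover have "g \<in> carrier S" using g \<Gamma>_carrier pairs_carrier by blast
    ultimately show "g \<in> ?X" using conj[of g] conj[of "inv g"] by simp
  qed
  then have "carrier S \<subseteq> ?X"
    using generate_subset_subgroup[OF sub] carrier_generate unfolding pairs_two by blast
  then show ?thesis by (auto simp: normalizes_def)
qed

lemma carrier_generate': "carrier S \<subseteq> generate S (\<Gamma> 0 \<union> generate S (pairs 2))"
proof -
  have "\<Gamma> 0 \<union> pairs 2 \<subseteq> \<Gamma> 0 \<union> generate S (pairs 2)" by (auto intro: generate.incl)
  from mono_generate[OF this] show ?thesis using carrier_generate unfolding pairs_two by blast
qed

lemma filt_central:
  assumes i: "1 \<le> i" and a: "a \<in> carrier S" and x: "x \<in> filt i"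
  shows "commutator S a x \<in> filt (Suc i)"
proof (rule commutator_generate[OF subgroup_self filt_subgroup filt_normal])
  show "\<Gamma> 0 \<union> generate S (pairs 2) \<subseteq> carrier S" using \<Gamma>_carrier generate_pairs_carrier by blast
  show "a \<in> generate S (\<Gamma> 0 \<union> generate S (pairs 2))" using a carrier_generate' by blast
  show "x \<in> generate S (pairs i \<union> \<Gamma> i)" using x by (simp add: filt_def)
qed (use generators_carrier commutator_generators[OF i] in auto)

text \<open>Induction on j by the three subgroup argument. Hall-Witt expresses [[x, g], s] through a
  commutator of [g, c] with a conjugate of x and one of [c, x] with a conjugate of g. The first is
  placed by centrality and then the induction hypothesis, the second in the opposite order.\<close>

lemma commutator_\<Gamma>_filt:
  assumes "1 \<le> j" "1 \<le> i" "x \<in> \<Gamma> j" "s \<in> filt i"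
  shows "commutator S x s \<in> filt (i + j)"
  using assms
proof (induction j arbitrary: i x s rule: dec_induct)
  case base
  then show ?case using filt_central[of i x s] \<Gamma>_carrier by simp
next
  case (step j)
  let ?c = "commutator S" and ?N = "filt (i + Suc j)"
  note sub = filt_subgroup
  have sc: "s \<in> carrier S" using filt_carrier step.prems by blast
  have conj: "a \<otimes> b \<otimes> inv a \<in> filt m" if "a \<in> carrier S" "b \<in> filt m" for a b m
    using normalizesD[OF filt_normal that] .
  have "?c (?c x g) s \<in> ?N" if x: "x \<in> \<Gamma> j" and g: "g \<in> \<Gamma> 0" for x g
  proof -
    note [simp] = \<Gamma>_carrier[OF x] \<Gamma>_carrier[OF g] sc
    \<comment> \<open>With this c the conjugated entry g c g^-1 of Hall-Witt is s itself.\<close>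
    define c where "c = inv g \<otimes> s \<otimes> g"
    have c: "c \<in> filt i" using conj[of "inv g" s i] step.prems by (simp add: c_def)
    note [simp] = filt_carrier[OF c]
    have s: "g \<otimes> c \<otimes> inv g = s" by (simp add: c_def word_simps)
    have gc: "?c g c \<in> filt (Suc i)" using filt_central[OF step.prems(1) _ c, of g] by simp
    \<comment> \<open>The induction hypothesis wants x itself as an entry, so the conjugation by c
      is moved to the other entry.\<close>
    have "?c x (inv c \<otimes> ?c g c \<otimes> c) \<in> filt (Suc i + j)"
      by (rule step.IH[OF _ x]) (use conj[of "inv c", OF _ gc] in simp_all)
    then have "?c (inv c \<otimes> ?c g c \<otimes> c) x \<in> filt (Suc i + j)"
      using commutator_swap_mem[OF sub, of x "inv c \<otimes> ?c g c \<otimes> c"] by simp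
    then have "c \<otimes> ?c (inv c \<otimes> ?c g c \<otimes> c) x \<otimes> inv c \<in> ?N"
      using conj[of c] by simp
    then have n1: "?c (?c g c) (c \<otimes> x \<otimes> inv c) \<in> ?N"
      by (simp add: commutator_def word_simps)
    have "?c x c \<in> filt (i + j)" using step.IH[OF step.prems(1) x c] .
    then have "?c c x \<in> filt (i + j)" using commutator_swap_mem[OF sub, of x c] by simp
    then have "inv x \<otimes> ?c c x \<otimes> x \<in> filt (i + j)" using conj[of "inv x"] by simp
    then have "?c g (inv x \<otimes> ?c c x \<otimes> x) \<in> ?N"
      using filt_central[of "i + j" g] step.prems(1) by simp
    then have "?c (inv x \<otimes> ?c c x \<otimes> x) g \<in> ?N"
      using commutator_swap_mem[OF sub, of g "inv x \<otimes> ?c c x \<otimes> x"] by simp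
    then have "x \<otimes> ?c (inv x \<otimes> ?c c x \<otimes> x) g \<otimes> inv x \<in> ?N"
      using conj[of x] by simp
    then have n2: "?c (?c c x) (x \<otimes> g \<otimes> inv x) \<in> ?N"
      by (simp add: commutator_def word_simps)
    have "?c (?c x g) s = inv (?c (?c g c) (c \<otimes> x \<otimes> inv c) \<otimes> ?c (?c c x) (x \<otimes> g \<otimes> inv x))"
      using hall_witt[of x g c] s by (intro inv_equality[symmetric]) simp_all
    then show ?thesis using n1 n2 subgroup.m_closed[OF sub] subgroup.m_inv_closed[OF sub] by simp
  qed
  then have N: "?c a s \<in> ?N" if "a \<in> {?c x g | x g. x \<in> \<Gamma> j \<and> g \<in> \<Gamma> 0}" for a using that by blast
  have x: "x \<in> generate S {?c x g | x g. x \<in> \<Gamma> j \<and> g \<in> \<Gamma> 0}"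
    using step.prems(2) \<Gamma>_Suc[of j] step.hyps by simp
  have "{?c x g | x g. x \<in> \<Gamma> j \<and> g \<in> \<Gamma> 0} \<subseteq> carrier S" using \<Gamma>_carrier by auto
  from commutator_generate_left[OF subgroup_self sub filt_normal this sc N x] show ?case .
qed

text \<open>The new case is that of two wedges: by \<open>w_boundary\<close> the first acts on the
  second as an element of \<open>\<Gamma> i\<close> does, so \<open>commutator_\<Gamma>_filt\<close>
  applies. Index 0 is treated as index 1, the two terms being equal.\<close>

lemma nseries_filt: "nseries S filt"
proof -
  have pos: "commutator S a b \<in> filt (i + j)"
    if ij: "1 \<le> i" "1 \<le> j" and a: "a \<in> filt i" and b: "b \<in> filt j" for i j a b
  proof (rule commutator_generate[OF subgroup_self filt_subgroup filt_normal generators_carrier generators_carrier])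
    show "a \<in> generate S (pairs i \<union> \<Gamma> i)" "b \<in> generate S (pairs j \<union> \<Gamma> j)"
      using a b by (simp_all add: filt_def)
    fix x y assume x: "x \<in> pairs i \<union> \<Gamma> i" and y: "y \<in> pairs j \<union> \<Gamma> j"
    have xy: "x \<in> carrier S" "y \<in> carrier S" "x \<in> filt i" "y \<in> filt j"
      using x y generators_carrier pairs_filt \<Gamma>_filt by blast+
    consider "x \<in> \<Gamma> i" | "y \<in> \<Gamma> j" | "x \<in> pairs i" "y \<in> pairs j" using x y by blast
    then show "commutator S x y \<in> filt (i + j)"
    proof cases
      case 1
      then show ?thesis using commutator_\<Gamma>_filt[of i j x y] ij xy by (simp add: add.commute)
    next
      case 2
      then show ?thesis
        using commutator_\<Gamma>_filt[of j i y x] ij xy commutator_swap_mem[OF filt_subgroup xy(2,1)] by simp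
    next
      case 3
      have "y \<in> pairs 2" using 3(2) pairs_max[of j] pairs_le[of 2 "max j 2"] by simp
      then obtain h where h: "h \<in> \<Gamma> (max i 2)" "commutator S x y = commutator S h y"
        using boundary[OF generate.incl[OF 3(1)]] generate.incl by metis
      have "h \<in> \<Gamma> i" using \<Gamma>_le[OF _ h(1), of i] by simp
      then show ?thesis using commutator_\<Gamma>_filt[of i j h y] ij xy h(2) by (simp add: add.commute)
    qed
  qed
  have "commutator S a b \<in> filt (i + j)" if a: "a \<in> filt i" and b: "b \<in> filt j" for i j a b
  proof -
    have eq: "filt 0 = filt 1" using filt_small[of 0] filt_small[of 1] by simp
    have max: "filt (max m 1) = filt m" for m using eq by (cases m) simp_all
    have "commutator S a b \<in> filt (max i 1 + max j 1)"
      by (rule pos) (use a b max in simp_all)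
    then show ?thesis using filt_le[of "i + j" "max i 1 + max j 1"] by simp
  qed
  then show ?thesis unfolding nseries_def using filt_subgroup filt_le[of i "Suc i" for i] by auto
qed

end

section \<open>Powers in the filtration\<close>

context crossed_pairing
begin

lemma filt_normalizes: "normalizes (filt i) (filt j)"
  using filt_normal[of j] filt_carrier by (auto simp: normalizes_def)

text \<open>Let x have weight d and t = w x y. In the group generated by x and
  \<open>filt (d + 1)\<close> commutators already lie in \<open>filt (2 * d + 1)\<close>, because x
  commutes with itself; so the i-th term may be \<open>filt (d * i + 1)\<close>, one deeper than the
  weight of x suggests. Modulo \<open>filt (p * d + 1)\<close> the class is then less than p, and t
  is a product of two torsion elements.\<close>

lemma filt_pow_prime_power:
  assumes p: "prime p" and tors: "\<And>x. x \<in> \<Gamma> 0 \<Longrightarrow> x [^] (p ^ k) = \<one>" and d: "1 \<le> d"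
    and a: "a \<in> filt (Suc d)"
  shows "a [^] (p ^ k) \<in> filt (p * d + 1)"
proof -
  let ?e = "p ^ k" and ?N = "filt (p * d + 1)"
  have p2: "2 \<le> p" using prime_ge_2_nat[OF p] .
  have wtors: "w x y [^] ?e \<in> ?N" if x: "x \<in> \<Gamma> d" and y: "y \<in> \<Gamma> 0" for x y
  proof -
    let ?t = "w x y" and ?A = "insert x (filt (Suc d))"
    let ?K = "\<lambda>i. filt (d * i + 1)"
    let ?R = "\<lambda>i. if i < 2 then generate S ?A else ?K i"
    have xd: "x \<in> filt d" by (rule \<Gamma>_filt[OF x])
    have A: "?A \<subseteq> filt d" using xd filt_le[of d "Suc d"] by auto
    have R: "nseries S ?R"
    proof (rule nseries_adjoin[OF filt_subgroup A])
      show "subgroup (?K i) S \<and> normalizes (filt d) (?K i) \<and> ?K (Suc i) \<subseteq> ?K i" for i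
        using filt_subgroup filt_normalizes filt_le[of "d * i + 1" "d * Suc i + 1"] by auto
      show "commutator S a b \<in> ?K (i + j)" if "a \<in> ?K i" "b \<in> ?K j" for i j a b
        using nseries_commutator_le[OF nseries_filt that] by (simp add: distrib_left)
      show "commutator S a b \<in> ?K (Suc i)" if "a \<in> ?A" "b \<in> ?K i" for i a b
        using nseries_commutator[OF nseries_filt, of a d b "d * i + 1"] that A
        by (auto simp: add.assoc)
      show "commutator S a b \<in> ?K 2" if a: "a \<in> ?A" and b: "b \<in> ?A" for a b
      proof (cases "a = x \<and> b = x")
        case True
        then show ?thesis using \<Gamma>_carrier[OF x] subgroup.one_closed[OF filt_subgroup] by simp
      next
        case False
        have "a \<in> filt d" "b \<in> filt d" using a b A by blast+
        then show ?thesis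
          using False a b nseries_commutator[OF nseries_filt, of a "Suc d" b d]
            nseries_commutator[OF nseries_filt, of a d b "Suc d"] by (auto simp: mult_2_right)
      qed
      have "filt (Suc d) \<subseteq> generate S ?A" by (meson generate.incl insertCI subsetI)
      then show "?K 2 \<subseteq> generate S ?A" using filt_le[of "Suc d" "d * 2 + 1"] by auto
    qed
    have x0: "x \<in> \<Gamma> 0" using \<Gamma>_0[OF x] .
    have "?t \<in> pairs (Suc d)" using x y by (auto simp: pairs_def)
    then have t: "?t \<in> generate S ?A" "?t \<in> carrier S"
      using pairs_filt pairs_carrier by (auto intro: generate.incl)
    have xA: "x \<in> generate S ?A" by (simp add: generate.incl)
    have xt: "inv x \<otimes> ?t \<in> ?R 1"
      using t(1) by (auto intro!: generate.eng intro: generate.inv)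
    have "x [^] ?e \<otimes> (inv x \<otimes> ?t) [^] ?e = \<one>"
      using w_pow[OF x0 y, of ?e] tors[OF x0] w_one[OF y] by metis
    then have "(inv x \<otimes> ?t) [^] ?e = \<one>" using tors[OF x0] \<Gamma>_carrier[OF x] t(2) by simp
    moreover have "normalizes (?R 1) ?N"
      using filt_normal[of "p * d + 1"] nseries_mem_carrier[OF R, of _ 1] by (simp add: normalizes_def)
    ultimately have "(x \<otimes> (inv x \<otimes> ?t)) [^] ?e \<in> ?N"
      using torsion_mult_closed[OF p R, of "p - 1" ?N x k "inv x \<otimes> ?t"] p2 filt_subgroup xA xt
        tors[OF x0] subgroup.one_closed[OF filt_subgroup] by (simp add: mult.commute)
    then show ?thesis using \<Gamma>_carrier[OF x] t(2) by (simp add: word_simps)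
  qed
  have gen: "b [^] ?e \<in> ?N" if "b \<in> pairs (Suc d) \<union> \<Gamma> (Suc d)" for b
    using that wtors tors[OF \<Gamma>_0] subgroup.one_closed[OF filt_subgroup] by (auto simp: pairs_def)
  \<comment> \<open>For the passage from generators to all of \<open>filt (d + 1)\<close> the
    multiples of d + 1 serve as series; the p-th of them is at least p d + 1.\<close>
  show ?thesis
  proof (rule torsion_generate[OF p nseries_multiples[OF nseries_filt, of "Suc d"], of "p - 1"])
    show "pairs (Suc d) \<union> \<Gamma> (Suc d) \<subseteq> filt (Suc d * 1)" using pairs_filt \<Gamma>_filt by auto
    have "p * d + 1 \<le> Suc d * Suc (p - 1)" using p2 by simp
    then show "filt (Suc d * Suc (p - 1)) \<subseteq> ?N" using filt_le by blast
    show "a \<in> generate S (pairs (Suc d) \<union> \<Gamma> (Suc d))" using a by (simp add: filt_def)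
  qed (use p2 filt_subgroup filt_normalizes gen in auto)
qed

text \<open>Start with d = 1, that is with \<open>filt 2\<close>; each e-th power replaces d by p
  d.\<close>

theorem torsion_large_class:
  assumes p: "prime p" and tors: "\<And>x. x \<in> \<Gamma> 0 \<Longrightarrow> x [^] (p ^ k) = \<one>"
    and triv: "filt (Suc (p ^ n)) = {\<one>}" and a: "a \<in> filt 2"
  shows "a [^] ((p ^ k) ^ n) = \<one>"
proof -
  have "a [^] ((p ^ k) ^ n) \<in> filt (Suc (p ^ n))" for n
  proof (induction n)
    case 0
    then show ?case using a filt_carrier[OF a] by (simp add: numeral_2_eq_2)
  next
    case (Suc n)
    have "1 \<le> p ^ n" using prime_gt_0_nat[OF p] by simp
    then show ?case
      using filt_pow_prime_power[OF p tors _ Suc] filt_carrier[OF a]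
      by (simp add: nat_pow_pow mult.commute)
  qed
  then show ?thesis using triv by blast
qed

section \<open>Multilinearity of iterated commutators at the last nontrivial depth\<close>

definition comm_iter :: "'a \<Rightarrow> nat \<Rightarrow> 'a \<Rightarrow> 'a" where
  "comm_iter g r = (commutator S g) ^^ r"

lemma comm_iter_0 [simp]: "comm_iter g 0 c = c"
  by (simp add: comm_iter_def)

lemma comm_iter_Suc: "comm_iter g (Suc r) c = comm_iter g r (commutator S g c)"
  by (simp add: comm_iter_def funpow_swap1)

lemma comm_iter_Suc_right: "comm_iter g (Suc r) c = commutator S g (comm_iter g r c)"
  by (simp add: comm_iter_def)

lemma comm_iter_filt:
  assumes "g \<in> \<Gamma> 0" "c \<in> filt i" "1 \<le> i"
  shows "comm_iter g r c \<in> filt (i + r)"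
proof (induction r)
  case (Suc r)
  then show ?case
    using filt_central[OF _ \<Gamma>_carrier[OF assms(1)] Suc] assms(3) by (simp add: comm_iter_Suc_right)
qed (use assms in simp)

text \<open>[g, a b] = [g, a] [a, [g, b]] [g, b], and the middle factor has depth at least i + 2, so
  the remaining commutators kill it.\<close>

lemma comm_iter_mult:
  assumes triv: "filt (i + Suc m) = {\<one>}" and i: "1 \<le> i" and g: "g \<in> \<Gamma> 0"
    and a: "a \<in> filt i" and b: "b \<in> filt i"
  shows "comm_iter g m (a \<otimes> b) = comm_iter g m a \<otimes> comm_iter g m b"
  using triv i a b
proof (induction m arbitrary: i a b)
  case (Suc m)
  note [simp] = filt_carrier[OF Suc.prems(3)] filt_carrier[OF Suc.prems(4)] \<Gamma>_carrier[OF g]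
  let ?c = "commutator S"
  have ga: "?c g a \<in> filt (Suc i)" and gb: "?c g b \<in> filt (Suc i)"
    using filt_central[OF Suc.prems(2)] Suc.prems by auto
  have h2: "?c a (?c g b) \<in> filt (Suc (Suc i))"
    using nseries_commutator_le[OF nseries_filt Suc.prems(3) gb] Suc.prems(2) by simp
  then have h1: "?c a (?c g b) \<in> filt (Suc i)" using filt_le[of "Suc i" "Suc (Suc i)"] by simp
  have triv: "filt (Suc i + Suc m) = {\<one>}" using Suc.prems(1) by simp
  have "comm_iter g m (?c a (?c g b)) \<in> filt (Suc (Suc i) + m)"
    using comm_iter_filt[OF g h2] by simp
  then have k: "comm_iter g m (?c a (?c g b)) = \<one>" using triv by simp
  have gb': "comm_iter g m (?c g b) \<in> carrier S" using filt_carrier[OF comm_iter_filt[OF g gb]] by simp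
  have "?c g (a \<otimes> b) = ?c g a \<otimes> (?c a (?c g b) \<otimes> ?c g b)"
    by (simp add: commutator_mult_right conj_eq_commutator_mult)
  moreover have "?c a (?c g b) \<otimes> ?c g b \<in> filt (Suc i)"
    using subgroup.m_closed[OF filt_subgroup h1 gb] .
  ultimately show ?case
    using Suc.IH[OF triv _ ga] Suc.IH[OF triv _ h1 gb] k gb' by (simp add: comm_iter_Suc)
qed simp

lemma comm_iter_inv:
  assumes triv: "filt (i + Suc m) = {\<one>}" and i: "1 \<le> i" and g: "g \<in> \<Gamma> 0" and a: "a \<in> filt i"
  shows "comm_iter g m (inv a) = inv (comm_iter g m a)"
proof -
  have ia: "inv a \<in> filt i" using subgroup.m_inv_closed[OF filt_subgroup a] .
  have "comm_iter g m \<one> = \<one>" using \<Gamma>_carrier[OF g] by (induction m) (simp_all add: comm_iter_Suc)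
  then have "comm_iter g m (inv a) \<otimes> comm_iter g m a = \<one>"
    using comm_iter_mult[OF triv i g ia a] filt_carrier[OF a] by simp
  then show ?thesis
    using comm_iter_filt[OF g a i] comm_iter_filt[OF g ia i] filt_carrier by (metis inv_equality)
qed

lemma comm_iter_trivial:
  assumes "filt (i + m) = {\<one>}" "1 \<le> i" "g \<in> \<Gamma> 0" "a \<in> filt i"
  shows "comm_iter g m a = \<one>"
  using comm_iter_filt[OF assms(3,4,2), of m] assms(1) by simp

text \<open>Only the innermost entry is expanded. The outer entries \<open>g\<close> will also be x
  y^j; the induction in \<open>comm_iter_moments\<close> deals with them one at a time.\<close>

lemma comm_iter_shift:
  assumes triv: "filt (i + Suc (Suc m)) = {\<one>}" and i: "1 \<le> i"
    and x: "x \<in> \<Gamma> 0" and y: "y \<in> \<Gamma> 0" and g: "g \<in> \<Gamma> 0" and c: "c \<in> filt i"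
  shows "comm_iter g m (commutator S (x \<otimes> y [^] (j::nat)) c) =
    comm_iter g m (commutator S x c) \<otimes> comm_iter g m (commutator S y c) [^] j"
proof -
  let ?c = "commutator S"
  note [simp] = \<Gamma>_carrier[OF x] \<Gamma>_carrier[OF y] filt_carrier[OF c]
  have triv': "filt (Suc i + Suc m) = {\<one>}" using triv by simp
  have cen: "?c a b \<in> filt (Suc l)" if "a \<in> carrier S" "b \<in> filt l" "1 \<le> l" for a b l
    using filt_central that by blast
  have mult: "comm_iter g m (?c (a \<otimes> b) c) = comm_iter g m (?c b c) \<otimes> comm_iter g m (?c a c)"
    if [simp]: "a \<in> carrier S" "b \<in> carrier S" for a b
  proof -
    have ac: "?c a c \<in> filt (Suc i)" and bc: "?c b c \<in> filt (Suc i)" using cen c i by auto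
    have h2: "?c a (?c b c) \<in> filt (Suc (Suc i))" using cen[OF _ bc] by simp
    then have h1: "?c a (?c b c) \<in> filt (Suc i)" using filt_le[of "Suc i" "Suc (Suc i)"] by simp
    have "?c (a \<otimes> b) c = ?c a (?c b c) \<otimes> (?c b c \<otimes> ?c a c)"
      by (simp add: commutator_def word_simps)
    moreover have "comm_iter g m (?c a (?c b c)) = \<one>"
      by (rule comm_iter_trivial[OF _ _ g h2]) (use triv' in simp_all)
    moreover have "?c b c \<otimes> ?c a c \<in> filt (Suc i)" using subgroup.m_closed[OF filt_subgroup bc ac] .
    ultimately show ?thesis
      using comm_iter_mult[OF triv' _ g h1] comm_iter_mult[OF triv' _ g bc ac]
        filt_carrier[OF comm_iter_filt[OF g ac]] filt_carrier[OF comm_iter_filt[OF g bc]] by simp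
  qed
  have X: "comm_iter g m (?c a c) \<in> carrier S" if "a \<in> carrier S" for a
    using filt_carrier[OF comm_iter_filt[OF g cen[OF that c i]]] by simp
  have Z: "comm_iter g m (?c a c) \<otimes> b = b \<otimes> comm_iter g m (?c a c)"
    if "a \<in> carrier S" "b \<in> carrier S" for a b
  proof -
    have "?c b (comm_iter g m (?c a c)) \<in> filt (Suc (Suc i + m))"
      using cen[OF that(2) comm_iter_filt[OF g cen[OF that(1) c i]]] by simp
    then have "?c b (comm_iter g m (?c a c)) = \<one>" using triv by simp
    then have "b \<otimes> comm_iter g m (?c a c) \<otimes> inv b = comm_iter g m (?c a c)"
      using conj_eq_commutator_mult[OF that(2) X[OF that(1)]] X[OF that(1)] by simp
    then show ?thesis using X[OF that(1)] that(2) by (metis inv_solve_right' m_closed)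
  qed
  have pow: "comm_iter g m (?c (y [^] j) c) = comm_iter g m (?c y c) [^] j"
  proof (induction j)
    case 0
    have "comm_iter g m \<one> = \<one>" using \<Gamma>_carrier[OF g] by (induction m) (simp_all add: comm_iter_Suc)
    then show ?case by simp
  next
    case (Suc j)
    then show ?case using mult[of "y [^] j" y] nat_pow_Suc2[of "comm_iter g m (?c y c)"] X by simp
  qed
  show ?thesis using mult[of x "y [^] j"] pow Z[of "y [^] j" "comm_iter g m (?c x c)"] X by simp
qed

text \<open>The sequence \<open>n \<mapsto> x\<^sup>n (x\<^sup>-\<^sup>1 t)\<^sup>n = x\<^sup>n \<and> y\<close>, with \<open>t = x \<and> y\<close>, has Newton coefficients in
  \<open>filt (i + 1)\<close>; evaluating it at the exponent kills all but the first and the \<open>p\<close>-th of them, and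
  the \<open>p\<close>-th is its \<open>p\<close>-th difference at \<open>0\<close>.\<close>

lemma pairing_pow_comm_iter:
  assumes p: "prime p" and tors: "\<And>x. x \<in> \<Gamma> 0 \<Longrightarrow> x [^] (p ^ k) = \<one>"
    and tors3: "\<And>a. a \<in> filt 3 \<Longrightarrow> a [^] (p ^ k) = \<one>" and triv: "filt (p + 2) = {\<one>}"
    and x: "x \<in> \<Gamma> 0" and y: "y \<in> \<Gamma> 0"
  shows "w x y [^] (p ^ k) \<otimes> comm_iter x (p - 1) (w x y) [^] (p ^ k choose p) = \<one>"
proof -
  let ?t = "w x y" and ?e = "p ^ k"
  have p2: "2 \<le> p" using prime_ge_2_nat[OF p] .
  note [simp] = \<Gamma>_carrier[OF x] w_closed[OF x y]
  have t: "?t \<in> filt 2" using x y by (intro pairs_filt) (auto simp: pairs_two)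
  define f where "f n = x [^] n \<otimes> (inv x \<otimes> ?t) [^] n" for n :: nat
  have D: "diff_seq S f = (\<lambda>n. x [^] n \<otimes> ?t \<otimes> inv (x [^] n))"
  proof
    fix n
    have "f (Suc n) = x [^] n \<otimes> ?t \<otimes> (inv x \<otimes> ?t) [^] n"
      unfolding f_def nat_pow_Suc2[OF m_closed[OF inv_closed[OF \<Gamma>_carrier[OF x]] w_closed[OF x y]]]
      by (simp add: word_simps)
    then show "diff_seq S f n = x [^] n \<otimes> ?t \<otimes> inv (x [^] n)"
      by (simp add: diff_seq_def f_def word_simps)
  qed
  have conj_diff: "diff_seq S (\<lambda>n. x [^] n \<otimes> c \<otimes> inv (x [^] n)) =
      (\<lambda>n. x [^] n \<otimes> commutator S x c \<otimes> inv (x [^] n))" if "c \<in> carrier S" for c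
    using that by (auto simp: diff_seq_def commutator_def word_simps)
  have iter_carrier: "comm_iter x r ?t \<in> carrier S" for r using filt_carrier[OF comm_iter_filt[OF x t]] by simp
  \<comment> \<open>On sequences x^n c x^-n the difference replaces c by [x, c], so iterated
    differences become iterated commutators.\<close>
  have Dr: "(diff_seq S ^^ Suc r) f = (\<lambda>n. x [^] n \<otimes> comm_iter x r ?t \<otimes> inv (x [^] n))" for r
  proof (induction r)
    case (Suc r)
    then show ?case using conj_diff[OF iter_carrier] by (simp add: comm_iter_Suc_right)
  qed (simp add: D)
  obtain q where q: "p = Suc q" using p2 by (cases p) auto
  have top: "(diff_seq S ^^ p) f 0 = comm_iter x (p - 1) ?t"
    unfolding q Dr using iter_carrier by simp
  \<comment> \<open>As a product of powers \<open>f\<close> would only get degree 0. Degree 1 comes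
    from its difference x^n t x^-n = [x^n, t] t, which has degree 2 like t.\<close>
  have "(\<lambda>n. x [^] n) \<in> poly_seq S filt 0"
    by (rule poly_seq_pow[OF nseries_filt]) (simp add: filt_small)
  then have "(\<lambda>n. commutator S (x [^] n) ?t \<otimes> ?t) \<in> poly_seq S filt 2"
    using poly_seq_mult[OF nseries_filt _ poly_seq_const[OF nseries_filt t]]
      poly_seq_commutator[OF nseries_filt _ poly_seq_const[OF nseries_filt t], of _ 0]
    by (simp add: numeral_2_eq_2)
  then have "diff_seq S f \<in> poly_seq S filt 2"
    unfolding D by (simp add: conj_eq_commutator_mult)
  moreover have "\<forall>n. f n \<in> filt 1" by (simp add: f_def filt_small)
  ultimately have f: "f \<in> poly_seq S filt 1"
    by (subst poly_seq_iff) (simp add: numeral_2_eq_2)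
  \<comment> \<open>The bound must reach both p^k and p, and p^k = 1 < p occurs for k = 0.\<close>
  obtain a where a: "\<And>i. a i \<in> filt (1 + i)"
    "\<And>n. n \<le> ?e + p \<Longrightarrow> f n = newton_product S a (?e + p) n"
    using newton_expansion[OF nseries_filt f, of "?e + p"] by (auto simp: f_def)
  have ac: "a i \<in> carrier S" for i using filt_carrier[OF a(1)] .
  have "a 1 = newton_product S a (?e + p) 1"
    by (rule newton_product_one[symmetric, OF ac]) (use p2 in simp)
  also have "\<dots> = f 1" by (rule a(2)[symmetric]) (use p2 in simp)
  finally have a1: "a 1 = ?t" by (simp add: f_def word_simps)
  have "a p = (diff_seq S ^^ p) f 0"
    by (rule newton_top_coefficient[OF nseries_filt _ a(1) _ _ _ a(2)]) (use p2 triv in auto)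
  then have ap: "a p = comm_iter x (p - 1) ?t" using top by simp
  have "newton_product S a (?e + p) ?e = a 1 [^] ?e \<otimes> a p [^] (?e choose p)"
  proof (rule newton_product_two_terms[OF ac p2])
    fix i :: nat assume i: "2 \<le> i" "i \<noteq> p"
    show "a i [^] (?e choose i) = \<one>"
    proof (cases "i < p")
      case True
      then obtain q where "(?e choose i) = ?e * q"
        using prime_power_dvd_choose[OF p, of i k] i by auto
      moreover have "a i \<in> filt 3" using filt_le[OF _ a(1), of 3 i] i by simp
      ultimately show ?thesis using tors3 ac by (simp add: nat_pow_pow[symmetric])
    next
      case False
      then have "a i \<in> filt (p + 2)" using filt_le[OF _ a(1), of "p + 2" i] i by simp
      then show ?thesis using triv by simp
    qed
  qed simp
  then have "f ?e = ?t [^] ?e \<otimes> comm_iter x (p - 1) ?t [^] (?e choose p)"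
    using a(2)[of ?e] a1 ap by simp
  moreover have "f ?e = \<one>" unfolding f_def w_pow[OF x y] using tors[OF x] w_one[OF y] by simp
  ultimately show ?thesis by simp
qed

text \<open>As a function of \<open>j\<close>, \<open>[x y\<^sup>j, \<dots>, x y\<^sup>j, c]\<close> is a polynomial of degree \<open>m\<close> with leading
  coefficient \<open>[y, \<dots>, y, c]\<close>.\<close>

lemma comm_iter_moments:
  assumes p: "prime p" and x: "x \<in> \<Gamma> 0" and y: "y \<in> \<Gamma> 0"
    and triv: "filt (i + Suc m) = {\<one>}" and i: "1 \<le> i" and c: "c \<in> filt i"
    and tors: "\<And>a. a \<in> filt (i + m) \<Longrightarrow> a [^] (C * p) = \<one>"
  shows "m + l < p - 1 \<Longrightarrow> seq_prod S (\<lambda>j. comm_iter (x \<otimes> y [^] j) m c [^] (C * j ^ l)) p = \<one>"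
    and "m + l = p - 1 \<Longrightarrow>
      comm_iter y m c [^] C \<otimes> seq_prod S (\<lambda>j. comm_iter (x \<otimes> y [^] j) m c [^] (C * j ^ l)) p = \<one>"
proof -
  have "(m + l < p - 1 \<longrightarrow> seq_prod S (\<lambda>j. comm_iter (x \<otimes> y [^] j) m c [^] (C * j ^ l)) p = \<one>) \<and>
    (m + l = p - 1 \<longrightarrow>
      comm_iter y m c [^] C \<otimes> seq_prod S (\<lambda>j. comm_iter (x \<otimes> y [^] j) m c [^] (C * j ^ l)) p = \<one>)"
    using triv i c tors
  proof (induction m arbitrary: i c l)
    \<comment> \<open>The product is c to the power C times a power sum, which is 0 modulo p for l <
      p - 1 and -1 for l = p - 1.\<close>
    case 0
    have cc: "c \<in> carrier S" using filt_carrier[OF 0(3)] .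
    have kill: "c [^] (C * q) = \<one>" if pq: "p dvd q" for q
    proof -
      obtain r where "q = p * r" using pq by (rule dvdE)
      then have "C * q = (C * p) * r" by simp
      then have "c [^] (C * q) = (c [^] (C * p)) [^] r" by (simp only: nat_pow_pow[OF cc])
      moreover have "c [^] (C * p) = \<one>" using 0(3,4) by simp
      ultimately show ?thesis by simp
    qed
    have eq: "seq_prod S (\<lambda>j. comm_iter (x \<otimes> y [^] j) 0 c [^] (C * j ^ l)) p = c [^] (C * (\<Sum>j<p. j ^ l))"
      using seq_prod_const[OF cc, of "\<lambda>j. C * j ^ l" p] by (simp add: sum_distrib_left)
    have "l = p - 1 \<Longrightarrow> c [^] C \<otimes> c [^] (C * (\<Sum>j<p. j ^ l)) = \<one>"
      using kill[OF prime_dvd_Suc_power_sum[OF p]] cc by (simp add: nat_pow_mult)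
    then show ?case unfolding eq using kill[OF prime_dvd_power_sum[OF p]] by simp
  next
    case (Suc m)
    let ?c = "commutator S"
    let ?g = "\<lambda>j. x \<otimes> y [^] (j::nat)"
    have g: "?g j \<in> \<Gamma> 0" for j
      using subgroup.m_closed[OF \<Gamma>_subgroup x subgroup_pow[OF \<Gamma>_subgroup y]] .
    have xc: "?c x c \<in> filt (Suc i)" and yc: "?c y c \<in> filt (Suc i)"
      using filt_central[OF Suc.prems(2) _ Suc.prems(3)] \<Gamma>_carrier x y by auto
    \<comment> \<open>Expanding the innermost entry x y^j splits the product: \<open>F\<close> takes
      x and keeps the weight j^l, \<open>H\<close> takes y and gains a factor j. So the sum of
      degree and weight exponent drops by one in \<open>F\<close> and is kept in \<open>H\<close>.
      If it equals p - 1, the product over \<open>F\<close> is trivial and \<open>H\<close> carries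
      the leading term.\<close>
    define F where "F j = comm_iter (?g j) m (?c x c) [^] (C * j ^ l)" for j
    define H where "H j = comm_iter (?g j) m (?c y c) [^] (C * j ^ Suc l)" for j
    have mem: "comm_iter (?g j) m (?c x c) \<in> filt (i + Suc m)" "comm_iter (?g j) m (?c y c) \<in> filt (i + Suc m)" for j
      using comm_iter_filt[OF g xc] comm_iter_filt[OF g yc] by simp_all
    have comm: "a \<otimes> b = b \<otimes> a" if "a \<in> filt (i + Suc m)" "b \<in> carrier S" for a b
    proof -
      have "?c b a \<in> filt (Suc (i + Suc m))" using filt_central[OF _ that(2,1)] Suc.prems(2) by simp
      then have "?c b a = \<one>" using Suc.prems(1) by simp
      then have "b \<otimes> a \<otimes> inv b = a"
        using conj_eq_commutator_mult[OF that(2) filt_carrier[OF that(1)]] filt_carrier[OF that(1)] by simp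
      then show ?thesis using filt_carrier[OF that(1)] that(2) by (metis inv_solve_right' m_closed)
    qed
    have FH: "F j \<in> carrier S" "H j \<in> filt (i + Suc m)" for j
      unfolding F_def H_def
      using filt_carrier[OF subgroup_pow[OF filt_subgroup mem(1)]] subgroup_pow[OF filt_subgroup mem(2)]
      by blast+
    have Hc: "H j \<in> carrier S" for j using filt_carrier[OF FH(2)] .
    have "comm_iter (?g j) (Suc m) c [^] (C * j ^ l) = F j \<otimes> H j" for j
    proof -
      have "comm_iter (?g j) (Suc m) c = comm_iter (?g j) m (?c x c) \<otimes> comm_iter (?g j) m (?c y c) [^] j"
        using comm_iter_shift[OF Suc.prems(1,2) x y g Suc.prems(3)] by (simp add: comm_iter_Suc)
      moreover have "comm_iter (?g j) m (?c y c) [^] j \<in> filt (i + Suc m)"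
        using subgroup_pow[OF filt_subgroup mem(2)] .
      ultimately show ?thesis
        using pow_mult_distrib[OF comm[OF mem(1)]] filt_carrier[OF mem(1)] filt_carrier[OF mem(2)]
        by (simp add: F_def H_def nat_pow_pow mult.assoc mult.left_commute)
    qed
    then have split: "seq_prod S (\<lambda>j. comm_iter (?g j) (Suc m) c [^] (C * j ^ l)) p =
        seq_prod S F p \<otimes> seq_prod S H p"
      using seq_prod_mult[of F H p, OF FH(1) Hc comm[OF FH(2)]] by simp
    have triv': "filt (Suc i + Suc m) = {\<one>}" "1 \<le> Suc i" using Suc.prems(1) by simp_all
    have tors': "a [^] (C * p) = \<one>" if "a \<in> filt (Suc i + m)" for a using Suc.prems(4) that by simp
    note IH = Suc.IH[OF triv' xc tors', of l] Suc.IH[OF triv' yc tors', of "Suc l"]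
    have "seq_prod S H p \<in> carrier S" using seq_prod_closed[of H, OF Hc] .
    then show ?case
      unfolding split using IH[folded F_def H_def] by (auto simp: comm_iter_Suc F_def[abs_def] H_def[abs_def])
  qed
  then show "m + l < p - 1 \<Longrightarrow> seq_prod S (\<lambda>j. comm_iter (x \<otimes> y [^] j) m c [^] (C * j ^ l)) p = \<one>"
    "m + l = p - 1 \<Longrightarrow>
      comm_iter y m c [^] C \<otimes> seq_prod S (\<lambda>j. comm_iter (x \<otimes> y [^] j) m c [^] (C * j ^ l)) p = \<one>"
    by blast+
qed

theorem torsion_class_prime:
  assumes p: "prime p" and p3: "3 \<le> p" and tors: "\<And>x. x \<in> \<Gamma> 0 \<Longrightarrow> x [^] (p ^ k) = \<one>"
    and triv: "filt (p + 2) = {\<one>}" and a: "a \<in> generate S (pairs 2)"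
  shows "a [^] (p ^ k) = \<one>"
proof -
  let ?e = "p ^ k" and ?C = "p ^ k choose p"
  have tors3: "b [^] ?e = \<one>" if "b \<in> filt 3" for b
  proof -
    have "b [^] ?e \<in> filt (p * 2 + 1)"
      using filt_pow_prime_power[OF p tors, of 2 b] that by (simp add: numeral_3_eq_3)
    then show ?thesis using filt_le[of "p + 2" "p * 2 + 1"] p3 triv by auto
  qed
  \<comment> \<open>The binomial coefficient may miss one factor p of p^k; multiplication by p
    restores it.\<close>
  have torsC: "b [^] (?C * p) = \<one>" if b: "b \<in> filt 3" for b
  proof -
    obtain q where "p * ?C = ?e * q" using prime_power_dvd_mult_choose[OF p, of k] by blast
    then have "?C * p = ?e * q" by (simp only: mult.commute)
    then show ?thesis using tors3[OF b] filt_carrier[OF b] by (simp add: nat_pow_pow[symmetric])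
  qed
  have w: "w x y [^] ?e = \<one>" if x: "x \<in> \<Gamma> 0" and y: "y \<in> \<Gamma> 0" for x y
  proof -
    let ?t = "w x y" and ?g = "\<lambda>j. x \<otimes> y [^] (j::nat)"
    have t: "?t \<in> filt 2" using x y by (intro pairs_filt) (auto simp: pairs_two)
    have tc: "?t \<in> carrier S" using filt_carrier[OF t] .
    have triv2: "filt (2 + Suc (p - 1)) = {\<one>}" using triv p3 by simp
    have g: "?g j \<in> \<Gamma> 0" for j
      using subgroup.m_closed[OF \<Gamma>_subgroup x subgroup_pow[OF \<Gamma>_subgroup y]] .
    have top: "comm_iter h (p - 1) ?t \<in> filt (p + 1)" if "h \<in> \<Gamma> 0" for h
      using comm_iter_filt[OF that t, of "p - 1"] p3 by simp
    have top3: "comm_iter h (p - 1) ?t \<in> filt 3" if "h \<in> \<Gamma> 0" for h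
      using filt_le[OF _ top[OF that], of 3] p3 by simp
    have topc: "comm_iter h (p - 1) ?t \<in> carrier S" if "h \<in> \<Gamma> 0" for h
      using filt_carrier[OF top[OF that]] .
    define \<tau> where "\<tau> = comm_iter x (p - 1) ?t [^] ?C"
    have \<tau>c: "\<tau> \<in> carrier S" using topc[OF x] by (simp add: \<tau>_def)
    have \<tau>: "comm_iter (?g j) (p - 1) ?t [^] ?C = \<tau>" for j
    proof -
      have "?t [^] ?e \<otimes> comm_iter (?g j) (p - 1) ?t [^] ?C = \<one>"
        using pairing_pow_comm_iter[OF p tors tors3 triv g y] w_shift[OF x y] by simp
      moreover have "?t [^] ?e \<otimes> \<tau> = \<one>"
        unfolding \<tau>_def by (rule pairing_pow_comm_iter[OF p tors tors3 triv x y])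
      ultimately show ?thesis using tc \<tau>c topc[OF g] by (metis Units_eq Units_l_cancel nat_pow_closed)
    qed
    have "comm_iter y (p - 1) ?t [^] ?C \<otimes>
        seq_prod S (\<lambda>j. comm_iter (?g j) (p - 1) ?t [^] (?C * j ^ 0)) p = \<one>"
    proof (rule comm_iter_moments(2)[OF p x y triv2 _ t])
      fix b assume "b \<in> filt (2 + (p - 1))"
      then have "b \<in> filt 3" using filt_le[of 3 "2 + (p - 1)" b] p3 by simp
      then show "b [^] (?C * p) = \<one>" by (rule torsC)
    qed simp_all
    \<comment> \<open>All p factors equal \<open>\<tau>\<close>, and \<tau>^p is trivial by
      \<open>torsC\<close>; of the moment relation only the leading coefficient remains.\<close>
    moreover have "seq_prod S (\<lambda>j. comm_iter (?g j) (p - 1) ?t [^] (?C * j ^ 0)) p = \<one>"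
    proof -
      have "seq_prod S (\<lambda>j. comm_iter (?g j) (p - 1) ?t [^] (?C * j ^ 0)) p = seq_prod S (\<lambda>j. \<tau> [^] (1::nat)) p"
        using \<tau> \<tau>c by simp
      also have "\<dots> = \<tau> [^] p" using seq_prod_const[OF \<tau>c, of "\<lambda>j. 1" p] by simp
      also have "\<dots> = \<one>" unfolding \<tau>_def using torsC[OF top3[OF x]] topc[OF x] by (simp add: nat_pow_pow)
      finally show ?thesis .
    qed
    ultimately have "comm_iter y (p - 1) ?t [^] ?C = \<one>" using topc[OF y] by simp
    \<comment> \<open>The commutator shown to be trivial has entries y, but the relation for (x, y)
      has entries x. It is therefore inserted into the relation for (y, x), whose wedge is the
      inverse of t.\<close>
    moreover have "comm_iter y (p - 1) (inv ?t) = inv (comm_iter y (p - 1) ?t)"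
      by (rule comm_iter_inv[OF triv2 _ y t]) simp
    ultimately have "comm_iter y (p - 1) (inv ?t) [^] ?C = \<one>"
      using topc[OF y] by (simp add: nat_pow_inv)
    then have "(inv ?t) [^] ?e = \<one>"
      using pairing_pow_comm_iter[OF p tors tors3 triv y x] w_swap[OF x y] tc by simp
    then show ?thesis using tc by (simp add: nat_pow_inv)
  qed
  have "a [^] ?e \<in> {\<one>}"
  proof (rule torsion_generate[OF p nseries_multiples[OF nseries_filt, of 2], of "p - 1"])
    show "pairs 2 \<subseteq> filt (2 * 1)" using pairs_filt by auto
    show "filt (2 * Suc (p - 1)) \<subseteq> {\<one>}" using filt_le[of "p + 2" "2 * Suc (p - 1)"] p3 triv by auto
    show "b [^] ?e \<in> {\<one>}" if "b \<in> pairs 2" for b using that w by (auto simp: pairs_two)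
  qed (use p3 triv_subgroup filt_carrier a in \<open>auto simp: normalizes_def\<close>)
  then show ?thesis by simp
qed

end

section \<open>Semidirect products from exterior pairings\<close>

definition semidirect ::
  "('b, 'n) monoid_scheme \<Rightarrow> ('a, 'm) monoid_scheme \<Rightarrow> ('a \<Rightarrow> 'b \<Rightarrow> 'b) \<Rightarrow> ('b \<times> 'a) monoid" where
  "semidirect T G \<alpha> = \<lparr>carrier = carrier T \<times> carrier G,
     monoid.mult = (\<lambda>(t, g) (u, h). (t \<otimes>\<^bsub>T\<^esub> \<alpha> g u, g \<otimes>\<^bsub>G\<^esub> h)), one = (\<one>\<^bsub>T\<^esub>, \<one>\<^bsub>G\<^esub>)\<rparr>"

section \<open>The lower central series\<close>

context group
begin

lemma lower_central_subgroup_conj: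
  "subgroup (lower_central G i) G \<and>
    (\<forall>g\<in>carrier G. \<forall>x\<in>lower_central G i. g \<otimes> x \<otimes> inv g \<in> lower_central G i)"
proof (induction i)
  case 0
  then show ?case using subgroup_self by simp
next
  case (Suc i)
  let ?A = "{commutator G x g | x g. x \<in> lower_central G i \<and> g \<in> carrier G}"
  have mem: "x \<in> carrier G" if "x \<in> lower_central G i" for x
    using subgroup.mem_carrier[OF conjunct1[OF Suc] that] .
  have A: "?A \<subseteq> carrier G" using mem by auto
  have "normalizes (carrier G) (generate G ?A)"
  proof (rule normalizes_generate[OF subgroup_self A])
    fix g a assume g: "g \<in> carrier G" and "a \<in> ?A"
    then obtain x h where a: "a = commutator G x h" "x \<in> lower_central G i" "h \<in> carrier G" by blast
    then have "g \<otimes> a \<otimes> inv g = commutator G (g \<otimes> x \<otimes> inv g) (g \<otimes> h \<otimes> inv g)"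
      using conj_commutator[OF g mem] by simp
    moreover have "g \<otimes> x \<otimes> inv g \<in> lower_central G i" "g \<otimes> h \<otimes> inv g \<in> carrier G"
      using Suc a g by auto
    ultimately have "g \<otimes> a \<otimes> inv g \<in> ?A" by blast
    then show "g \<otimes> a \<otimes> inv g \<in> generate G ?A" by (rule generate.incl)
  qed
  then show ?case using generate_is_subgroup[OF A] by (simp add: normalizes_def)
qed

lemma lower_central_subgroup: "subgroup (lower_central G i) G"
  using lower_central_subgroup_conj by blast

lemma lower_central_carrier: "x \<in> lower_central G i \<Longrightarrow> x \<in> carrier G"
  using subgroup.mem_carrier[OF lower_central_subgroup] .

lemma lower_central_mono: "lower_central G (Suc i) \<subseteq> lower_central G i"
  unfolding lower_central.simps
proof (rule generate_subset_subgroup[OF lower_central_subgroup], safe)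
  fix x g assume x: "x \<in> lower_central G i" and g: "g \<in> carrier G"
  have "g \<otimes> inv x \<otimes> inv g \<in> lower_central G i"
    using lower_central_subgroup_conj[of i] g subgroup.m_inv_closed[OF lower_central_subgroup x] by blast
  then have "x \<otimes> (g \<otimes> inv x \<otimes> inv g) \<in> lower_central G i"
    using subgroup.m_closed[OF lower_central_subgroup x] by blast
  then show "commutator G x g \<in> lower_central G i"
    using g lower_central_carrier[OF x] by (simp add: commutator_def m_assoc)
qed

lemma hom_eq_on_generate:
  assumes "group H" "f \<in> hom G H" "h \<in> hom G H" "A \<subseteq> carrier G"
    and "\<And>a. a \<in> A \<Longrightarrow> f a = h a" and x: "x \<in> generate G A"
  shows "f x = h x"
proof -
  interpret f: group_hom G H f using assms(1,2) by (simp add: group_hom_def group_hom_axioms_def)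
  interpret h: group_hom G H h using assms(1,3) by (simp add: group_hom_def group_hom_axioms_def)
  from x show ?thesis
  proof (induction x)
    case (inv a)
    then show ?case using f.hom_inv[of a] h.hom_inv[of a] assms(4,5) by auto
  next
    case (eng a b)
    then show ?case
      using f.hom_mult h.hom_mult generate_in_carrier[OF assms(4)] by metis
  qed (use assms(5) in auto)
qed

end

text \<open>An abstract exterior square: generation by wedges takes the place of the universal
  property. For the presented group the latter provides \<open>act\<close> and
  \<open>\<delta>\<close>.\<close>

locale exterior_pairing = G: group G + T: group T
  for G :: "('a, 'm) monoid_scheme" and T :: "('b, 'n) monoid_scheme" (structure) +
  fixes wedge :: "'a \<Rightarrow> 'a \<Rightarrow> 'b" and act :: "'a \<Rightarrow> 'b \<Rightarrow> 'b" and \<delta> :: "'b \<Rightarrow> 'a"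
  assumes wedge_closed [simp]: "x \<in> carrier G \<Longrightarrow> y \<in> carrier G \<Longrightarrow> wedge x y \<in> carrier T"
    and act_hom: "g \<in> carrier G \<Longrightarrow> act g \<in> hom T T"
    and act_one [simp]: "t \<in> carrier T \<Longrightarrow> act \<one>\<^bsub>G\<^esub> t = t"
    and act_act: "g \<in> carrier G \<Longrightarrow> h \<in> carrier G \<Longrightarrow> t \<in> carrier T \<Longrightarrow>
      act g (act h t) = act (g \<otimes>\<^bsub>G\<^esub> h) t"
    and act_wedge: "g \<in> carrier G \<Longrightarrow> x \<in> carrier G \<Longrightarrow> y \<in> carrier G \<Longrightarrow>
      act g (wedge x y) = wedge (conjugate G g x) (conjugate G g y)"
    and wedge_mult_left: "x \<in> carrier G \<Longrightarrow> x' \<in> carrier G \<Longrightarrow> y \<in> carrier G \<Longrightarrow>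
      wedge (x \<otimes>\<^bsub>G\<^esub> x') y = wedge (conjugate G x x') (conjugate G x y) \<otimes> wedge x y"
    and wedge_mult_right: "x \<in> carrier G \<Longrightarrow> y \<in> carrier G \<Longrightarrow> y' \<in> carrier G \<Longrightarrow>
      wedge x (y \<otimes>\<^bsub>G\<^esub> y') = wedge x y \<otimes> wedge (conjugate G y x) (conjugate G y y')"
    and wedge_self: "x \<in> carrier G \<Longrightarrow> wedge x x = \<one>"
    and carrier_generate: "carrier T = generate T {wedge x y | x y. x \<in> carrier G \<and> y \<in> carrier G}"
    and \<delta>_hom: "\<delta> \<in> hom T G"
    and \<delta>_wedge: "x \<in> carrier G \<Longrightarrow> y \<in> carrier G \<Longrightarrow> \<delta> (wedge x y) = commutator G x y"
begin

lemma conjugate_closed [simp]: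
  "g \<in> carrier G \<Longrightarrow> x \<in> carrier G \<Longrightarrow> conjugate G g x \<in> carrier G"
  by (simp add: conjugate_def)

lemma act_closed [simp]: "g \<in> carrier G \<Longrightarrow> t \<in> carrier T \<Longrightarrow> act g t \<in> carrier T"
  using hom_in_carrier[OF act_hom] .

lemma act_mult:
  "g \<in> carrier G \<Longrightarrow> t \<in> carrier T \<Longrightarrow> u \<in> carrier T \<Longrightarrow> act g (t \<otimes> u) = act g t \<otimes> act g u"
  using hom_mult[OF act_hom] .

lemma act_group_hom: "g \<in> carrier G \<Longrightarrow> group_hom T T (act g)"
  by (simp add: group_hom_def group_hom_axioms_def act_hom)

lemma act_unit [simp]: "g \<in> carrier G \<Longrightarrow> act g \<one> = \<one>"
  using group_hom.hom_one[OF act_group_hom] .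

lemma act_inv: "g \<in> carrier G \<Longrightarrow> t \<in> carrier T \<Longrightarrow> act g (inv t) = inv (act g t)"
  using group_hom.hom_inv[OF act_group_hom] .

lemma wedge_mult_left':
  "x \<in> carrier G \<Longrightarrow> x' \<in> carrier G \<Longrightarrow> y \<in> carrier G \<Longrightarrow>
    wedge (x \<otimes>\<^bsub>G\<^esub> x') y = act x (wedge x' y) \<otimes> wedge x y"
  by (simp add: wedge_mult_left act_wedge)

lemma wedge_mult_right':
  "x \<in> carrier G \<Longrightarrow> y \<in> carrier G \<Longrightarrow> y' \<in> carrier G \<Longrightarrow>
    wedge x (y \<otimes>\<^bsub>G\<^esub> y') = wedge x y \<otimes> act y (wedge x y')"
  by (simp add: wedge_mult_right act_wedge)

lemma wedge_one_left: "y \<in> carrier G \<Longrightarrow> wedge \<one>\<^bsub>G\<^esub> y = \<one>"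
  using wedge_mult_left'[of "\<one>\<^bsub>G\<^esub>" "\<one>\<^bsub>G\<^esub>" y] by simp

text \<open>Expand the trivial element x y \<and> x y in both entries; the result is the x-translate
  of (y \<and> x) (x \<and> y).\<close>

lemma wedge_swap:
  assumes x: "x \<in> carrier G" and y: "y \<in> carrier G"
  shows "wedge y x = inv (wedge x y)"
proof -
  let ?u = "wedge y x \<otimes> wedge x y"
  have "wedge (x \<otimes>\<^bsub>G\<^esub> y) (x \<otimes>\<^bsub>G\<^esub> y) = act x (wedge y (x \<otimes>\<^bsub>G\<^esub> y)) \<otimes> wedge x (x \<otimes>\<^bsub>G\<^esub> y)"
    using x y by (simp add: wedge_mult_left')
  also have "\<dots> = act x ?u" using x y by (simp add: wedge_mult_right' wedge_self act_mult)
  finally have 1: "act x ?u = \<one>" using x y by (simp add: wedge_self)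
  have "act (inv\<^bsub>G\<^esub> x) (act x ?u) = ?u" using x y by (simp add: act_act)
  then have "?u = \<one>" unfolding 1 using x by simp
  then show ?thesis using x y T.inv_equality[of "wedge y x" "wedge x y"] by simp
qed

lemma wedge_carrier: "{wedge x y | x y. x \<in> carrier G \<and> y \<in> carrier G} \<subseteq> carrier T"
  by auto

lemma hom_eqI:
  assumes "group H" "f \<in> hom T H" "h \<in> hom T H"
    and "\<And>x y. x \<in> carrier G \<Longrightarrow> y \<in> carrier G \<Longrightarrow> f (wedge x y) = h (wedge x y)"
    and "t \<in> carrier T"
  shows "f t = h t"
proof (rule T.hom_eq_on_generate[OF assms(1-3) wedge_carrier])
  show "t \<in> generate T {wedge x y | x y. x \<in> carrier G \<and> y \<in> carrier G}"
    using assms(5) carrier_generate by blast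
qed (use assms(4) in blast)

lemma subgroup_eq_carrier:
  assumes "subgroup H T" "\<And>x y. x \<in> carrier G \<Longrightarrow> y \<in> carrier G \<Longrightarrow> wedge x y \<in> H" "t \<in> carrier T"
  shows "t \<in> H"
proof -
  have "generate T {wedge x y | x y. x \<in> carrier G \<and> y \<in> carrier G} \<subseteq> H"
    by (rule T.generate_subset_subgroup[OF assms(1)]) (use assms(2) in blast)
  then show ?thesis using assms(3) carrier_generate by blast
qed

text \<open>Expand \<open>wedge (g x) (h y)\<close> in the two possible orders.\<close>

lemma conj_wedge:
  assumes g: "g \<in> carrier G" and h: "h \<in> carrier G" and v: "v \<in> carrier T"
  shows "wedge g h \<otimes> v \<otimes> inv (wedge g h) = act (commutator G g h) v"
proof -
  let ?t = "wedge g h"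
  note [simp] = g h
  have gen: "act (g \<otimes>\<^bsub>G\<^esub> h) (wedge x y) \<otimes> ?t = ?t \<otimes> act (h \<otimes>\<^bsub>G\<^esub> g) (wedge x y)"
    if [simp]: "x \<in> carrier G" "y \<in> carrier G" for x y
  proof -
    let ?A = "act g (wedge x h)" and ?B = "act h (wedge g y)"
    have "wedge (g \<otimes>\<^bsub>G\<^esub> x) (h \<otimes>\<^bsub>G\<^esub> y) = ?A \<otimes> (act (g \<otimes>\<^bsub>G\<^esub> h) (wedge x y) \<otimes> ?t) \<otimes> ?B"
      by (subst wedge_mult_left') (simp_all add: wedge_mult_right' act_mult act_act T.m_assoc)
    moreover have "wedge (g \<otimes>\<^bsub>G\<^esub> x) (h \<otimes>\<^bsub>G\<^esub> y) = ?A \<otimes> (?t \<otimes> act (h \<otimes>\<^bsub>G\<^esub> g) (wedge x y)) \<otimes> ?B"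
      by (subst wedge_mult_right') (simp_all add: wedge_mult_left' act_mult act_act T.m_assoc)
    moreover define X where "X = act (g \<otimes>\<^bsub>G\<^esub> h) (wedge x y) \<otimes> ?t"
    moreover define Y where "Y = ?t \<otimes> act (h \<otimes>\<^bsub>G\<^esub> g) (wedge x y)"
    moreover have "X \<in> carrier T" "Y \<in> carrier T" by (simp_all add: X_def Y_def)
    ultimately have "?A \<otimes> X \<otimes> ?B = ?A \<otimes> Y \<otimes> ?B" "X \<in> carrier T" "Y \<in> carrier T"
      by metis+
    then have "X = Y" by simp
    then show ?thesis by (simp add: X_def Y_def)
  qed
  have act_hom': "act (g \<otimes>\<^bsub>G\<^esub> h) \<in> hom T T" "(\<lambda>v. ?t \<otimes> act (h \<otimes>\<^bsub>G\<^esub> g) v \<otimes> inv ?t) \<in> hom T T"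
    using act_hom by (auto intro!: homI simp: act_mult T.word_simps)
  have eq: "act (g \<otimes>\<^bsub>G\<^esub> h) u = ?t \<otimes> act (h \<otimes>\<^bsub>G\<^esub> g) u \<otimes> inv ?t" if "u \<in> carrier T" for u
  proof (rule hom_eqI[OF T.group_axioms act_hom' _ that])
    fix x y assume xy: "x \<in> carrier G" "y \<in> carrier G"
    then have "act (g \<otimes>\<^bsub>G\<^esub> h) (wedge x y) = act (g \<otimes>\<^bsub>G\<^esub> h) (wedge x y) \<otimes> ?t \<otimes> inv ?t"
      by (simp add: T.m_assoc)
    then show "act (g \<otimes>\<^bsub>G\<^esub> h) (wedge x y) = ?t \<otimes> act (h \<otimes>\<^bsub>G\<^esub> g) (wedge x y) \<otimes> inv ?t"
      unfolding gen[OF xy] .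
  qed
  \<comment> \<open>Applying \<open>eq\<close> to the translate of v by (h g)^-1 turns the action of
    g h into that of [g, h].\<close>
  have "h \<otimes>\<^bsub>G\<^esub> g \<otimes>\<^bsub>G\<^esub> inv\<^bsub>G\<^esub> (h \<otimes>\<^bsub>G\<^esub> g) = \<one>\<^bsub>G\<^esub>" by simp
  moreover have "g \<otimes>\<^bsub>G\<^esub> h \<otimes>\<^bsub>G\<^esub> inv\<^bsub>G\<^esub> (h \<otimes>\<^bsub>G\<^esub> g) = commutator G g h"
    by (simp add: commutator_def G.word_simps)
  ultimately show ?thesis
    using eq[of "act (inv\<^bsub>G\<^esub> (h \<otimes>\<^bsub>G\<^esub> g)) v"] v by (simp add: act_act)
qed

lemma \<delta>_closed [simp]: "t \<in> carrier T \<Longrightarrow> \<delta> t \<in> carrier G"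
  using hom_in_carrier[OF \<delta>_hom] .

lemma \<delta>_mult: "t \<in> carrier T \<Longrightarrow> u \<in> carrier T \<Longrightarrow> \<delta> (t \<otimes> u) = \<delta> t \<otimes>\<^bsub>G\<^esub> \<delta> u"
  using hom_mult[OF \<delta>_hom] .

lemma \<delta>_group_hom: "group_hom T G \<delta>"
  by (simp add: group_hom_def group_hom_axioms_def \<delta>_hom)

lemma \<delta>_inv: "t \<in> carrier T \<Longrightarrow> \<delta> (inv t) = inv\<^bsub>G\<^esub> (\<delta> t)"
  using group_hom.hom_inv[OF \<delta>_group_hom] .

text \<open>The Peiffer identity of a crossed module: known for wedges by \<open>conj_wedge\<close>,
  and the elements satisfying it form a subgroup.\<close>

lemma conj_eq_act:
  assumes t: "t \<in> carrier T" and v: "v \<in> carrier T"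
  shows "t \<otimes> v \<otimes> inv t = act (\<delta> t) v"
proof -
  let ?H = "{t \<in> carrier T. \<forall>v\<in>carrier T. t \<otimes> v \<otimes> inv t = act (\<delta> t) v}"
  have "subgroup ?H T"
  proof (rule T.subgroupI)
    have "\<one> \<in> ?H" using group_hom.hom_one[OF \<delta>_group_hom] by simp
    then show "?H \<noteq> {}" by blast
    show "a \<otimes> b \<in> ?H" if a: "a \<in> ?H" and b: "b \<in> ?H" for a b
    proof -
      have "a \<otimes> b \<otimes> v \<otimes> inv (a \<otimes> b) = act (\<delta> (a \<otimes> b)) v" if v: "v \<in> carrier T" for v
      proof -
        have "act (\<delta> (a \<otimes> b)) v = act (\<delta> a) (act (\<delta> b) v)" using a b v by (simp add: \<delta>_mult act_act)
        also have "act (\<delta> b) v = b \<otimes> v \<otimes> inv b" using b v by simp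
        also have "act (\<delta> a) \<dots> = a \<otimes> (b \<otimes> v \<otimes> inv b) \<otimes> inv a" using a b v by simp
        finally show ?thesis using a b v by (simp add: T.word_simps)
      qed
      then show ?thesis using a b by simp
    qed
    show "inv a \<in> ?H" if a: "a \<in> ?H" for a
    proof -
      have "inv a \<otimes> v \<otimes> inv (inv a) = act (\<delta> (inv a)) v" if v: "v \<in> carrier T" for v
      proof -
        let ?u = "act (\<delta> (inv a)) v"
        have u: "?u \<in> carrier T" using a v by simp
        have "a \<otimes> ?u \<otimes> inv a = act (\<delta> a) ?u" using a u by blast
        also have "\<dots> = v" using a v by (simp add: act_act \<delta>_inv)
        finally have "inv a \<otimes> v \<otimes> inv (inv a) = inv a \<otimes> (a \<otimes> ?u \<otimes> inv a) \<otimes> inv (inv a)" by simp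
        then show ?thesis using a u by (simp add: T.word_simps)
      qed
      then show ?thesis using a by simp
    qed
  qed auto
  then have "t \<in> ?H" by (rule subgroup_eq_carrier[OF _ _ t]) (simp add: conj_wedge \<delta>_wedge)
  then show ?thesis using v by blast
qed

lemma wedge_inv_left:
  assumes x: "x \<in> carrier G" and y: "y \<in> carrier G"
  shows "wedge (inv\<^bsub>G\<^esub> x) y = inv (act (inv\<^bsub>G\<^esub> x) (wedge x y))"
proof -
  have "act (inv\<^bsub>G\<^esub> x) (wedge x y) \<otimes> wedge (inv\<^bsub>G\<^esub> x) y = \<one>"
    using wedge_mult_left'[of "inv\<^bsub>G\<^esub> x" x y] wedge_one_left x y by simp
  then show ?thesis using x y by (metis T.inv_equality T.inv_comm G.inv_closed act_closed wedge_closed)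
qed

lemma wedge_commutator_left:
  assumes g: "g \<in> carrier G" and h: "h \<in> carrier G" and b: "b \<in> carrier G"
  shows "wedge (commutator G g h) b = wedge g h \<otimes> inv (act b (wedge g h))"
proof -
  note [simp] = g h b
  let ?t = "wedge g h"
  \<comment> \<open>c is chosen with h c = b h, and y with [g, h] = g y. Expanding g \<and> h c = g
    \<and> b h gives the h-translate of g \<and> c; since y is the h-conjugate of g^-1 and b that of
    c, this also yields y \<and> b.\<close>
  define c where "c = inv\<^bsub>G\<^esub> h \<otimes>\<^bsub>G\<^esub> b \<otimes>\<^bsub>G\<^esub> h"
  define y where "y = h \<otimes>\<^bsub>G\<^esub> inv\<^bsub>G\<^esub> g \<otimes>\<^bsub>G\<^esub> inv\<^bsub>G\<^esub> h"
  have c: "c \<in> carrier G" and y: "y \<in> carrier G" by (simp_all add: c_def y_def)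
  note [simp] = c y
  have "wedge g (h \<otimes>\<^bsub>G\<^esub> c) = wedge g (b \<otimes>\<^bsub>G\<^esub> h)" by (simp add: c_def G.word_simps)
  then have e: "?t \<otimes> act h (wedge g c) = wedge g b \<otimes> act b ?t"
    by (simp add: wedge_mult_right')
  have "inv ?t \<otimes> (?t \<otimes> act h (wedge g c)) = act h (wedge g c)" by (simp add: T.word_simps)
  then have e': "act h (wedge g c) = inv ?t \<otimes> (wedge g b \<otimes> act b ?t)" unfolding e by simp
  have "wedge y b = act h (wedge (inv\<^bsub>G\<^esub> g) c)"
    by (simp add: act_wedge conjugate_def y_def c_def G.word_simps)
  then have "act g (wedge y b) = act (g \<otimes>\<^bsub>G\<^esub> h \<otimes>\<^bsub>G\<^esub> inv\<^bsub>G\<^esub> g) (inv (wedge g c))"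
    by (simp add: wedge_inv_left act_act act_inv G.m_assoc)
  also have "g \<otimes>\<^bsub>G\<^esub> h \<otimes>\<^bsub>G\<^esub> inv\<^bsub>G\<^esub> g = commutator G g h \<otimes>\<^bsub>G\<^esub> h" by (simp add: commutator_def G.word_simps)
  also have "act (commutator G g h \<otimes>\<^bsub>G\<^esub> h) (inv (wedge g c)) =
      ?t \<otimes> inv (act h (wedge g c)) \<otimes> inv ?t"
    by (simp add: act_act[symmetric] act_inv conj_wedge)
  finally have "act g (wedge y b) = ?t \<otimes> inv (act b ?t) \<otimes> inv (wedge g b)"
    unfolding e' by (simp add: T.word_simps)
  moreover have "commutator G g h = g \<otimes>\<^bsub>G\<^esub> y" by (simp add: commutator_def y_def G.m_assoc)
  ultimately show ?thesis by (simp add: wedge_mult_left' T.word_simps)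
qed

text \<open>Read in the semidirect product, this says that [b, t] is the inverse of \<delta> t
  \<and> b, the first half of \<open>w_boundary\<close>.\<close>

lemma wedge_boundary:
  assumes t: "t \<in> carrier T" and b: "b \<in> carrier G"
  shows "wedge (\<delta> t) b = t \<otimes> inv (act b t)"
proof -
  let ?H = "{t \<in> carrier T. wedge (\<delta> t) b = t \<otimes> inv (act b t)}"
  note [simp] = b
  have "subgroup ?H T"
  proof (rule T.subgroupI)
    have "\<one> \<in> ?H" using group_hom.hom_one[OF \<delta>_group_hom] by (simp add: wedge_one_left)
    then show "?H \<noteq> {}" by blast
    show "u \<otimes> v \<in> ?H" if "u \<in> ?H" "v \<in> ?H" for u v
      using that by (simp add: \<delta>_mult wedge_mult_left' conj_eq_act[symmetric] act_mult T.word_simps)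
    show "inv u \<in> ?H" if u: "u \<in> ?H" for u
    proof -
      have [simp]: "u \<in> carrier T" using u by simp
      have "wedge (\<delta> (inv u)) b = inv (act (\<delta> (inv u)) (wedge (\<delta> u) b))"
        by (simp add: \<delta>_inv wedge_inv_left)
      also have "\<dots> = inv (inv u \<otimes> wedge (\<delta> u) b \<otimes> u)"
        using conj_eq_act[of "inv u" "wedge (\<delta> u) b"] by simp
      also have "\<dots> = inv u \<otimes> inv (act b (inv u))" using u by (simp add: act_inv T.word_simps)
      finally show ?thesis by simp
    qed
  qed auto
  then have "t \<in> ?H" by (rule subgroup_eq_carrier[OF _ _ t]) (simp add: \<delta>_wedge wedge_commutator_left)
  then show ?thesis by blast
qed

section \<open>The semidirect product as a crossed pairing\<close>

definition S where "S = semidirect T G act"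

definition emb :: "'b \<Rightarrow> 'b \<times> 'a" where "emb t = (t, \<one>\<^bsub>G\<^esub>)"

definition sec :: "'a \<Rightarrow> 'b \<times> 'a" where "sec g = (\<one>, g)"

lemma S_simps:
  "carrier S = carrier T \<times> carrier G"
  "(t, g) \<otimes>\<^bsub>S\<^esub> (u, h) = (t \<otimes> act g u, g \<otimes>\<^bsub>G\<^esub> h)"
  "\<one>\<^bsub>S\<^esub> = (\<one>, \<one>\<^bsub>G\<^esub>)"
  by (simp_all add: S_def semidirect_def)

lemma group_S: "group S"
proof (rule groupI)
  fix x assume "x \<in> carrier S"
  then obtain t g where "x = (t, g)" "t \<in> carrier T" "g \<in> carrier G" by (auto simp: S_simps)
  then show "\<exists>y\<in>carrier S. y \<otimes>\<^bsub>S\<^esub> x = \<one>\<^bsub>S\<^esub>"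
    by (intro bexI[of _ "(act (inv\<^bsub>G\<^esub> g) (inv t), inv\<^bsub>G\<^esub> g)"]) (auto simp: S_simps act_mult[symmetric])
qed (auto simp: S_simps act_mult act_act T.m_assoc G.m_assoc)

sublocale S: group S by (rule group_S)

lemma emb_hom: "group_hom T S emb"
  by (auto simp: group_hom_def group_hom_axioms_def emb_def S_simps group_S T.group_axioms intro!: homI)

lemma sec_hom: "group_hom G S sec"
  by (auto simp: group_hom_def group_hom_axioms_def sec_def S_simps group_S G.group_axioms intro!: homI)

sublocale emb: group_hom T S emb by (rule emb_hom)
sublocale sec: group_hom G S sec by (rule sec_hom)

lemma sec_conj_emb:
  "g \<in> carrier G \<Longrightarrow> t \<in> carrier T \<Longrightarrow> sec g \<otimes>\<^bsub>S\<^esub> emb t \<otimes>\<^bsub>S\<^esub> inv\<^bsub>S\<^esub> (sec g) = emb (act g t)"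
  by (simp add: sec.hom_inv[symmetric] del: sec.hom_inv) (simp add: sec_def emb_def S_simps)

lemma commutator_sec_emb:
  "g \<in> carrier G \<Longrightarrow> t \<in> carrier T \<Longrightarrow> commutator S (sec g) (emb t) = emb (act g t \<otimes> inv t)"
  by (simp add: commutator_def sec_conj_emb)

lemma commutator_emb_emb:
  "t \<in> carrier T \<Longrightarrow> u \<in> carrier T \<Longrightarrow> commutator S (emb t) (emb u) = emb (act (\<delta> t) u \<otimes> inv u)"
  by (simp add: commutator_def conj_eq_act[symmetric])

text \<open>With truncated subtraction, \<open>lc i\<close> is the image of \<open>\<gamma>\<^sub>i(G)\<close> for \<open>i > 0\<close>, and \<open>lc 0 = lc 1\<close>.\<close>

definition lc :: "nat \<Rightarrow> ('b \<times> 'a) set" where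
  "lc i = sec ` lower_central G (i - 1)"

definition pairing :: "'b \<times> 'a \<Rightarrow> 'b \<times> 'a \<Rightarrow> 'b \<times> 'a" where
  "pairing a b = emb (wedge (snd a) (snd b))"

lemma pairing_sec [simp]: "pairing (sec x) (sec y) = emb (wedge x y)"
  by (simp add: pairing_def sec_def)

lemma generate_pairing:
  "generate S {pairing a b | a b. a \<in> lc i \<and> b \<in> lc 0} =
    emb ` generate T {wedge x y | x y. x \<in> lower_central G (i - 1) \<and> y \<in> carrier G}"
proof -
  have "{pairing a b | a b. a \<in> lc i \<and> b \<in> lc 0} =
      emb ` {wedge x y | x y. x \<in> lower_central G (i - 1) \<and> y \<in> carrier G}"
  proof (intro equalityI subsetI)
    fix z assume "z \<in> emb ` {wedge x y | x y. x \<in> lower_central G (i - 1) \<and> y \<in> carrier G}"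
    then obtain x y where "z = pairing (sec x) (sec y)" "sec x \<in> lc i" "sec y \<in> lc 0"
      by (auto simp: lc_def)
    then show "z \<in> {pairing a b | a b. a \<in> lc i \<and> b \<in> lc 0}" by blast
  next
    fix z assume "z \<in> {pairing a b | a b. a \<in> lc i \<and> b \<in> lc 0}"
    then obtain a b where z: "z = pairing a b" and a: "a \<in> lc i" and b: "b \<in> lc 0" by blast
    obtain x where "a = sec x" "x \<in> lower_central G (i - 1)" using a unfolding lc_def by blast
    moreover obtain y where "b = sec y" "y \<in> carrier G" using b unfolding lc_def by auto
    ultimately show "z \<in> emb ` {wedge x y | x y. x \<in> lower_central G (i - 1) \<and> y \<in> carrier G}"
      using z by auto
  qed
  then show ?thesis
    using emb.generate_img[of "{wedge x y | x y. x \<in> lower_central G (i - 1) \<and> y \<in> carrier G}"]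
      G.lower_central_carrier by fastforce
qed

lemma wedge_pow_self: "y \<in> carrier G \<Longrightarrow> wedge (y [^]\<^bsub>G\<^esub> (j::nat)) y = \<one>"
  by (induction j) (simp_all add: wedge_one_left wedge_mult_left' wedge_self)

lemma crossed_pairing: "crossed_pairing S lc pairing"
proof (rule crossed_pairing.intro[OF group_S], rule crossed_pairing_axioms.intro)
  show "subgroup (lc i) S" for i
    unfolding lc_def by (rule sec.subgroup_img_is_subgroup[OF G.lower_central_subgroup])
  show "lc (Suc i) \<subseteq> lc i" for i
    using G.lower_central_mono[of "i - 1"] by (cases i) (auto simp: lc_def)
  show "lc 1 = lc 0" by (simp add: lc_def)
  show "lc (Suc i) = generate S {commutator S x g | x g. x \<in> lc i \<and> g \<in> lc 0}" if i1: "1 \<le> i" for i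
  proof -
    obtain j where j: "i = Suc j" using i1 by (cases i) auto
    let ?A = "{commutator G x g | x g. x \<in> lower_central G j \<and> g \<in> carrier G}"
    have eq: "commutator S (sec x) (sec g) = sec (commutator G x g)"
      if "x \<in> lower_central G j" "g \<in> carrier G" for x g
      using that G.lower_central_carrier[OF that(1)] by (simp add: commutator_def)
    have "{commutator S x g | x g. x \<in> lc i \<and> g \<in> lc 0} = sec ` ?A"
    proof (intro equalityI subsetI)
      fix z assume "z \<in> {commutator S x g | x g. x \<in> lc i \<and> g \<in> lc 0}"
      then obtain a b where z: "z = commutator S a b" and a: "a \<in> lc i" and b: "b \<in> lc 0" by blast
      obtain x where "a = sec x" "x \<in> lower_central G j" using a unfolding lc_def j by auto
      moreover obtain g where "b = sec g" "g \<in> carrier G" using b unfolding lc_def by auto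
      ultimately have "z = sec (commutator G x g)" "commutator G x g \<in> ?A" using z eq by auto
      then show "z \<in> sec ` ?A" by simp
    next
      fix z assume "z \<in> sec ` ?A"
      then obtain x g where xg: "x \<in> lower_central G j" "g \<in> carrier G" "z = sec (commutator G x g)" by blast
      then have "z = commutator S (sec x) (sec g)" using eq by simp
      moreover have "sec x \<in> lc i" "sec g \<in> lc 0" using xg by (simp_all add: lc_def j)
      ultimately show "z \<in> {commutator S x g | x g. x \<in> lc i \<and> g \<in> lc 0}" by blast
    qed
    moreover have "?A \<subseteq> carrier G" using G.lower_central_carrier by auto
    ultimately show ?thesis using sec.generate_img[of ?A] by (simp add: lc_def j)
  qed
  show "pairing x y \<in> carrier S" if "x \<in> lc 0" "y \<in> lc 0" for x y
    using that by (auto simp: lc_def)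
  show "carrier S \<subseteq> generate S (lc 0 \<union> {pairing x y | x y. x \<in> lc 0 \<and> y \<in> lc 0})"
  proof
    let ?A = "lc 0 \<union> {pairing x y | x y. x \<in> lc 0 \<and> y \<in> lc 0}"
    fix a assume "a \<in> carrier S"
    then obtain t g where a: "a = (t, g)" "t \<in> carrier T" "g \<in> carrier G" by (auto simp: S_simps)
    have "emb t \<in> generate S {pairing x y | x y. x \<in> lc 0 \<and> y \<in> lc 0}"
      unfolding generate_pairing using a(2) carrier_generate by simp
    then have "emb t \<in> generate S ?A" by (rule subsetD[OF S.mono_generate, rotated]) simp
    moreover have "sec g \<in> generate S ?A" using a(3) by (intro generate.incl) (auto simp: lc_def)
    moreover have "a = emb t \<otimes>\<^bsub>S\<^esub> sec g" using a by (simp add: emb_def sec_def S_simps)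
    ultimately show "a \<in> generate S ?A" by (simp only: generate.eng)
  qed
  show "\<exists>h\<in>lc i. (\<forall>g\<in>lc 0. commutator S g t = inv\<^bsub>S\<^esub> pairing h g) \<and>
      (\<forall>u\<in>generate S {pairing x y | x y. x \<in> lc 0 \<and> y \<in> lc 0}. commutator S t u = commutator S h u)"
    if i: "2 \<le> i" and t: "t \<in> generate S {pairing x y | x y. x \<in> lc (i - 1) \<and> y \<in> lc 0}" for i t
  proof -
    obtain j where j: "i = Suc (Suc j)" using i by (metis Suc_le_D numeral_2_eq_2 Suc_le_mono)
    let ?W = "{wedge x y | x y. x \<in> lower_central G j \<and> y \<in> carrier G}"
    have W: "?W \<subseteq> carrier T" using G.lower_central_carrier by auto
    obtain s where s: "t = emb s" "s \<in> generate T ?W"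
      using t unfolding generate_pairing by (auto simp: j)
    have sc: "s \<in> carrier T" using T.generate_in_carrier[OF W s(2)] .
    let ?A = "{commutator G x g | x g. x \<in> lower_central G j \<and> g \<in> carrier G}"
    have "\<delta> ` ?W \<subseteq> ?A"
    proof
      fix z assume "z \<in> \<delta> ` ?W"
      then obtain x g where xg: "x \<in> lower_central G j" "g \<in> carrier G" "z = \<delta> (wedge x g)" by blast
      then have "z = commutator G x g" using \<delta>_wedge G.lower_central_carrier by simp
      then show "z \<in> ?A" using xg by blast
    qed
    then have "\<delta> ` generate T ?W \<subseteq> generate G ?A"
      unfolding group_hom.generate_img[OF \<delta>_group_hom W, symmetric] by (rule G.mono_generate)
    then have "\<delta> s \<in> lower_central G (Suc j)" using s(2) by auto
    then have h: "sec (\<delta> s) \<in> lc i" by (simp add: lc_def j)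
    moreover have "commutator S g t = inv\<^bsub>S\<^esub> pairing (sec (\<delta> s)) g" if g: "g \<in> lc 0" for g
    proof -
      obtain g0 where g0: "g = sec g0" "g0 \<in> carrier G" using g by (auto simp: lc_def)
      have "act g0 s \<otimes> inv s = inv (wedge (\<delta> s) g0)"
        using sc g0 by (simp add: wedge_boundary T.inv_mult_group)
      then have "commutator S g t = emb (inv (wedge (\<delta> s) g0))"
        using sc g0 by (simp only: s(1) commutator_sec_emb)
      then show ?thesis using sc g0 by simp
    qed
    moreover have "commutator S t u = commutator S (sec (\<delta> s)) u"
      if u: "u \<in> generate S {pairing x y | x y. x \<in> lc 0 \<and> y \<in> lc 0}" for u
    proof -
      obtain v where v: "u = emb v" "v \<in> carrier T"
        using u carrier_generate unfolding generate_pairing by auto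
      then show ?thesis using sc by (simp add: s(1) commutator_emb_emb commutator_sec_emb)
    qed
    ultimately show ?thesis by blast
  qed
  show "x [^]\<^bsub>S\<^esub> n \<otimes>\<^bsub>S\<^esub> (inv\<^bsub>S\<^esub> x \<otimes>\<^bsub>S\<^esub> pairing x y) [^]\<^bsub>S\<^esub> n = pairing (x [^]\<^bsub>S\<^esub> n) y"
    if xy0: "x \<in> lc 0" "y \<in> lc 0" for x y and n :: nat
  proof -
    obtain x0 y0 where xy: "x = sec x0" "y = sec y0" and [simp]: "x0 \<in> carrier G" "y0 \<in> carrier G"
      using xy0 by (auto simp: lc_def)
    let ?t = "emb (wedge x0 y0)"
    have t: "?t \<in> carrier S" by simp
    have "sec x0 [^]\<^bsub>S\<^esub> n \<otimes>\<^bsub>S\<^esub> (inv\<^bsub>S\<^esub> (sec x0) \<otimes>\<^bsub>S\<^esub> ?t) [^]\<^bsub>S\<^esub> n = emb (wedge (x0 [^]\<^bsub>G\<^esub> n) y0)"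
    proof (induction n)
      case 0
      show ?case using wedge_one_left by simp
    next
      case (Suc n)
      let ?x = "sec x0"
      define z where "z = inv\<^bsub>S\<^esub> ?x \<otimes>\<^bsub>S\<^esub> ?t"
      have z: "z \<in> carrier S" unfolding z_def by (intro S.m_closed S.inv_closed) (simp_all)
      have xz: "?x \<otimes>\<^bsub>S\<^esub> z = ?t" unfolding z_def by (simp add: S.mult_inv_cancel_left)
      \<comment> \<open>Peel off the inner product x z = t. Moved to the front it becomes the
        x^n-translate of t, as in the expansion of x^(n+1) \<and> y.\<close>
      have "?x [^]\<^bsub>S\<^esub> Suc n \<otimes>\<^bsub>S\<^esub> z [^]\<^bsub>S\<^esub> Suc n = ?x [^]\<^bsub>S\<^esub> n \<otimes>\<^bsub>S\<^esub> (?x \<otimes>\<^bsub>S\<^esub> z) \<otimes>\<^bsub>S\<^esub> z [^]\<^bsub>S\<^esub> n"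
        unfolding S.nat_pow_Suc2[OF z] using z by (simp add: S.m_assoc)
      also have "\<dots> = (?x [^]\<^bsub>S\<^esub> n \<otimes>\<^bsub>S\<^esub> ?t \<otimes>\<^bsub>S\<^esub> inv\<^bsub>S\<^esub> (?x [^]\<^bsub>S\<^esub> n)) \<otimes>\<^bsub>S\<^esub> (?x [^]\<^bsub>S\<^esub> n \<otimes>\<^bsub>S\<^esub> z [^]\<^bsub>S\<^esub> n)"
        unfolding xz using z by (simp add: S.word_simps)
      also have "\<dots> = emb (act (x0 [^]\<^bsub>G\<^esub> n) (wedge x0 y0)) \<otimes>\<^bsub>S\<^esub> emb (wedge (x0 [^]\<^bsub>G\<^esub> n) y0)"
        using Suc sec_conj_emb[of "x0 [^]\<^bsub>G\<^esub> n" "wedge x0 y0"] by (simp add: z_def sec.hom_nat_pow)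
      also have "\<dots> = emb (wedge (x0 [^]\<^bsub>G\<^esub> Suc n) y0)"
        by (simp add: wedge_mult_left')
      finally show ?case unfolding z_def .
    qed
    then show ?thesis by (simp add: xy sec.hom_nat_pow[symmetric])
  qed
  show "pairing \<one>\<^bsub>S\<^esub> y = \<one>\<^bsub>S\<^esub>" if "y \<in> lc 0" for y
    using that wedge_one_left by (auto simp: lc_def pairing_def emb_def sec_def S_simps)
  show "pairing (x \<otimes>\<^bsub>S\<^esub> y [^]\<^bsub>S\<^esub> j) y = pairing x y" if xy0: "x \<in> lc 0" "y \<in> lc 0" for x y and j :: nat
  proof -
    obtain x0 y0 where xy: "x = sec x0" "y = sec y0" "x0 \<in> carrier G" "y0 \<in> carrier G"
      using xy0 by (auto simp: lc_def)
    have eq: "x \<otimes>\<^bsub>S\<^esub> y [^]\<^bsub>S\<^esub> j = sec (x0 \<otimes>\<^bsub>G\<^esub> y0 [^]\<^bsub>G\<^esub> j)"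
      using xy by (simp add: sec.hom_nat_pow)
    have "wedge (x0 \<otimes>\<^bsub>G\<^esub> y0 [^]\<^bsub>G\<^esub> j) y0 = wedge x0 y0"
      using xy(3,4) by (simp add: wedge_mult_left' wedge_pow_self)
    then show ?thesis unfolding eq unfolding xy(1,2) pairing_sec by simp
  qed
  show "pairing y x = inv\<^bsub>S\<^esub> pairing x y" if xy0: "x \<in> lc 0" "y \<in> lc 0" for x y
  proof -
    obtain x0 y0 where "x = sec x0" "y = sec y0" "x0 \<in> carrier G" "y0 \<in> carrier G"
      using xy0 by (auto simp: lc_def)
    then show ?thesis using wedge_swap[of x0 y0] by simp
  qed
qed

theorem pow_eq_one:
  assumes p: "prime p" "odd p" and tors: "\<And>x. x \<in> carrier G \<Longrightarrow> x [^]\<^bsub>G\<^esub> (p ^ k) = \<one>\<^bsub>G\<^esub>"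
    and c: "lower_central G c = {\<one>\<^bsub>G\<^esub>}" and n: "c + 1 \<le> p ^ n \<or> c \<le> p \<and> n = 1"
    and t: "t \<in> carrier T"
  shows "t [^] ((p ^ k) ^ n) = \<one>"
proof -
  interpret C: crossed_pairing S lc pairing by (rule crossed_pairing)
  \<comment> \<open>\<open>lower_central\<close> counts from 0 and \<open>lc\<close> from 1, hence
    the successor. Wedges gain one more weight, so \<open>filt\<close> is trivial only from c + 2
    on.\<close>
  have lc1: "lc (Suc c) = {\<one>\<^bsub>S\<^esub>}" using c by (simp add: lc_def)
  have lc_tors: "x [^]\<^bsub>S\<^esub> (p ^ k) = \<one>\<^bsub>S\<^esub>" if x: "x \<in> lc 0" for x
  proof -
    obtain x0 where x0: "x = sec x0" "x0 \<in> carrier G" using x by (auto simp: lc_def)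
    then have "x [^]\<^bsub>S\<^esub> (p ^ k) = sec (x0 [^]\<^bsub>G\<^esub> (p ^ k))" by (simp add: sec.hom_nat_pow)
    then show ?thesis using tors[OF x0(2)] by simp
  qed
  have "C.pairs (c + 2) \<union> lc (c + 2) \<subseteq> {\<one>\<^bsub>S\<^esub>}"
    using lc1 C.w_one C.\<Gamma>_le[of "Suc c" "c + 2"] by (auto simp: C.pairs_def)
  then have "C.filt (c + 2) \<subseteq> {\<one>\<^bsub>S\<^esub>}"
    unfolding C.filt_def by (rule S.generate_subset_subgroup[OF S.triv_subgroup])
  then have triv: "C.filt m = {\<one>\<^bsub>S\<^esub>}" if "c + 2 \<le> m" for m
    using C.filt_le[OF that] subgroup.one_closed[OF C.filt_subgroup[of m]] by blast
  have g: "emb t \<in> generate S (C.pairs 2)"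
    unfolding C.pairs_two generate_pairing using t carrier_generate by simp
  have "emb t [^]\<^bsub>S\<^esub> ((p ^ k) ^ n) = \<one>\<^bsub>S\<^esub>"
    using n
  proof
    assume "c + 1 \<le> p ^ n"
    then show ?thesis
      using C.torsion_large_class[OF p(1) lc_tors triv C.generate_pairs_filt[OF g]] by simp
  next
    assume *: "c \<le> p \<and> n = 1"
    moreover have "3 \<le> p" using p prime_ge_2_nat[OF p(1)] by (cases "p = 2") auto
    ultimately show ?thesis
      using C.torsion_class_prime[OF p(1) _ lc_tors triv g] by simp
  qed
  then show ?thesis using t by (simp add: emb.hom_nat_pow[symmetric]) (simp add: emb_def S_simps)
qed

end

section \<open>The exterior square as a presented group\<close>

lemma (in group) group_exponent_dvd:
  assumes "N > 0" "\<And>x. x \<in> carrier G \<Longrightarrow> x [^] (N::nat) = \<one>"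
  shows "group_exponent G dvd N"
proof -
  let ?P = "\<lambda>n. n > 0 \<and> (\<forall>x\<in>carrier G. x [^] (n::nat) = \<one>)"
  have ex: "?P N" using assms by blast
  define e where "e = (LEAST n. ?P n)"
  have e: "?P e" unfolding e_def using ex by (rule LeastI)
  have "group_exponent G = e"
    unfolding group_exponent_def e_def by (rule if_P) (use ex in blast)
  moreover have "\<not> 0 < N mod e"
  proof
    assume "0 < N mod e"
    moreover have "x [^] (N mod e) = \<one>" if x: "x \<in> carrier G" for x
    proof -
      have "x [^] N = x [^] (e * (N div e)) \<otimes> x [^] (N mod e)" using x by (simp add: nat_pow_mult)
      also have "x [^] (e * (N div e)) = \<one>" using e x by (simp add: nat_pow_pow[symmetric])
      finally show ?thesis using assms(2)[OF x] x by simp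
    qed
    ultimately have "e \<le> N mod e" unfolding e_def by (intro Least_le) blast
    then show False using e by (meson mod_less_divisor not_le)
  qed
  ultimately show ?thesis by (simp add: dvd_eq_mod_eq_0)
qed

lemma (in group) group_exponent_finite:
  assumes "finite (carrier G)"
  shows "group_exponent G dvd order G" "x \<in> carrier G \<Longrightarrow> x [^] group_exponent G = \<one>"
proof -
  have o: "order G > 0" "\<And>x. x \<in> carrier G \<Longrightarrow> x [^] order G = \<one>"
    using assms order_gt_0_iff_finite pow_order_eq_1 by auto
  show "group_exponent G dvd order G" by (rule group_exponent_dvd[OF o])
  have ex: "\<exists>n>0. \<forall>x\<in>carrier G. x [^] (n::nat) = \<one>" using o by blast
  show "x [^] group_exponent G = \<one>" if "x \<in> carrier G" for x
    unfolding group_exponent_def using LeastI_ex[OF ex] ex that by auto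
qed

section \<open>Homomorphisms out of a presented group\<close>

definition word_eval :: "('b, 'n) monoid_scheme \<Rightarrow> ('x \<Rightarrow> 'b) \<Rightarrow> 'x word \<Rightarrow> 'b" where
  "word_eval H f w = foldr (\<lambda>(b, x) r. (if b then f x else inv\<^bsub>H\<^esub> (f x)) \<otimes>\<^bsub>H\<^esub> r) w \<one>\<^bsub>H\<^esub>"

lemma (in group) word_eval_closed:
  "f \<in> X \<rightarrow> carrier G \<Longrightarrow> w \<in> words X \<Longrightarrow> word_eval G f w \<in> carrier G"
  by (induction w) (auto simp: word_eval_def Pi_iff)

lemma (in group) word_eval_append:
  assumes "f \<in> X \<rightarrow> carrier G" "u \<in> words X" "v \<in> words X"
  shows "word_eval G f (u @ v) = word_eval G f u \<otimes> word_eval G f v"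
  using assms(2)
proof (induction u)
  case Nil
  then show ?case using word_eval_closed[OF assms(1,3)] by (simp add: word_eval_def)
next
  case (Cons a u)
  obtain b x where a: "a = (b, x)" "x \<in> X" using Cons.hyps by (cases a) auto
  have "word_eval G f (a # w) = (if b then f x else inv (f x)) \<otimes> word_eval G f w" for w
    by (simp add: a word_eval_def)
  moreover have "f x \<in> carrier G" using assms(1) a by auto
  ultimately show ?case
    using Cons.IH word_eval_closed[OF assms(1)] Cons.hyps assms(3) by (simp add: m_assoc)
qed

lemma (in group) word_eval_word_rel:
  assumes f: "f \<in> X \<rightarrow> carrier G"
    and R: "\<And>u v. (u, v) \<in> R \<Longrightarrow> u \<in> words X \<Longrightarrow> v \<in> words X \<Longrightarrow> word_eval G f u = word_eval G f v"
    and uv: "(u, v) \<in> word_rel X R"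
  shows "word_eval G f u = word_eval G f v"
  using uv
proof (induction rule: word_rel.induct)
  case (cong u v a b)
  then show ?case
    using word_rel_words[OF cong.hyps(1)] word_eval_append[OF f] by simp
next
  case (cancel x b)
  then have "f x \<in> carrier G" using f by auto
  then show ?case by (simp add: word_eval_def)
qed (use R in auto)

lemma (in group) presented_group_universal:
  assumes f: "f \<in> X \<rightarrow> carrier G"
    and R: "\<And>u v. (u, v) \<in> R \<Longrightarrow> u \<in> words X \<Longrightarrow> v \<in> words X \<Longrightarrow> word_eval G f u = word_eval G f v"
  obtains \<phi> where "\<phi> \<in> hom (presented_group X R) G"
    "\<And>x. x \<in> X \<Longrightarrow> \<phi> (presented_gen X R x) = f x"
proof -
  let ?c = "\<lambda>w. word_rel X R `` {w}"
  define \<phi> where "\<phi> A = word_eval G f (SOME w. w \<in> A)" for A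
  have \<phi>: "\<phi> (?c w) = word_eval G f w" if w: "w \<in> words X" for w
  proof -
    have "w \<in> ?c w" using w by (simp add: word_rel.refl)
    then have "(SOME w'. w' \<in> ?c w) \<in> ?c w" by (rule someI)
    then show ?thesis using word_eval_word_rel[OF f R] unfolding \<phi>_def by simp
  qed
  have car: "carrier (presented_group X R) = ?c ` words X"
    by (auto simp: presented_group_def quotient_def)
  have "\<phi> \<in> hom (presented_group X R) G"
  proof (rule homI)
    show "\<phi> A \<in> carrier G" if A: "A \<in> carrier (presented_group X R)" for A
    proof -
      obtain w where "A = ?c w" "w \<in> words X" using A unfolding car by blast
      then show ?thesis using word_eval_closed[OF f] by (simp only: \<phi>)
    qed
    fix A B assume "A \<in> carrier (presented_group X R)" "B \<in> carrier (presented_group X R)"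
    then obtain u v where "A = ?c u" "B = ?c v" "u \<in> words X" "v \<in> words X" unfolding car by blast
    moreover from this have "u @ v \<in> words X" by simp
    ultimately show "\<phi> (A \<otimes>\<^bsub>presented_group X R\<^esub> B) = \<phi> A \<otimes> \<phi> B"
      by (simp only: presented_group_mult_class \<phi> word_eval_append[OF f])
  qed
  moreover have "\<phi> (presented_gen X R x) = f x" if x: "x \<in> X" for x
  proof -
    have "f x \<in> carrier G" using f x by auto
    then show ?thesis using \<phi>[of "[(True, x)]"] x by (simp add: presented_gen_def word_eval_def)
  qed
  ultimately show ?thesis using that by blast
qed

lemma presented_gen_closed:
  "x \<in> X \<Longrightarrow> presented_gen X R x \<in> carrier (presented_group X R)"
  by (auto simp: presented_gen_def presented_group_def intro!: quotientI)

lemma carrier_presented_group: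
  "carrier (presented_group X R) = generate (presented_group X R) (presented_gen X R ` X)"
proof
  interpret P: group "presented_group X R" by (rule group_presented_group)
  let ?P = "presented_group X R" and ?c = "\<lambda>w. word_rel X R `` {w}"
  have gen: "presented_gen X R ` X \<subseteq> carrier ?P" by (rule image_subsetI) (rule presented_gen_closed)
  show "generate ?P (presented_gen X R ` X) \<subseteq> carrier ?P"
    using P.generate_in_carrier[OF gen] by blast
  have one: "\<one>\<^bsub>?P\<^esub> = ?c []" by (simp add: presented_group_def)
  have "?c w \<in> generate ?P (presented_gen X R ` X)" if "w \<in> words X" for w
    using that
  proof (induction w)
    case Nil
    then show ?case using generate.one[of ?P] one by metis
  next
    case (Cons a w)
    obtain b x where a: "a = (b, x)" "x \<in> X" using Cons.hyps by (cases a) auto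
    have "?c [(False, x)] \<otimes>\<^bsub>?P\<^esub> presented_gen X R x = ?c ([(False, x)] @ [(True, x)])"
      unfolding presented_gen_def using a by (intro presented_group_mult_class) auto
    also have "\<dots> = ?c []"
      using equiv_class_eq[OF equiv_word_rel word_rel.cancel[OF a(2), of False R]] by simp
    finally have "inv\<^bsub>?P\<^esub> (presented_gen X R x) = ?c [(False, x)]"
      using presented_gen_closed[OF a(2)] a(2)
      by (intro P.inv_equality) (auto simp: one presented_group_def intro!: quotientI)
    then have "?c [(b, x)] \<in> generate ?P (presented_gen X R ` X)"
      using generate.incl[of "presented_gen X R x" "presented_gen X R ` X" ?P]
        generate.inv[of "presented_gen X R x" "presented_gen X R ` X" ?P] a(2)
      by (cases b) (auto simp: presented_gen_def)
    moreover have "?c (a # w) = ?c [(b, x)] \<otimes>\<^bsub>?P\<^esub> ?c w"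
      using presented_group_mult_class[of "[(b, x)]" X w R] a Cons.hyps by simp
    ultimately show ?case using generate.eng[OF _ Cons.IH] by simp
  qed
  then show "carrier ?P \<subseteq> generate ?P (presented_gen X R ` X)"
    by (auto simp: presented_group_def quotient_def)
qed

section \<open>Relations between tensors\<close>

locale group_tensor = group
begin

abbreviation "TS \<equiv> tensor_square G"
abbreviation "ES \<equiv> exterior_square G"
abbreviation "cj \<equiv> conjugate G"

definition wedge :: "'a \<Rightarrow> 'a \<Rightarrow> ('a \<times> 'a) word set set" where
  "wedge g h = nabla G #>\<^bsub>TS\<^esub> tensor G g h"

lemma cj_closed [simp]: "g \<in> carrier G \<Longrightarrow> x \<in> carrier G \<Longrightarrow> cj g x \<in> carrier G"
  by (simp add: conjugate_def)

lemma cj_mult: "g \<in> carrier G \<Longrightarrow> x \<in> carrier G \<Longrightarrow> y \<in> carrier G \<Longrightarrow> cj g (x \<otimes> y) = cj g x \<otimes> cj g y"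
  by (simp add: conjugate_def word_simps)

lemma cj_cj: "g \<in> carrier G \<Longrightarrow> h \<in> carrier G \<Longrightarrow> x \<in> carrier G \<Longrightarrow> cj g (cj h x) = cj (g \<otimes> h) x"
  by (simp add: conjugate_def word_simps)

lemma cj_one [simp]: "x \<in> carrier G \<Longrightarrow> cj \<one> x = x"
  by (simp add: conjugate_def)

sublocale TS: group TS
  unfolding tensor_square_def by (rule group_presented_group)

lemma tensor_closed [simp]: "g \<in> carrier G \<Longrightarrow> h \<in> carrier G \<Longrightarrow> tensor G g h \<in> carrier TS"
  unfolding tensor_def tensor_square_def by (rule presented_gen_closed) simp

lemma tensor_relation:
  assumes "([(True, a)], [(True, b), (True, c)]) \<in> tensor_relations G"
    and a: "a \<in> carrier G \<times> carrier G" and b: "b \<in> carrier G \<times> carrier G" and c: "c \<in> carrier G \<times> carrier G"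
  shows "case_prod (tensor G) a = case_prod (tensor G) b \<otimes>\<^bsub>TS\<^esub> case_prod (tensor G) c"
proof -
  let ?X = "carrier G \<times> carrier G" and ?R = "tensor_relations G"
  have "([(True, a)], [(True, b), (True, c)]) \<in> word_rel ?X ?R"
    using assms by (intro word_rel.relation) auto
  then have "word_rel ?X ?R `` {[(True, a)]} = word_rel ?X ?R `` {[(True, b)] @ [(True, c)]}"
    using equiv_class_eq[OF equiv_word_rel] by fastforce
  also have "\<dots> = word_rel ?X ?R `` {[(True, b)]} \<otimes>\<^bsub>TS\<^esub> word_rel ?X ?R `` {[(True, c)]}"
    unfolding tensor_square_def using b c by (intro presented_group_mult_class[symmetric]) auto
  finally show ?thesis by (cases a; cases b; cases c) (simp add: tensor_def presented_gen_def)
qed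

lemma tensor_mult_left:
  assumes "g \<in> carrier G" "g' \<in> carrier G" "h \<in> carrier G"
  shows "tensor G (g \<otimes> g') h = tensor G (cj g g') (cj g h) \<otimes>\<^bsub>TS\<^esub> tensor G g h"
proof -
  have "([(True, (g \<otimes> g', h))], [(True, (cj g g', cj g h)), (True, (g, h))]) \<in> tensor_relations G"
    using assms unfolding tensor_relations_def by blast
  from tensor_relation[OF this] show ?thesis using assms by simp
qed

lemma tensor_mult_right:
  assumes "g \<in> carrier G" "h \<in> carrier G" "h' \<in> carrier G"
  shows "tensor G g (h \<otimes> h') = tensor G g h \<otimes>\<^bsub>TS\<^esub> tensor G (cj h g) (cj h h')"
proof -
  have "([(True, (g, h \<otimes> h'))], [(True, (g, h)), (True, (cj h g, cj h h'))]) \<in> tensor_relations G"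
    using assms unfolding tensor_relations_def by blast
  from tensor_relation[OF this] show ?thesis using assms by simp
qed

lemma carrier_TS: "carrier TS = generate TS {tensor G g h | g h. g \<in> carrier G \<and> h \<in> carrier G}"
proof -
  have "presented_gen (carrier G \<times> carrier G) (tensor_relations G) ` (carrier G \<times> carrier G) =
      {tensor G g h | g h. g \<in> carrier G \<and> h \<in> carrier G}"
    by (auto simp: tensor_def image_iff)
  then show ?thesis unfolding tensor_square_def carrier_presented_group[of "carrier G \<times> carrier G"] by simp
qed

text \<open>Expand z x \<otimes> z y in both orders, as for \<open>conj_wedge\<close>. The inner
  tensor arrives with its entries conjugated by z twice, so x and y are the conjugates of a and b by
  (z z)^-1; as z commutes with itself, the two results differ only in the order of z \<otimes> z and
  a \<otimes> b.\<close>

lemma tensor_self_commute: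
  assumes z: "z \<in> carrier G" and a: "a \<in> carrier G" and b: "b \<in> carrier G"
  shows "tensor G a b \<otimes>\<^bsub>TS\<^esub> tensor G z z = tensor G z z \<otimes>\<^bsub>TS\<^esub> tensor G a b"
proof -
  note [simp] = z a b
  define x where "x = cj (inv (z \<otimes> z)) a"
  define y where "y = cj (inv (z \<otimes> z)) b"
  have [simp]: "x \<in> carrier G" "y \<in> carrier G" by (simp_all add: x_def y_def)
  have ab: "cj (z \<otimes> z) x = a" "cj (z \<otimes> z) y = b"
    by (simp_all add: x_def y_def cj_cj)
  let ?A = "tensor G (cj z x) (cj z z)" and ?B = "tensor G (cj z z) (cj z y)"
  have "tensor G (z \<otimes> x) (z \<otimes> y) = ?A \<otimes>\<^bsub>TS\<^esub> tensor G (cj (cj z z) (cj z x)) (cj (cj z z) (cj z y)) \<otimes>\<^bsub>TS\<^esub>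
      (tensor G z z \<otimes>\<^bsub>TS\<^esub> ?B)"
    by (subst tensor_mult_left) (simp_all add: tensor_mult_right cj_mult)
  moreover have "tensor G (z \<otimes> x) (z \<otimes> y) = ?A \<otimes>\<^bsub>TS\<^esub> tensor G z z \<otimes>\<^bsub>TS\<^esub>
      (tensor G (cj (cj z z) (cj z x)) (cj (cj z z) (cj z y)) \<otimes>\<^bsub>TS\<^esub> ?B)"
    by (subst tensor_mult_right) (simp_all add: tensor_mult_left cj_mult)
  moreover have "cj z z = z" by (simp add: conjugate_def word_simps)
  ultimately have "?A \<otimes>\<^bsub>TS\<^esub> tensor G a b \<otimes>\<^bsub>TS\<^esub> (tensor G z z \<otimes>\<^bsub>TS\<^esub> ?B) =
      ?A \<otimes>\<^bsub>TS\<^esub> tensor G z z \<otimes>\<^bsub>TS\<^esub> (tensor G a b \<otimes>\<^bsub>TS\<^esub> ?B)"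
    by (simp add: cj_cj ab)
  moreover define X where "X = tensor G a b \<otimes>\<^bsub>TS\<^esub> tensor G z z"
  moreover define Y where "Y = tensor G z z \<otimes>\<^bsub>TS\<^esub> tensor G a b"
  moreover have "X \<in> carrier TS" "Y \<in> carrier TS" by (simp_all add: X_def Y_def)
  ultimately have "?A \<otimes>\<^bsub>TS\<^esub> X \<otimes>\<^bsub>TS\<^esub> ?B = ?A \<otimes>\<^bsub>TS\<^esub> Y \<otimes>\<^bsub>TS\<^esub> ?B" "X \<in> carrier TS" "Y \<in> carrier TS"
    by (simp_all add: TS.m_assoc)
  then have "X = Y" by simp
  then show ?thesis by (simp add: X_def Y_def)
qed

lemma nabla_normal: "nabla G \<lhd> TS"
proof -
  let ?N = "{tensor G x x | x. x \<in> carrier G}"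
  have N: "?N \<subseteq> carrier TS" by auto
  have "TS.normalizes (carrier TS) (generate TS ?N)"
  proof (rule TS.normalizes_generate[OF TS.subgroup_self N])
    fix t n assume t: "t \<in> carrier TS" and "n \<in> ?N"
    then obtain z where z: "n = tensor G z z" "z \<in> carrier G" by blast
    have nc: "n \<in> carrier TS" using z by simp
    let ?gens = "{tensor G g h | g h. g \<in> carrier G \<and> h \<in> carrier G}"
    have "commutator TS t n \<in> {\<one>\<^bsub>TS\<^esub>}"
    proof (rule TS.commutator_generate_left[OF TS.subgroup_self TS.triv_subgroup])
      show "t \<in> generate TS ?gens" using t carrier_TS by blast
      show "commutator TS a n \<in> {\<one>\<^bsub>TS\<^esub>}" if "a \<in> ?gens" for a
        using that tensor_self_commute[OF z(2)] z by (auto simp: commutator_def TS.word_simps)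
    qed (use nc in \<open>auto simp: TS.normalizes_def\<close>)
    then have "t \<otimes>\<^bsub>TS\<^esub> n \<otimes>\<^bsub>TS\<^esub> inv\<^bsub>TS\<^esub> t = n"
      using TS.conj_eq_commutator_mult[OF t nc] nc by simp
    then show "t \<otimes>\<^bsub>TS\<^esub> n \<otimes>\<^bsub>TS\<^esub> inv\<^bsub>TS\<^esub> t \<in> generate TS ?N"
      using \<open>n \<in> ?N\<close> by (simp add: generate.incl)
  qed
  then show ?thesis
    unfolding TS.normal_inv_iff nabla_def using TS.generate_is_subgroup[OF N]
    by (simp add: TS.normalizes_def)
qed

sublocale ES: group ES
  unfolding exterior_square_def using normal.factorgroup_is_group[OF nabla_normal] .

lemma coset_hom: "group_hom TS ES (\<lambda>t. nabla G #>\<^bsub>TS\<^esub> t)"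
  using normal.r_coset_hom_Mod[OF nabla_normal]
  by (simp add: group_hom_def group_hom_axioms_def exterior_square_def[symmetric])

lemma wedge_closed [simp]: "g \<in> carrier G \<Longrightarrow> h \<in> carrier G \<Longrightarrow> wedge g h \<in> carrier ES"
  unfolding wedge_def using group_hom.hom_closed[OF coset_hom tensor_closed] .

lemma wedge_mult_left:
  "g \<in> carrier G \<Longrightarrow> g' \<in> carrier G \<Longrightarrow> h \<in> carrier G \<Longrightarrow>
    wedge (g \<otimes> g') h = wedge (cj g g') (cj g h) \<otimes>\<^bsub>ES\<^esub> wedge g h"
  unfolding wedge_def using group_hom.hom_mult[OF coset_hom] by (simp add: tensor_mult_left)

lemma wedge_mult_right:
  "g \<in> carrier G \<Longrightarrow> h \<in> carrier G \<Longrightarrow> h' \<in> carrier G \<Longrightarrow>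
    wedge g (h \<otimes> h') = wedge g h \<otimes>\<^bsub>ES\<^esub> wedge (cj h g) (cj h h')"
  unfolding wedge_def using group_hom.hom_mult[OF coset_hom] by (simp add: tensor_mult_right)

lemma wedge_self:
  assumes "x \<in> carrier G"
  shows "wedge x x = \<one>\<^bsub>ES\<^esub>"
proof -
  have "tensor G x x \<in> nabla G" unfolding nabla_def using assms by (auto intro: generate.incl)
  then have "wedge x x = nabla G"
    unfolding wedge_def using TS.coset_join2 assms normal_imp_subgroup[OF nabla_normal] by simp
  then show ?thesis by (simp add: exterior_square_def)
qed

lemma carrier_ES: "carrier ES = generate ES {wedge g h | g h. g \<in> carrier G \<and> h \<in> carrier G}"
proof -
  let ?q = "\<lambda>t. nabla G #>\<^bsub>TS\<^esub> t" and ?A = "{tensor G g h | g h. g \<in> carrier G \<and> h \<in> carrier G}"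
  have "carrier ES = ?q ` carrier TS" by (simp add: exterior_square_def carrier_FactGroup)
  also have "\<dots> = generate ES (?q ` ?A)"
    unfolding carrier_TS by (rule group_hom.generate_img[OF coset_hom, symmetric]) auto
  also have "?q ` ?A = {wedge g h | g h. g \<in> carrier G \<and> h \<in> carrier G}"
    by (auto simp: wedge_def)
  finally show ?thesis .
qed

section \<open>The universal property, the action and the boundary map\<close>

definition lift :: "('c, 'n) monoid_scheme \<Rightarrow> ('a \<Rightarrow> 'a \<Rightarrow> 'c) \<Rightarrow> ('a \<times> 'a) word set set \<Rightarrow> 'c" where
  "lift H f = (SOME \<phi>. \<phi> \<in> hom ES H \<and> (\<forall>g\<in>carrier G. \<forall>h\<in>carrier G. \<phi> (wedge g h) = f g h))"

lemma lift:
  assumes H: "group H"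
    and f: "\<And>g h. g \<in> carrier G \<Longrightarrow> h \<in> carrier G \<Longrightarrow> f g h \<in> carrier H"
    and left: "\<And>g g' h. g \<in> carrier G \<Longrightarrow> g' \<in> carrier G \<Longrightarrow> h \<in> carrier G \<Longrightarrow>
      f (g \<otimes> g') h = f (cj g g') (cj g h) \<otimes>\<^bsub>H\<^esub> f g h"
    and right: "\<And>g h h'. g \<in> carrier G \<Longrightarrow> h \<in> carrier G \<Longrightarrow> h' \<in> carrier G \<Longrightarrow>
      f g (h \<otimes> h') = f g h \<otimes>\<^bsub>H\<^esub> f (cj h g) (cj h h')"
    and self: "\<And>x. x \<in> carrier G \<Longrightarrow> f x x = \<one>\<^bsub>H\<^esub>"
  shows "lift H f \<in> hom ES H"
    "g \<in> carrier G \<Longrightarrow> h \<in> carrier G \<Longrightarrow> lift H f (wedge g h) = f g h"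
proof -
  interpret H: group H by (rule H)
  let ?X = "carrier G \<times> carrier G"
  have fX: "case_prod f \<in> ?X \<rightarrow> carrier H" using f by auto
  have "word_eval H (case_prod f) u = word_eval H (case_prod f) v"
    if "(u, v) \<in> tensor_relations G" for u v
    using that f left right by (auto simp: tensor_relations_def word_eval_def)
  then obtain \<psi> where \<psi>: "\<psi> \<in> hom (presented_group ?X (tensor_relations G)) H"
    "\<And>x. x \<in> ?X \<Longrightarrow> \<psi> (presented_gen ?X (tensor_relations G) x) = case_prod f x"
    using H.presented_group_universal[OF fX, of "tensor_relations G"] by blast
  have \<psi>': "group_hom TS H \<psi>"
    using \<psi>(1) by (simp add: group_hom_def group_hom_axioms_def tensor_square_def[symmetric] H)
  have \<psi>t: "\<psi> (tensor G g h) = f g h" if "g \<in> carrier G" "h \<in> carrier G" for g h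
    using \<psi>(2)[of "(g, h)"] that by (simp add: tensor_def)
  have "nabla G \<subseteq> kernel TS H \<psi>"
    unfolding nabla_def
    by (rule TS.generate_subset_subgroup[OF group_hom.subgroup_kernel[OF \<psi>']])
       (auto simp: kernel_def \<psi>t self)
  then obtain \<phi> where \<phi>: "\<phi> \<in> hom (TS Mod nabla G) H"
    "\<And>t. t \<in> carrier TS \<Longrightarrow> \<phi> (nabla G #>\<^bsub>TS\<^esub> t) = \<psi> t"
    using group_hom.FactGroup_universal_kernel[OF \<psi>' nabla_normal] by blast
  then have "\<phi> \<in> hom ES H \<and> (\<forall>g\<in>carrier G. \<forall>h\<in>carrier G. \<phi> (wedge g h) = f g h)"
    by (simp add: wedge_def \<psi>t exterior_square_def)
  then have "lift H f \<in> hom ES H \<and> (\<forall>g\<in>carrier G. \<forall>h\<in>carrier G. lift H f (wedge g h) = f g h)"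
    unfolding lift_def
    by (rule someI[where P = "\<lambda>\<phi>. \<phi> \<in> hom ES H \<and> (\<forall>g\<in>carrier G. \<forall>h\<in>carrier G. \<phi> (wedge g h) = f g h)"])
  then show "lift H f \<in> hom ES H"
    "g \<in> carrier G \<Longrightarrow> h \<in> carrier G \<Longrightarrow> lift H f (wedge g h) = f g h" by blast+
qed

definition act :: "'a \<Rightarrow> ('a \<times> 'a) word set set \<Rightarrow> ('a \<times> 'a) word set set" where
  "act g = lift ES (\<lambda>x y. wedge (cj g x) (cj g y))"

definition bd :: "('a \<times> 'a) word set set \<Rightarrow> 'a" where
  "bd = lift G (commutator G)"

lemma act:
  assumes g: "g \<in> carrier G"
  shows "act g \<in> hom ES ES"
    "x \<in> carrier G \<Longrightarrow> y \<in> carrier G \<Longrightarrow> act g (wedge x y) = wedge (cj g x) (cj g y)"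
proof -
  let ?f = "\<lambda>x y. wedge (cj g x) (cj g y)"
  have swap: "cj g (cj x y) = cj (cj g x) (cj g y)" if "x \<in> carrier G" "y \<in> carrier G" for x y
    using that g by (simp add: conjugate_def word_simps)
  have left: "?f (x \<otimes> x') y = ?f (cj x x') (cj x y) \<otimes>\<^bsub>ES\<^esub> ?f x y"
    if "x \<in> carrier G" "x' \<in> carrier G" "y \<in> carrier G" for x x' y
    using that g by (simp add: swap cj_mult wedge_mult_left)
  have right: "?f x (y \<otimes> y') = ?f x y \<otimes>\<^bsub>ES\<^esub> ?f (cj y x) (cj y y')"
    if "x \<in> carrier G" "y \<in> carrier G" "y' \<in> carrier G" for x y y'
    using that g by (simp add: swap cj_mult wedge_mult_right)
  note lift = lift[OF ES.group_axioms, of ?f, OF _ left right]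
  show "act g \<in> hom ES ES"
    "x \<in> carrier G \<Longrightarrow> y \<in> carrier G \<Longrightarrow> act g (wedge x y) = wedge (cj g x) (cj g y)"
    unfolding act_def using lift g by (simp_all add: wedge_self)
qed

lemma bd:
  "bd \<in> hom ES G" "x \<in> carrier G \<Longrightarrow> y \<in> carrier G \<Longrightarrow> bd (wedge x y) = commutator G x y"
  unfolding bd_def
  by (rule lift[OF group_axioms]; simp add: conjugate_def commutator_def word_simps)+

lemma ES_hom_eq:
  assumes "f \<in> hom ES ES" "h \<in> hom ES ES"
    and "\<And>x y. x \<in> carrier G \<Longrightarrow> y \<in> carrier G \<Longrightarrow> f (wedge x y) = h (wedge x y)" and t: "t \<in> carrier ES"
  shows "f t = h t"
proof (rule ES.hom_eq_on_generate[OF ES.group_axioms assms(1,2)])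
  show "t \<in> generate ES {wedge g h | g h. g \<in> carrier G \<and> h \<in> carrier G}" using t carrier_ES by blast
qed (use assms(3) in auto)

lemma exterior_pairing: "exterior_pairing G ES wedge act bd"
proof (rule exterior_pairing.intro[OF group_axioms ES.group_axioms], rule exterior_pairing_axioms.intro)
  show "act \<one> t = t" if "t \<in> carrier ES" for t
  proof (rule ES_hom_eq[OF act(1)[OF one_closed] _ _ that])
    show "(\<lambda>t. t) \<in> hom ES ES" by (simp add: hom_def)
  qed (simp add: act(2))
  show "act g (act h t) = act (g \<otimes> h) t" if g: "g \<in> carrier G" and h: "h \<in> carrier G" and t: "t \<in> carrier ES" for g h t
  proof (rule ES_hom_eq[OF _ _ _ t])
    show "(\<lambda>t. act g (act h t)) \<in> hom ES ES"
      by (rule homI) (simp_all add: hom_in_carrier[OF act(1)] hom_mult[OF act(1)] g h)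
    show "act (g \<otimes> h) \<in> hom ES ES" using act(1) g h by simp
  qed (use g h in \<open>simp add: act(2) cj_cj\<close>)
  show "carrier ES = generate ES {wedge x y | x y. x \<in> carrier G \<and> y \<in> carrier G}" by (rule carrier_ES)
qed (simp_all add: act bd wedge_mult_left wedge_mult_right wedge_self)

end

section \<open>The Schur multiplier inside a central extension\<close>

text \<open>The order of the factors matches the three terms of \<open>bar2\<close>: it is applied
  with a, b, d the images of g, h and g h.\<close>

lemma (in comm_group) mult_eq_mult_imp:
  assumes "a \<otimes> b = c \<otimes> d" and [simp]: "a \<in> carrier G" "b \<in> carrier G" "c \<in> carrier G" "d \<in> carrier G"
  shows "c = b \<otimes> inv d \<otimes> a"
proof -
  have "c = c \<otimes> d \<otimes> inv d" by (simp add: m_assoc)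
  then show ?thesis unfolding assms(1)[symmetric] by (simp add: m_ac)
qed

locale cocycle_extension = A: comm_group A + G: group G
  for A :: "('c, 'n) monoid_scheme" and G :: "('a, 'm) monoid_scheme" (structure) +
  fixes \<sigma> :: "'a \<Rightarrow> 'a \<Rightarrow> 'c"
  assumes \<sigma>_closed [simp]: "g \<in> carrier G \<Longrightarrow> h \<in> carrier G \<Longrightarrow> \<sigma> g h \<in> carrier A"
    and cocycle: "g \<in> carrier G \<Longrightarrow> h \<in> carrier G \<Longrightarrow> k \<in> carrier G \<Longrightarrow>
      \<sigma> h k \<otimes>\<^bsub>A\<^esub> \<sigma> g (h \<otimes> k) = \<sigma> (g \<otimes> h) k \<otimes>\<^bsub>A\<^esub> \<sigma> g h"
begin

text \<open>The cocycle is not normalised, since the bar complex is not; this accounts for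
  \<sigma>(1, 1) in the unit and in \<open>emb\<close>.\<close>

definition E :: "('c \<times> 'a) monoid" where
  "E = \<lparr>carrier = carrier A \<times> carrier G,
     monoid.mult = (\<lambda>(a, g) (b, h). (a \<otimes>\<^bsub>A\<^esub> b \<otimes>\<^bsub>A\<^esub> \<sigma> g h, g \<otimes> h)),
     one = (inv\<^bsub>A\<^esub> \<sigma> \<one> \<one>, \<one>)\<rparr>"

lemma E_simps:
  "carrier E = carrier A \<times> carrier G"
  "(a, g) \<otimes>\<^bsub>E\<^esub> (b, h) = (a \<otimes>\<^bsub>A\<^esub> b \<otimes>\<^bsub>A\<^esub> \<sigma> g h, g \<otimes> h)"
  "\<one>\<^bsub>E\<^esub> = (inv\<^bsub>A\<^esub> \<sigma> \<one> \<one>, \<one>)"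
  by (simp_all add: E_def)

lemma \<sigma>_one_left: "k \<in> carrier G \<Longrightarrow> \<sigma> \<one> k = \<sigma> \<one> \<one>"
  using cocycle[of "\<one>" "\<one>" k] by simp

lemma \<sigma>_one_right: "g \<in> carrier G \<Longrightarrow> \<sigma> g \<one> = \<sigma> \<one> \<one>"
  using cocycle[of g "\<one>" "\<one>"] by simp

lemma group_E: "group E"
proof (rule groupI)
  fix x y z assume "x \<in> carrier E" "y \<in> carrier E" "z \<in> carrier E"
  then obtain a g b h c k where xyz: "x = (a, g)" "y = (b, h)" "z = (c, k)"
    and [simp]: "a \<in> carrier A" "b \<in> carrier A" "c \<in> carrier A" "g \<in> carrier G" "h \<in> carrier G" "k \<in> carrier G"
    by (auto simp: E_simps)
  have "a \<otimes>\<^bsub>A\<^esub> b \<otimes>\<^bsub>A\<^esub> \<sigma> g h \<otimes>\<^bsub>A\<^esub> c \<otimes>\<^bsub>A\<^esub> \<sigma> (g \<otimes> h) k =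
      a \<otimes>\<^bsub>A\<^esub> b \<otimes>\<^bsub>A\<^esub> c \<otimes>\<^bsub>A\<^esub> (\<sigma> (g \<otimes> h) k \<otimes>\<^bsub>A\<^esub> \<sigma> g h)" by (simp add: A.m_ac)
  also have "\<dots> = a \<otimes>\<^bsub>A\<^esub> (b \<otimes>\<^bsub>A\<^esub> c \<otimes>\<^bsub>A\<^esub> \<sigma> h k) \<otimes>\<^bsub>A\<^esub> \<sigma> g (h \<otimes> k)"
    by (simp add: cocycle[symmetric] A.m_assoc)
  finally show "x \<otimes>\<^bsub>E\<^esub> y \<otimes>\<^bsub>E\<^esub> z = x \<otimes>\<^bsub>E\<^esub> (y \<otimes>\<^bsub>E\<^esub> z)"
    by (simp add: xyz E_simps G.m_assoc)
next
  fix x assume "x \<in> carrier E"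
  then obtain a g where x: "x = (a, g)" and [simp]: "a \<in> carrier A" "g \<in> carrier G" by (auto simp: E_simps)
  show "\<one>\<^bsub>E\<^esub> \<otimes>\<^bsub>E\<^esub> x = x"
  proof -
    have "inv\<^bsub>A\<^esub> \<sigma> \<one> \<one> \<otimes>\<^bsub>A\<^esub> a \<otimes>\<^bsub>A\<^esub> \<sigma> \<one> \<one> = a"
      by (simp add: A.m_ac)
    then show ?thesis by (simp add: x E_simps \<sigma>_one_left[of g])
  qed
  show "\<exists>y\<in>carrier E. y \<otimes>\<^bsub>E\<^esub> x = \<one>\<^bsub>E\<^esub>"
  proof
    let ?b = "inv\<^bsub>A\<^esub> \<sigma> \<one> \<one> \<otimes>\<^bsub>A\<^esub> inv\<^bsub>A\<^esub> (a \<otimes>\<^bsub>A\<^esub> \<sigma> (inv g) g)"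
    show "(?b, inv g) \<in> carrier E" by (simp add: E_simps)
    have "?b \<otimes>\<^bsub>A\<^esub> a \<otimes>\<^bsub>A\<^esub> \<sigma> (inv g) g = inv\<^bsub>A\<^esub> \<sigma> \<one> \<one>"
      by (simp add: A.m_assoc)
    then show "(?b, inv g) \<otimes>\<^bsub>E\<^esub> x = \<one>\<^bsub>E\<^esub>" by (simp add: x E_simps)
  qed
qed (auto simp: E_simps)

sublocale E: group E by (rule group_E)

definition emb :: "'c \<Rightarrow> 'c \<times> 'a" where
  "emb a = (a \<otimes>\<^bsub>A\<^esub> inv\<^bsub>A\<^esub> \<sigma> \<one> \<one>, \<one>)"

definition sec :: "'a \<Rightarrow> 'c \<times> 'a" where "sec g = (\<one>\<^bsub>A\<^esub>, g)"

lemma emb_hom: "group_hom A E emb"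
proof -
  have "a \<otimes>\<^bsub>A\<^esub> b \<otimes>\<^bsub>A\<^esub> inv\<^bsub>A\<^esub> \<sigma> \<one> \<one> = a \<otimes>\<^bsub>A\<^esub> inv\<^bsub>A\<^esub> \<sigma> \<one> \<one> \<otimes>\<^bsub>A\<^esub> (b \<otimes>\<^bsub>A\<^esub> inv\<^bsub>A\<^esub> \<sigma> \<one> \<one>) \<otimes>\<^bsub>A\<^esub> \<sigma> \<one> \<one>"
    if [simp]: "a \<in> carrier A" "b \<in> carrier A" for a b
  proof -
    define s i where "s = \<sigma> \<one> \<one>" and "i = inv\<^bsub>A\<^esub> s"
    have [simp]: "s \<in> carrier A" "i \<in> carrier A" by (simp_all add: s_def i_def)
    have "a \<otimes>\<^bsub>A\<^esub> i \<otimes>\<^bsub>A\<^esub> (b \<otimes>\<^bsub>A\<^esub> i) \<otimes>\<^bsub>A\<^esub> s = a \<otimes>\<^bsub>A\<^esub> b \<otimes>\<^bsub>A\<^esub> i \<otimes>\<^bsub>A\<^esub> (i \<otimes>\<^bsub>A\<^esub> s)" by (simp add: A.m_ac)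
    also have "i \<otimes>\<^bsub>A\<^esub> s = \<one>\<^bsub>A\<^esub>" by (simp add: i_def)
    finally show ?thesis by (simp add: i_def s_def)
  qed
  then show ?thesis
    by (auto simp: group_hom_def group_hom_axioms_def emb_def E_simps A.group_axioms group_E intro!: homI)
qed

sublocale emb: group_hom A E emb by (rule emb_hom)

lemma sec_closed [simp]: "g \<in> carrier G \<Longrightarrow> sec g \<in> carrier E"
  by (simp add: sec_def E_simps)

lemma emb_eq_one: "a \<in> carrier A \<Longrightarrow> emb a = \<one>\<^bsub>E\<^esub> \<Longrightarrow> a = \<one>\<^bsub>A\<^esub>"
  by (simp add: emb_def E_simps A.inv_solve_right')

lemma decompose:
  assumes "x \<in> carrier E"
  obtains a where "a \<in> carrier A" "x = emb a \<otimes>\<^bsub>E\<^esub> sec (snd x)" "snd x \<in> carrier G"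
proof -
  obtain a g where "x = (a, g)" "a \<in> carrier A" "g \<in> carrier G" using assms by (auto simp: E_simps)
  then show ?thesis
    using that[of a] by (simp add: emb_def sec_def E_simps A.m_assoc \<sigma>_one_left[of g])
qed

lemma emb_central:
  assumes a: "a \<in> carrier A" and x: "x \<in> carrier E"
  shows "emb a \<otimes>\<^bsub>E\<^esub> x = x \<otimes>\<^bsub>E\<^esub> emb a"
proof -
  obtain b g where "x = (b, g)" "b \<in> carrier A" "g \<in> carrier G" using x by (auto simp: E_simps)
  then show ?thesis using a by (simp add: emb_def E_simps \<sigma>_one_left[of g] \<sigma>_one_right[of g] A.m_ac)
qed

lemma commutator_emb_left:
  assumes a: "a \<in> carrier A" and x: "x \<in> carrier E" and y: "y \<in> carrier E"
  shows "commutator E (emb a \<otimes>\<^bsub>E\<^esub> x) y = commutator E x y"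
proof -
  have "emb a \<otimes>\<^bsub>E\<^esub> commutator E x y \<otimes>\<^bsub>E\<^esub> inv\<^bsub>E\<^esub> emb a = commutator E x y"
    using emb_central[OF a, of "commutator E x y"] a x y by (simp add: E.m_assoc)
  moreover have "commutator E (emb a) y = \<one>\<^bsub>E\<^esub>"
    using emb_central[OF a y] a y by (simp add: commutator_def E.word_simps)
  ultimately show ?thesis using a x y by (simp add: E.commutator_mult_left)
qed

text \<open>Changing a lift by a central element does not change the commutator, so every lift may
  be replaced by \<open>sec\<close>.\<close>

lemma commutator_sec:
  assumes x: "x \<in> carrier E" and y: "y \<in> carrier E"
  shows "commutator E x y = commutator E (sec (snd x)) (sec (snd y))"
proof -
  have 1: "commutator E x y = commutator E (sec (snd x)) y" if "x \<in> carrier E" "y \<in> carrier E" for x y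
    by (rule decompose[OF that(1)]) (metis commutator_emb_left sec_closed that(2))
  have s: "sec (snd x) \<in> carrier E" using x by (auto simp: sec_def E_simps)
  have "commutator E (sec (snd x)) y = inv\<^bsub>E\<^esub> commutator E y (sec (snd x))"
    using E.inv_commutator y s by simp
  also have "\<dots> = inv\<^bsub>E\<^esub> commutator E (sec (snd y)) (sec (snd x))" using 1[OF y s] by simp
  also have "\<dots> = commutator E (sec (snd x)) (sec (snd y))"
    by (rule E.inv_commutator) (use y s in \<open>auto simp: sec_def E_simps\<close>)
  finally show ?thesis using 1[OF x y] by simp
qed

lemma snd_hom: "snd \<in> hom E G"
  by (rule homI) (auto simp: E_simps)

lemma snd_conj:
  assumes "x \<in> carrier E" "y \<in> carrier E"
  shows "snd (x \<otimes>\<^bsub>E\<^esub> y \<otimes>\<^bsub>E\<^esub> inv\<^bsub>E\<^esub> x) = conjugate G (snd x) (snd y)"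
proof -
  interpret s: group_hom E G snd by (simp add: group_hom_def group_hom_axioms_def snd_hom group_E G.group_axioms)
  show ?thesis using assms by (simp add: conjugate_def)
qed

lemma sec_mult: "g \<in> carrier G \<Longrightarrow> h \<in> carrier G \<Longrightarrow> sec g \<otimes>\<^bsub>E\<^esub> sec h = emb (\<sigma> g h) \<otimes>\<^bsub>E\<^esub> sec (g \<otimes> h)"
  by (simp add: sec_def emb_def E_simps \<sigma>_one_left[of "g \<otimes> h"] A.m_assoc)

text \<open>Although \<open>sec\<close> is not a homomorphism, (g, h) |-> [sec g, sec h] satisfies
  the relations of the exterior square, because commutators in \<open>E\<close> do not see the
  central part.\<close>

lemma exterior_square_to_derived:
  obtains \<phi> where "\<phi> \<in> hom (exterior_square G) E" "derived E (carrier E) \<subseteq> \<phi> ` carrier (exterior_square G)"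
proof -
  interpret X: group_tensor G by (simp add: group_tensor_def G.group_axioms)
  let ?f = "\<lambda>g h. commutator E (sec g) (sec h)"
  have sn [simp]: "snd (sec g) = g" for g by (simp add: sec_def)
  have snm: "snd (x \<otimes>\<^bsub>E\<^esub> y) = snd x \<otimes> snd y" if "x \<in> carrier E" "y \<in> carrier E" for x y
    using hom_mult[OF snd_hom that] .
  have conj: "sec g \<otimes>\<^bsub>E\<^esub> ?f x y \<otimes>\<^bsub>E\<^esub> inv\<^bsub>E\<^esub> sec g = ?f (conjugate G g x) (conjugate G g y)"
    if "g \<in> carrier G" "x \<in> carrier G" "y \<in> carrier G" for g x y
    using that by (simp add: E.conj_commutator) (subst commutator_sec, simp_all add: snd_conj)
  have left: "?f (g \<otimes> g') h = ?f (conjugate G g g') (conjugate G g h) \<otimes>\<^bsub>E\<^esub> ?f g h"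
    if [simp]: "g \<in> carrier G" "g' \<in> carrier G" "h \<in> carrier G" for g g' h
  proof -
    have "?f (g \<otimes> g') h = commutator E (sec g \<otimes>\<^bsub>E\<^esub> sec g') (sec h)"
      by (subst (2) commutator_sec) (simp_all add: snm)
    then show ?thesis by (simp add: E.commutator_mult_left conj)
  qed
  have right: "?f g (h \<otimes> h') = ?f g h \<otimes>\<^bsub>E\<^esub> ?f (conjugate G h g) (conjugate G h h')"
    if [simp]: "g \<in> carrier G" "h \<in> carrier G" "h' \<in> carrier G" for g h h'
  proof -
    have "?f g (h \<otimes> h') = commutator E (sec g) (sec h \<otimes>\<^bsub>E\<^esub> sec h')"
      by (subst (2) commutator_sec) (simp_all add: snm)
    then show ?thesis by (simp add: E.commutator_mult_right conj)
  qed
  define \<phi> where "\<phi> = X.lift E ?f"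
  have \<phi>: "\<phi> \<in> hom (exterior_square G) E"
    "\<And>g h. g \<in> carrier G \<Longrightarrow> h \<in> carrier G \<Longrightarrow> \<phi> (X.wedge g h) = ?f g h"
    unfolding \<phi>_def by (rule X.lift[OF group_E _ left right]; simp)+
  have \<phi>h: "group_hom (exterior_square G) E \<phi>"
    by (simp add: group_hom_def group_hom_axioms_def \<phi>(1) group_E X.ES.group_axioms)
  have "derived E (carrier E) \<subseteq> \<phi> ` carrier (exterior_square G)"
    unfolding derived_def
  proof (rule E.generate_subset_subgroup[OF group_hom.img_is_subgroup[OF \<phi>h]], rule subsetI)
    fix z assume "z \<in> derived_set E (carrier E)"
    then obtain x y where xy: "x \<in> carrier E" "y \<in> carrier E" "z = x \<otimes>\<^bsub>E\<^esub> y \<otimes>\<^bsub>E\<^esub> inv\<^bsub>E\<^esub> x \<otimes>\<^bsub>E\<^esub> inv\<^bsub>E\<^esub> y" by blast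
    then have "x \<otimes>\<^bsub>E\<^esub> y \<otimes>\<^bsub>E\<^esub> inv\<^bsub>E\<^esub> x \<otimes>\<^bsub>E\<^esub> inv\<^bsub>E\<^esub> y = \<phi> (X.wedge (snd x) (snd y))" "snd x \<in> carrier G" "snd y \<in> carrier G"
      using commutator_sec[of x y] \<phi>(2) by (auto simp: commutator_def E_simps)
    then show "z \<in> \<phi> ` carrier (exterior_square G)" using xy(3) by simp
  qed
  then show ?thesis using that \<phi>(1) by blast
qed

end

section \<open>The bar complex and the central extension of chains modulo boundaries\<close>

lemma keys_bar2:
  "group G \<Longrightarrow> g \<in> carrier G \<Longrightarrow> h \<in> carrier G \<Longrightarrow> Poly_Mapping.keys (bar2 G (g, h)) \<subseteq> carrier G"
  using keys_add[of "frag_of h - frag_of (g \<otimes>\<^bsub>G\<^esub> h)" "frag_of g"]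
    keys_diff[of "frag_of h" "frag_of (g \<otimes>\<^bsub>G\<^esub> h)"] monoid.m_closed[OF group.is_monoid]
  by (fastforce simp: bar2_def)

lemma frag_extend_hom:
  assumes "\<And>x. x \<in> X \<Longrightarrow> Poly_Mapping.keys (f x) \<subseteq> Y"
  shows "frag_extend f \<in> hom (free_Abelian_group X) (free_Abelian_group Y)"
proof (rule homI)
  show "frag_extend f c \<in> carrier (free_Abelian_group Y)" if "c \<in> carrier (free_Abelian_group X)" for c
    using that keys_frag_extend[of f c] assms by fastforce
qed (simp add: frag_extend_add)

lemma keys_bar3:
  assumes "group G" "g \<in> carrier G" "h \<in> carrier G" "k \<in> carrier G"
  shows "Poly_Mapping.keys (bar3 G (g, h, k)) \<subseteq> carrier G \<times> carrier G"
proof -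
  interpret group G by fact
  have "bar3 G (g, h, k) \<in> carrier (free_Abelian_group (carrier G \<times> carrier G))"
    unfolding bar3_def prod.case
    using assms by (metis (no_types, lifting) carrier_free_Abelian_group_iff mem_Sigma_iff m_closed
        frag_of_in_free_Abelian_group group_free_Abelian_group group.inv_closed inv_free_Abelian_group
        monoid.m_closed group.is_monoid mult_free_Abelian_group diff_conv_add_uminus)
  then show ?thesis by simp
qed

text \<open>The coefficient group consists of all 2-chains modulo boundaries, so that the class of
  (g, h) is a cocycle by the very form of \<open>bar3\<close>. The abelianisation of the resulting
  extension sees a chain only through its boundary.\<close>

theorem schur_multiplier_pow_eq_one:
  fixes G :: "('a, 'm) monoid_scheme" and N :: nat
  assumes "group G"
    and T: "\<And>t. t \<in> carrier (exterior_square G) \<Longrightarrow> t [^]\<^bsub>exterior_square G\<^esub> N = \<one>\<^bsub>exterior_square G\<^esub>"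
  shows "group (schur_multiplier G)"
    and "x \<in> carrier (schur_multiplier G) \<Longrightarrow> x [^]\<^bsub>schur_multiplier G\<^esub> N = \<one>\<^bsub>schur_multiplier G\<^esub>"
proof -
  interpret G: group G by fact
  let ?F = "free_Abelian_group (carrier G \<times> carrier G)"
  interpret F: comm_group ?F by (rule abelian_free_Abelian_group)
  let ?d = "frag_extend (bar2 G)"
  have d3: "group_hom (free_Abelian_group (carrier G \<times> carrier G \<times> carrier G)) ?F (frag_extend (bar3 G))"
    using keys_bar3[OF \<open>group G\<close>] by (auto simp: group_hom_def group_hom_axioms_def intro!: frag_extend_hom)
  have d2: "group_hom ?F (free_Abelian_group (carrier G)) ?d"
    using keys_bar2[OF \<open>group G\<close>] by (auto simp: group_hom_def group_hom_axioms_def intro!: frag_extend_hom)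
  have B: "subgroup (boundaries2 G) ?F"
    unfolding boundaries2_def by (rule group_hom.img_is_subgroup[OF d3])
  have Z: "subgroup (cycles2 G) ?F"
    unfolding cycles2_def by (rule group_hom.subgroup_kernel[OF d2])
  have BZ: "boundaries2 G \<subseteq> cycles2 G"
  proof
    fix b assume b: "b \<in> boundaries2 G"
    then obtain c where c: "b = frag_extend (bar3 G) c" "Poly_Mapping.keys c \<subseteq> carrier G \<times> carrier G \<times> carrier G"
      by (auto simp: boundaries2_def)
    have "?d (frag_extend (bar3 G) c) = 0"
      by (rule free_Abelian_group_induct[OF c(2)])
         (use bar2_bar3[OF \<open>group G\<close>] in \<open>auto simp: frag_extend_diff\<close>)
    then show "b \<in> cycles2 G" using b c subgroup.mem_carrier[OF B] by (simp add: cycles2_def kernel_def)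
  qed
  let ?A = "?F Mod boundaries2 G" and ?q = "\<lambda>z. boundaries2 G #>\<^bsub>?F\<^esub> z"
  have BN: "boundaries2 G \<lhd> ?F" by (rule F.subgroup_imp_normal[OF B])
  interpret A: comm_group ?A by (rule F.abelian_FactGroup[OF B])
  interpret q: group_hom ?F ?A ?q
    using normal.r_coset_hom_Mod[OF BN] by (simp add: group_hom_def group_hom_axioms_def A.group_axioms)
  have q_mem: "z \<in> boundaries2 G" if "z \<in> carrier ?F" "?q z = \<one>\<^bsub>?A\<^esub>" for z
    using F.coset_join1[OF _ that(1) B] that(2) by simp
  define \<sigma> where "\<sigma> g h = ?q (frag_of (g, h))" for g h
  interpret C: cocycle_extension ?A G \<sigma>
  proof (unfold_locales)
    show "\<sigma> g h \<in> carrier ?A" if "g \<in> carrier G" "h \<in> carrier G" for g h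
      unfolding \<sigma>_def by (rule q.hom_closed) (use that in simp)
    show "\<sigma> h k \<otimes>\<^bsub>?A\<^esub> \<sigma> g (h \<otimes>\<^bsub>G\<^esub> k) = \<sigma> (g \<otimes>\<^bsub>G\<^esub> h) k \<otimes>\<^bsub>?A\<^esub> \<sigma> g h"
      if [simp]: "g \<in> carrier G" "h \<in> carrier G" "k \<in> carrier G" for g h k
    proof -
      let ?x = "frag_of (h, k) + frag_of (g, h \<otimes>\<^bsub>G\<^esub> k)" and ?y = "frag_of (g \<otimes>\<^bsub>G\<^esub> h, k) + frag_of (g, h)"
      have fr: "frag_of (a, b) \<in> carrier ?F" if "a \<in> carrier G" "b \<in> carrier G" for a b
        using that by simp
      have y: "?y \<in> carrier ?F" using F.m_closed[OF fr fr, of "g \<otimes>\<^bsub>G\<^esub> h" k g h] by simp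
      have "bar3 G (g, h, k) = frag_extend (bar3 G) (frag_of (g, h, k))" by simp
      moreover have "frag_of (g, h, k) \<in> carrier (free_Abelian_group (carrier G \<times> carrier G \<times> carrier G))" by simp
      ultimately have b: "bar3 G (g, h, k) \<in> boundaries2 G" unfolding boundaries2_def by (rule image_eqI)
      have "?x = bar3 G (g, h, k) \<otimes>\<^bsub>?F\<^esub> ?y" by (simp add: bar3_def)
      then have "?q ?x = ?q (bar3 G (g, h, k)) \<otimes>\<^bsub>?A\<^esub> ?q ?y"
        using q.hom_mult[OF subgroup.mem_carrier[OF B b] y] by (simp only:)
      also have "?q (bar3 G (g, h, k)) = \<one>\<^bsub>?A\<^esub>"
        using F.coset_join2[OF subgroup.mem_carrier[OF B b] B b] by simp
      finally have "?q ?x = ?q ?y" using q.hom_closed[OF y] A.l_one by metis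
      moreover have "?q ?x = \<sigma> h k \<otimes>\<^bsub>?A\<^esub> \<sigma> g (h \<otimes>\<^bsub>G\<^esub> k)"
        unfolding \<sigma>_def using q.hom_mult[OF fr fr, of h k g "h \<otimes>\<^bsub>G\<^esub> k"] by (simp del: mult_FactGroup)
      moreover have "?q ?y = \<sigma> (g \<otimes>\<^bsub>G\<^esub> h) k \<otimes>\<^bsub>?A\<^esub> \<sigma> g h"
        unfolding \<sigma>_def using q.hom_mult[OF fr fr, of "g \<otimes>\<^bsub>G\<^esub> h" k g h] by (simp del: mult_FactGroup)
      ultimately show ?thesis by simp
    qed
  qed
  let ?D = "derived C.E (carrier C.E)"
  let ?Ab = "C.E Mod ?D" and ?\<pi> = "\<lambda>x. ?D #>\<^bsub>C.E\<^esub> x"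
  interpret D: normal ?D C.E by (rule C.E.derived_self_is_normal)
  interpret Ab: comm_group ?Ab by (rule C.E.derived_quot_is_comm_group)
  interpret \<pi>: group_hom C.E ?Ab ?\<pi>
    using D.r_coset_hom_Mod by (simp add: group_hom_def group_hom_axioms_def C.group_E Ab.group_axioms)
  have "(\<lambda>g. ?\<pi> (C.sec g)) ` carrier G \<subseteq> carrier ?Ab"
    using \<pi>.hom_closed by auto
  then obtain \<rho> where \<rho>: "\<rho> \<in> hom (free_Abelian_group (carrier G)) ?Ab"
    "\<And>g. g \<in> carrier G \<Longrightarrow> \<rho> (frag_of g) = ?\<pi> (C.sec g)"
    by (rule Ab.free_Abelian_group_universal) blast
  interpret \<rho>: group_hom "free_Abelian_group (carrier G)" ?Ab \<rho>
    by (simp add: group_hom_def group_hom_axioms_def \<rho>(1) Ab.group_axioms)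
  \<comment> \<open>After abelianisation, sec g sec h = emb (\<sigma> g h) sec (g h) says that the
    class of (g, h) goes to h - gh + g, its boundary. The general case follows by
    additivity.\<close>
  have key: "?\<pi> (C.emb (?q z)) = \<rho> (?d z)" if "Poly_Mapping.keys z \<subseteq> carrier G \<times> carrier G" for z
  proof (rule free_Abelian_group_induct[OF that, where P = "\<lambda>z. ?\<pi> (C.emb (?q z)) = \<rho> (?d z)"])
    have "?q 0 = \<one>\<^bsub>?A\<^esub>" using q.hom_one by (simp del: one_FactGroup)
    then show "?\<pi> (C.emb (?q 0)) = \<rho> (?d 0)" using \<rho>.hom_one by (simp del: one_FactGroup)
  next
    fix x y assume 2: "Poly_Mapping.keys x \<subseteq> carrier G \<times> carrier G" "Poly_Mapping.keys y \<subseteq> carrier G \<times> carrier G"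
      "?\<pi> (C.emb (?q x)) = \<rho> (?d x)" "?\<pi> (C.emb (?q y)) = \<rho> (?d y)"
    have x: "x \<in> carrier ?F" and y: "y \<in> carrier ?F" using 2 by auto
    have "x - y = x \<otimes>\<^bsub>?F\<^esub> inv\<^bsub>?F\<^esub> y" using y by simp
    then have "?q (x - y) = ?q x \<otimes>\<^bsub>?A\<^esub> inv\<^bsub>?A\<^esub> ?q y"
      using q.hom_mult[OF x F.inv_closed[OF y]] q.hom_inv[OF y] by (simp only:)
    then have l: "?\<pi> (C.emb (?q (x - y))) = ?\<pi> (C.emb (?q x)) \<otimes>\<^bsub>?Ab\<^esub> inv\<^bsub>?Ab\<^esub> ?\<pi> (C.emb (?q y))"
      using x y by (simp del: mult_FactGroup carrier_free_Abelian_group_iff)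
    have dx: "?d x \<in> carrier (free_Abelian_group (carrier G))" and dy: "?d y \<in> carrier (free_Abelian_group (carrier G))"
      using group_hom.hom_closed[OF d2] x y by blast+
    have "?d (x - y) = ?d x \<otimes>\<^bsub>free_Abelian_group (carrier G)\<^esub> inv\<^bsub>free_Abelian_group (carrier G)\<^esub> ?d y"
      using dy by (simp add: frag_extend_diff)
    then have "\<rho> (?d (x - y)) = \<rho> (?d x) \<otimes>\<^bsub>?Ab\<^esub> inv\<^bsub>?Ab\<^esub> \<rho> (?d y)"
      using dx dy \<rho>.hom_mult[OF dx group.inv_closed[OF group_free_Abelian_group dy]] \<rho>.hom_inv[OF dy] by (simp only:)
    then show "?\<pi> (C.emb (?q (x - y))) = \<rho> (?d (x - y))" using l 2 by (simp only:)
  next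
    fix a assume "a \<in> carrier G \<times> carrier G"
    then obtain g h where a: "a = (g, h)" and [simp]: "g \<in> carrier G" "h \<in> carrier G" by auto
    let ?s = "\<lambda>g. ?\<pi> (C.sec g)" and ?FG = "free_Abelian_group (carrier G)"
    have sc: "?s k \<in> carrier ?Ab" if "k \<in> carrier G" for k using that by (intro \<pi>.hom_closed) simp
    have ec: "?\<pi> (C.emb (\<sigma> g h)) \<in> carrier ?Ab" by (intro \<pi>.hom_closed C.emb.hom_closed C.\<sigma>_closed) simp_all
    have "?s g \<otimes>\<^bsub>?Ab\<^esub> ?s h = ?\<pi> (C.emb (\<sigma> g h)) \<otimes>\<^bsub>?Ab\<^esub> ?s (g \<otimes>\<^bsub>G\<^esub> h)"
      using arg_cong[OF C.sec_mult[of g h], of ?\<pi>] by (simp del: mult_FactGroup)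
    then have "?\<pi> (C.emb (\<sigma> g h)) = ?s h \<otimes>\<^bsub>?Ab\<^esub> inv\<^bsub>?Ab\<^esub> ?s (g \<otimes>\<^bsub>G\<^esub> h) \<otimes>\<^bsub>?Ab\<^esub> ?s g"
      by (rule Ab.mult_eq_mult_imp) (intro sc ec G.m_closed; simp)+
    also have "\<dots> = \<rho> (frag_of h \<otimes>\<^bsub>?FG\<^esub> inv\<^bsub>?FG\<^esub> frag_of (g \<otimes>\<^bsub>G\<^esub> h) \<otimes>\<^bsub>?FG\<^esub> frag_of g)"
    proof -
      have f: "frag_of k \<in> carrier ?FG" if "k \<in> carrier G" for k using that by simp
      have i: "inv\<^bsub>?FG\<^esub> frag_of (g \<otimes>\<^bsub>G\<^esub> h) \<in> carrier ?FG"
        by (rule group.inv_closed[OF group_free_Abelian_group f]) simp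
      show ?thesis
        using \<rho>.hom_mult[OF monoid.m_closed[OF group.is_monoid[OF group_free_Abelian_group] f i] f, of h g]
          \<rho>.hom_mult[OF f i, of h] \<rho>.hom_inv[OF f, of "g \<otimes>\<^bsub>G\<^esub> h"] \<rho>(2) by simp
    qed
    also have "frag_of h \<otimes>\<^bsub>?FG\<^esub> inv\<^bsub>?FG\<^esub> frag_of (g \<otimes>\<^bsub>G\<^esub> h) \<otimes>\<^bsub>?FG\<^esub> frag_of g = ?d (frag_of a)"
      by (simp add: a bar2_def)
    finally have "?\<pi> (C.emb (\<sigma> g h)) = \<rho> (?d (frag_of a))" .
    moreover have "\<sigma> g h = ?q (frag_of a)" by (simp add: \<sigma>_def a)
    ultimately show "?\<pi> (C.emb (?q (frag_of a))) = \<rho> (?d (frag_of a))" by (simp only:)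
  qed
  obtain \<phi> where \<phi>: "\<phi> \<in> hom (exterior_square G) C.E" "?D \<subseteq> \<phi> ` carrier (exterior_square G)"
    by (rule C.exterior_square_to_derived)
  interpret X: group_tensor G by (simp add: group_tensor_def G.group_axioms)
  interpret \<phi>: group_hom "exterior_square G" C.E \<phi>
    by (simp add: group_hom_def group_hom_axioms_def \<phi>(1) C.group_E X.ES.group_axioms)
  \<comment> \<open>For a cycle, \<open>key\<close> puts the class into the derived subgroup, which
    the exterior square covers and whose elements are therefore killed by N; injectivity of
    \<open>emb\<close> carries this back.\<close>
  have main: "z [^]\<^bsub>?F\<^esub> N \<in> boundaries2 G" if z: "z \<in> cycles2 G" for z
  proof -
    have zc: "z \<in> carrier ?F" and dz: "?d z = 0" using z by (auto simp: cycles2_def kernel_def)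
    have qz: "?q z \<in> carrier ?A" by (rule q.hom_closed[OF zc])
    have "?\<pi> (C.emb (?q z)) = ?D" using key[of z] zc dz \<rho>.hom_one by simp
    then have "C.emb (?q z) \<in> ?D"
      using C.E.coset_join1[OF _ C.emb.hom_closed[OF qz] D.subgroup_axioms] by simp
    then obtain t where t: "t \<in> carrier (exterior_square G)" "C.emb (?q z) = \<phi> t" using \<phi>(2) by blast
    have "C.emb (?q (z [^]\<^bsub>?F\<^esub> N)) = C.emb (?q z) [^]\<^bsub>C.E\<^esub> N"
      using q.hom_nat_pow[OF zc, of N] C.emb.hom_nat_pow[OF qz, of N] by (simp only:)
    also have "\<dots> = \<phi> (t [^]\<^bsub>exterior_square G\<^esub> N)" using t \<phi>.hom_nat_pow by simp
    also have "\<dots> = \<one>\<^bsub>C.E\<^esub>" using T[OF t(1)] by simp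
    finally have "?q (z [^]\<^bsub>?F\<^esub> N) = \<one>\<^bsub>?A\<^esub>"
      using C.emb_eq_one q.hom_closed[OF F.nat_pow_closed[OF zc]] by blast
    then show ?thesis using q_mem F.nat_pow_closed[OF zc] by blast
  qed
  let ?Z = "subgroup_generated ?F (cycles2 G)"
  have Zc: "carrier ?Z = cycles2 G" by (rule subgroup.carrier_subgroup_generated_subgroup[OF Z])
  interpret Z: comm_group ?Z by (rule F.abelian_subgroup_generated[OF abelian_free_Abelian_group])
  have BZs: "subgroup (boundaries2 G) ?Z" using F.subgroup_subgroup_generated_iff B BZ Zc by blast
  have BZn: "boundaries2 G \<lhd> ?Z" by (rule Z.subgroup_imp_normal[OF BZs])
  interpret M: comm_group "schur_multiplier G"
    unfolding schur_multiplier_def by (rule Z.abelian_FactGroup[OF BZs])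
  show "group (schur_multiplier G)" by (rule M.group_axioms)
  show "x [^]\<^bsub>schur_multiplier G\<^esub> N = \<one>\<^bsub>schur_multiplier G\<^esub>" if x: "x \<in> carrier (schur_multiplier G)"
  proof -
    obtain z where z: "x = boundaries2 G #>\<^bsub>?Z\<^esub> z" "z \<in> cycles2 G"
      using x unfolding schur_multiplier_def carrier_FactGroup Zc by blast
    have "x [^]\<^bsub>schur_multiplier G\<^esub> N = boundaries2 G #>\<^bsub>?Z\<^esub> (z [^]\<^bsub>?F\<^esub> N)"
      unfolding schur_multiplier_def z(1)
      using normal.FactGroup_pow[OF BZn, of z N] z(2) Zc by (simp only: pow_subgroup_generated)
    also have "\<dots> = boundaries2 G"
      using main[OF z(2)] BZ by (intro Z.coset_join2[OF _ BZs]) (auto simp: Zc)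
    finally show ?thesis by (simp add: schur_multiplier_def)
  qed
qed

text \<open>For n = 1 the definition of n says only that c + 1 <= p + 1. For n >= 2 it gives c + 1
  <= (p - 1)^(n - 1) (p + 1), where one factor p - 1 combines with p + 1 to p^2 - 1 < p^2, so the
  bound is at most p^n.\<close>

lemma ceiling_log_bound:
  fixes p c n :: nat
  assumes p: "3 \<le> p" and c: "p \<le> c"
    and n: "n = nat (1 + \<lceil>log (real p - 1) ((real c + 1) / (real p + 1))\<rceil>)"
  shows "c + 1 \<le> p ^ n \<or> c \<le> p \<and> n = 1"
proof -
  let ?b = "real p - 1" and ?x = "(real c + 1) / (real p + 1)"
  have b: "1 < ?b" using p by simp
  have x: "1 \<le> ?x" using c by simp
  have log: "0 \<le> log ?b ?x" using b x by simp
  define m where "m = nat \<lceil>log ?b ?x\<rceil>"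
  have nm: "n = Suc m" unfolding n m_def using log by (simp add: nat_add_distrib)
  have "log ?b ?x \<le> real m" unfolding m_def by (rule real_nat_ceiling_ge)
  then have "?x \<le> ?b powr real m" using b x by (simp add: log_le_iff)
  then have "?x \<le> ?b ^ m" using b by (simp add: powr_realpow)
  then have le: "real c + 1 \<le> ?b ^ m * (real p + 1)" by (simp add: pos_divide_le_eq)
  show ?thesis
  proof (cases m)
    case 0
    then show ?thesis using le nm by simp
  next
    case (Suc l)
    have "real c + 1 \<le> ?b ^ l * (?b * (real p + 1))" using le Suc by (simp add: algebra_simps)
    also have "\<dots> \<le> real p ^ l * (real p * real p)"
    proof (rule mult_mono)
      show "?b ^ l \<le> real p ^ l" using b by (intro power_mono) auto
      show "?b * (real p + 1) \<le> real p * real p" by (simp add: algebra_simps)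
    qed (use b in simp_all)
    also have "\<dots> = real (p ^ n)" by (simp add: nm Suc algebra_simps)
    finally have "real (c + 1) \<le> real (p ^ n)" by simp
    then show ?thesis using of_nat_le_iff by blast
  qed
qed

theorem theorem6p5:
  fixes G :: "('a, 'm) monoid_scheme" and p c k n :: nat
  assumes "prime p" and "odd p"
    and "group G" and "finite (carrier G)" and "order G = p ^ k"
    and "nilpotent_of_class G c" and "c \<ge> p"
    and "n = nat (1 + \<lceil>log (real p - 1) ((real c + 1) / (real p + 1))\<rceil>)"
  shows "group_exponent (exterior_square G) dvd group_exponent G ^ n \<and>
         group_exponent (schur_multiplier G) dvd group_exponent G ^ n"
proof -
  interpret X: group_tensor G by (simp add: group_tensor_def assms(3))
  have p3: "3 \<le> p" using assms(1,2) prime_ge_2_nat[OF assms(1)] by (cases "p = 2") auto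
  \<comment> \<open>The exponent divides the order, so it is a power of p, as the torsion arguments
    require.\<close>
  obtain l where e: "group_exponent G = p ^ l"
    using X.group_exponent_finite(1)[OF assms(4)] assms(1,5) by (metis divides_primepow_nat)
  have tors: "x [^]\<^bsub>G\<^esub> (p ^ l) = \<one>\<^bsub>G\<^esub>" if "x \<in> carrier G" for x
    using X.group_exponent_finite(2)[OF assms(4) that] e by simp
  have c: "lower_central G c = {\<one>\<^bsub>G\<^esub>}" using assms(6) by (simp add: nilpotent_of_class_def)
  have pow: "t [^]\<^bsub>exterior_square G\<^esub> (group_exponent G ^ n) = \<one>\<^bsub>exterior_square G\<^esub>"
    if "t \<in> carrier (exterior_square G)" for t
    using exterior_pairing.pow_eq_one[OF X.exterior_pairing assms(1,2) tors c
        ceiling_log_bound[OF p3 assms(7,8)] that] e by simp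
  have pos: "group_exponent G ^ n > 0" using e p3 by simp
  show ?thesis
    using X.ES.group_exponent_dvd[OF pos pow]
      group.group_exponent_dvd[OF schur_multiplier_pow_eq_one(1)[OF assms(3) pow] pos
        schur_multiplier_pow_eq_one(2)[OF assms(3) pow]] by simp
qed

end
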